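(* Let $p,t$ be real numbers such that $p>1$ and $t>-1$, let $d$ be a positive integer and let $\mu$ be a partition. Then the $\mu$-moment of the distribution $P_{d;1,t}$ is $$M_{p,\mu}\big(P_{d;1,t}\big)=\frac{q^{\,t|\mu|-\binom{l(\mu)}{2}}\,(q;q)_{l(\mu)}}{(-q^{\,d+t+1-l(\mu)};q)_{l(\mu)}}\begin{bmatrix}d\\ l(\mu)\end{bmatrix}_q .$$ Furthermore, the $\mu$-moment of the distribution $P_{\infty;1,t}$ is $$M_{p,\mu}\big(P_{\infty;1,t}\big)=p^{\binom{l(\mu)}{2}-t|\mu|}.$$
   Context: Partitions: a partition $\lambda=(\lambda_1,\lambda_2,\dots)$ is a weakly decreasing sequence of nonnegative integers with finite sum $|\lambda|$; $l(\lambda)$ is its number of positive parts; $\lambda'$ is the conjugate partition; $m_i(\lambda)=\lambda'_i-\lambda'_{i+1}$ is the number of parts equal to $i$; $n(\lambda):=\sum_{i\ge1}\binom{\lambda'_i}{2}$; $b_\lambda(q):=\prod_{i\ge1}(q;q)_{m_i(\lambda)}$. Throughout $q:=1/p\in(0,1)$, $(x;q)_\infty=\prod_{i\ge1}(1-xq^{i-1})$, $(x;q)_n=\prod_{i=1}^n(1-xq^{i-1})$ for $n\ge0$, and $\begin{bmatrix}m\\ n\end{bmatrix}_q=\frac{(q;q)_m}{(q;q)_n(q;q)_{m-n}}$ for $0\le n\le m$, and $0$ otherwise. For $0<u<p$ and $d$ a nonnegative integer, $$P_{d,u}(\lambda):=\frac{u^{|\lambda|}q^{2n(\lambda)+|\lambda|}}{b_\lambda(q)}(q;q)_{l(\lambda)}(uq;q)_d\begin{bmatrix}d\\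 l(\lambda)\end{bmatrix}_q,\qquad P_{\infty,u}(\lambda):=\lim_{d\to\infty}P_{d,u}(\lambda)=(uq;q)_\infty\frac{u^{|\lambda|}q^{2n(\lambda)+|\lambda|}}{b_\lambda(q)}.$$ For $t>-1$, $$P_{d;1,t}(\lambda):=P_{d,q^t}(\lambda)\,\frac{q^{-\binom{l(\lambda)}2}(q^{t+1};q)_{l(\lambda)}}{(q^{2t+2};q^2)_d},\qquad P_{\infty;1,t}(\lambda):=\lim_{d\to\infty}P_{d;1,t}(\lambda)=P_{\infty,q^t}(\lambda)\,\frac{q^{-\binom{l(\lambda)}2}(q^{t+1};q)_{l(\lambda)}}{(q^{2t+2};q^2)_\infty}.$$ Hall–Littlewood functions: for $l(\lambda)\le n$, $$P_\lambda(x_1,\dots,x_n;q)=\frac1{v_\lambda(q)}\sum_{w\in S_n}w\Big(x_1^{\lambda_1}\cdots x_n^{\lambda_n}\prod_{i<j}\frac{x_i-qx_j}{x_i-x_j}\Big),\quad v_\lambda(q)=\frac{(q;q)_{n-l(\lambda)}}{(1-q)^{n-l(\lambda)}}\prod_{i\ge1}\frac{(q;q)_{m_i(\lambda)}}{(1-q)^{m_i(\lambda)}},$$ where $S_n$ permutes the variables, extended by stability to symmetric functions in countably many variables; $Q_\lambda=b_\lambda(q)P_\lambda$. Define $g^\lambda_{\mu\nu}(q)$ by $Q_\mu Q_\nu=\sum_\lambda g^\lambda_{\mu\nu}(q)Q_\lambda$ and the skew function $P_{\lambda/\mu}:=\sum_\nu g^\lambda_{\mu\nu}(q)P_\nu$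 (zero unless $\mu_i\le\lambda_i$ for all $i$). For real $p>1$ put $$|\mathrm{Sur}_p(\lambda,\mu)|:=\frac{P_{\lambda/\mu}(q,q^2,\dots;q)}{P_\lambda(q,q^2,\dots;q)\,Q_\mu(1,q,q^2,\dots;q)};$$ when $p$ is prime this is the number of surjective homomorphisms $\bigoplus_i\mathbb Z/p^{\lambda_i}\mathbb{Z}\to\bigoplus_i\mathbb Z/p^{\mu_i}\mathbb{Z}$. The $\mu$-moment of a measure $\nu$ on partitions is $M_{p,\mu}(\nu):=\sum_\lambda\nu(\lambda)\,|\mathrm{Sur}_p(\lambda,\mu)|$. *)

theory Defs
  imports "HOL-Analysis.Analysis" "HOL-Combinatorics.Permutations"
begin

text \<open>Sequences are indexed from 0: the part $\lambda_{i+1}$ is \<open>la i\<close>.\<close>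

definition partitions :: "(nat \<Rightarrow> nat) set" where
  "partitions = {la. antimono la \<and> finite {i. la i \<noteq> 0}}"

definition psize :: "(nat \<Rightarrow> nat) \<Rightarrow> nat" where
  "psize la = (\<Sum>i | la i \<noteq> 0. la i)"

definition plength :: "(nat \<Rightarrow> nat) \<Rightarrow> nat" where
  "plength la = card {i. la i \<noteq> 0}"

text \<open>\<open>conj_part la i\<close> is $\lambda'_i$ and \<open>mult_part la i\<close> is $m_i(\lambda)$, both with $i \ge 1$.\<close>

definition conj_part :: "(nat \<Rightarrow> nat) \<Rightarrow> nat \<Rightarrow> nat" where
  "conj_part la i = card {j. i \<le> la j}"

definition mult_part :: "(nat \<Rightarrow> nat) \<Rightarrow> nat \<Rightarrow> nat" where
  "mult_part la i = conj_part la i - conj_part la (i + 1)"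

text \<open>
  Below, sums and products over all $i \ge 1$ stop at the largest part \<open>la 0\<close>, since
  $\lambda'_i = m_i(\lambda) = 0$ for larger \<open>i\<close>.
\<close>

definition pn :: "(nat \<Rightarrow> nat) \<Rightarrow> nat" where
  "pn la = (\<Sum>i = 1..la 0. conj_part la i choose 2)"

definition qpoch :: "real \<Rightarrow> real \<Rightarrow> nat \<Rightarrow> real" where
  "qpoch x q n = (\<Prod>i<n. 1 - x * q ^ i)"

definition qbinom :: "real \<Rightarrow> nat \<Rightarrow> nat \<Rightarrow> real" where
  "qbinom q m n = (if n \<le> m then qpoch q q m / (qpoch q q n * qpoch q q (m - n)) else 0)"

definition b_part :: "real \<Rightarrow> (nat \<Rightarrow> nat) \<Rightarrow> real" where
  "b_part q la = (\<Prod>i = 1..la 0. qpoch q q (mult_part la i))"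

definition P_d :: "real \<Rightarrow> nat \<Rightarrow> real \<Rightarrow> (nat \<Rightarrow> nat) \<Rightarrow> real" where
  "P_d q d u la =
     u ^ psize la * q ^ (2 * pn la + psize la) / b_part q la
       * qpoch q q (plength la) * qpoch (u * q) q d * qbinom q d (plength la)"

definition P_d1 :: "real \<Rightarrow> nat \<Rightarrow> real \<Rightarrow> (nat \<Rightarrow> nat) \<Rightarrow> real" where
  "P_d1 q d t la =
     P_d q d (q powr t) la
       * (q powr (- real (plength la choose 2)) * qpoch (q powr (t + 1)) q (plength la)
           / qpoch (q powr (2 * t + 2)) (q ^ 2) d)"

definition P_inf1 :: "real \<Rightarrow> real \<Rightarrow> (nat \<Rightarrow> nat) \<Rightarrow> real" where
  "P_inf1 q t la = lim (\<lambda>d. P_d1 q d t la)"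

text \<open>
  A symmetric function $f$ is represented by the values of its restrictions to finitely many
  variables: \<open>f n x\<close> is $f(x_1, \dots, x_n)$ with $x_{i+1}$ written \<open>x i\<close>. Only points with
  pairwise distinct coordinates are used. There the denominators $x_i - x_j$ do not vanish, and
  a real polynomial is determined by its values at such points. By stability, $P_\lambda$
  restricts to zero when there are fewer than $l(\lambda)$ variables.
\<close>

definition hl_v :: "real \<Rightarrow> nat \<Rightarrow> (nat \<Rightarrow> nat) \<Rightarrow> real" where
  "hl_v q n la =
     qpoch q q (n - plength la) / (1 - q) ^ (n - plength la)
       * (\<Prod>i = 1..la 0. qpoch q q (mult_part la i) / (1 - q) ^ mult_part la i)"

definition hl_P :: "real \<Rightarrow> (nat \<Rightarrow> nat) \<Rightarrow> nat \<Rightarrow> (nat \<Rightarrow> real) \<Rightarrow> real" where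
  "hl_P q la n x =
     (if plength la \<le> n then
        1 / hl_v q n la *
          (\<Sum>w | w permutes {..<n}.
             (\<Prod>i<n. x (w i) ^ la i)
               * (\<Prod>(i, j) \<in> {(i, j). i < j \<and> j < n}.
                    (x (w i) - q * x (w j)) / (x (w i) - x (w j))))
      else 0)"

definition hl_Q :: "real \<Rightarrow> (nat \<Rightarrow> nat) \<Rightarrow> nat \<Rightarrow> (nat \<Rightarrow> real) \<Rightarrow> real" where
  "hl_Q q la n x = b_part q la * hl_P q la n x"

text \<open>\<open>hl_g q mu nu la\<close> is the coefficient $g^\lambda_{\mu\nu}(q)$ of $Q_\lambda$ in $Q_\mu Q_\nu$.\<close>

definition hl_g :: "real \<Rightarrow> (nat \<Rightarrow> nat) \<Rightarrow> (nat \<Rightarrow> nat) \<Rightarrow> (nat \<Rightarrow> nat) \<Rightarrow> real" where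
  "hl_g q mu nu =
     (THE g. finite {la. g la \<noteq> 0} \<and> {la. g la \<noteq> 0} \<subseteq> partitions \<and>
        (\<forall>n x. inj_on x {..<n} \<longrightarrow>
           hl_Q q mu n x * hl_Q q nu n x = (\<Sum>la | g la \<noteq> 0. g la * hl_Q q la n x)))"

definition hl_P_skew ::
    "real \<Rightarrow> (nat \<Rightarrow> nat) \<Rightarrow> (nat \<Rightarrow> nat) \<Rightarrow> nat \<Rightarrow> (nat \<Rightarrow> real) \<Rightarrow> real" where
  "hl_P_skew q la mu n x =
     (\<Sum>nu | nu \<in> partitions \<and> hl_g q mu nu la \<noteq> 0. hl_g q mu nu la * hl_P q nu n x)"

text \<open>The value of a symmetric function at an infinite (summable) sequence of variables.\<close>

definition at_seq :: "(nat \<Rightarrow> (nat \<Rightarrow> real) \<Rightarrow> real) \<Rightarrow> (nat \<Rightarrow> real) \<Rightarrow> real" where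
  "at_seq f x = lim (\<lambda>n. f n x)"

text \<open>
  For prime \<open>p\<close> this is the number of surjective homomorphisms from the finite abelian $p$-group of
  type $\lambda$ onto the one of type $\mu$.
\<close>

definition sur :: "real \<Rightarrow> (nat \<Rightarrow> nat) \<Rightarrow> (nat \<Rightarrow> nat) \<Rightarrow> real" where
  "sur p la mu =
     (let q = 1 / p in
        at_seq (hl_P_skew q la mu) (\<lambda>i. q ^ (i + 1))
          / (at_seq (hl_P q la) (\<lambda>i. q ^ (i + 1)) * at_seq (hl_Q q mu) (\<lambda>i. q ^ i)))"

definition moment :: "real \<Rightarrow> (nat \<Rightarrow> nat) \<Rightarrow> ((nat \<Rightarrow> nat) \<Rightarrow> real) \<Rightarrow> real" where
  "moment p mu nu = (\<Sum>\<^sub>\<infinity>la\<in>partitions. nu la * sur p la mu)"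

end

theory Submission imports Defs
begin

text \<open>
  The surjection numbers have a product formula in the columns of both partitions,
  $|\mathrm{Sur}(\lambda,\mu)| = \prod_i p^{\lambda'_i\mu'_i}
  (q;q)_{\lambda'_i-\mu'_{i+1}} / (q;q)_{\lambda'_i-\mu'_i}$.
  Indeed $P_{\lambda/\mu}(q,q^2,\dots)$ is, up to explicit factors, the coefficient of $P_\lambda$ in
  $h_r P_\mu$ where $h_r = \sum_{|\nu|=r} q^{n(\nu)} P_\nu$. This coefficient follows from the Pieri rule for
  $e_r P_\mu$, because the relation $\sum_i (-1)^i e_i h_{r-i} = 0$ becomes an identity that factorises over
  the columns. The same Pieri rule expresses every $P_\mu$ through products of the $e_r$, so that the
  structure constants exist; they are unique by a comparison of orders of vanishing.

  Given the product formula, the sum over $\lambda$ is evaluated one column at a time. The sum over each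
  column is an instance of the $q$-Chu--Vandermonde summation, except for the first column, where the weight
  of $P_{d;1,t}$ leads to the $q$-binomial theorem and that of $P_{\infty;1,t}$ to Euler's expansion of
  $(-uq;q)_\infty$ with $u = q^t$.
\<close>

section \<open>$q$-series\<close>

text \<open>For real p there are no homomorphisms to count, so the surjection numbers have to come
  out of the symmetric functions. Since \<open>hl_g\<close> is a definite description, nothing can
  be said about it before products of Hall-Littlewood functions are known to have unique expansions.
  Single structure constants are never computed: at q, q^2, ... the function P_nu equals q^(|nu| +
  n(nu)) / b_nu, so only the sum of g over nu with these weights enters.

  Column lengths are the right coordinates because n, b, the Pieri coefficients and the surjection
  numbers become products of factors that couple only neighbouring columns. Summing over lambda is
  then a transfer process in which a column c sees its right neighbour c' only through 1/(q;q)_(c -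
  c'); hence the weight 1/(q;q)_(k - c_0) of the intermediate sums. Peeling columns off mu ends at
  the empty partition, where infinitely many lambda remain and the recursion refers back to itself;
  there a monotone limit takes the place of the induction. Nonnegativity of all terms yields
  summability along with the values.\<close>

lemma square_eq_choose: "l\<^sup>2 = 2 * (l choose 2) + (l :: nat)"
  by (induction l) (auto simp: numeral_2_eq_2 power2_eq_square)

lemma choose_two_add: "(m + s choose 2) = (m choose 2) + (s choose 2) + m * s"
  by (induction s) (auto simp: numeral_2_eq_2)

text \<open>The exponent balance behind \<open>sur_eq\<close>: the cross term l * m is what turns
  into the power p^(l m).\<close>

lemma choose_two_diff:
  assumes "m \<le> l"
  shows "(l - m choose 2) + l * m = (l choose 2) + (m choose 2) + m"
proof -
  obtain d where l: "l = m + d" using assms le_Suc_ex by blast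
  have "(d choose 2) + (m + d) * m = (m + d choose 2) + (m choose 2) + m"
  proof (induction d)
    case 0
    have "m * m = (m choose 2) + (m choose 2) + m" by (induction m) (auto simp: numeral_2_eq_2)
    then show ?case by (simp add: numeral_2_eq_2)
  next
    case (Suc d)
    have "Suc j choose 2 = (j choose 2) + j" for j by (simp add: numeral_2_eq_2)
    then show ?case using Suc by simp
  qed
  then show ?thesis unfolding l by simp
qed

lemma qpoch_0 [simp]: "qpoch x q 0 = 1"
  by (simp add: qpoch_def)

lemma qpoch_Suc: "qpoch x q (Suc n) = qpoch x q n * (1 - x * q ^ n)"
  by (simp add: qpoch_def)

lemma qpoch_Suc_shift: "qpoch x q (Suc n) = (1 - x) * qpoch (x * q) q n"
  unfolding qpoch_def prod.lessThan_Suc_shift by (simp add: mult.assoc)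

lemma qpoch_add: "qpoch x q (m + n) = qpoch x q m * qpoch (x * q ^ m) q n"
  by (induction n) (simp_all add: qpoch_Suc power_add algebra_simps)

text \<open>Negative x is included because the denominators of the moments have the form
  (-x;q)_n.\<close>

lemma qpoch_pos:
  assumes "0 < q" "q < 1" "x < 1"
  shows "qpoch x q n > 0"
  unfolding qpoch_def
proof (rule prod_pos, safe)
  fix i :: nat
  have "x * q ^ i < 1"
  proof (cases "x \<le> 0")
    case True
    then show ?thesis using assms by (smt (verit) mult_nonpos_nonneg zero_less_power)
  next
    case False
    then have "x * q ^ i \<le> x * 1" using assms by (intro mult_left_mono power_le_one) auto
    then show ?thesis using assms by simp
  qed
  then show "0 < 1 - x * q ^ i" by simp
qed

lemma qbinom_0 [simp]:
  assumes "0 < q" "q < 1"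
  shows "qbinom q m 0 = 1"
  using qpoch_pos[of q q m] assms by (simp add: qbinom_def)

lemma qbinom_self [simp]:
  assumes "0 < q" "q < 1"
  shows "qbinom q m m = 1"
  using qpoch_pos[of q q m] assms by (simp add: qbinom_def)

lemma qbinom_eq_0 [simp]: "m < j \<Longrightarrow> qbinom q m j = 0"
  by (simp add: qbinom_def)

lemma qbinom_nonneg:
  assumes "0 < q" "q < 1"
  shows "qbinom q m j \<ge> 0"
  using qpoch_pos[of q q] assms by (simp add: qbinom_def less_imp_le)

text \<open>Of the two q-Pascal rules this is the one met when the last position of a block is
  peeled off: q^(m - j) is the price in \<open>hl_sum_block\<close> for moving that position forward
  past m - j unchosen ones.\<close>

lemma qbinom_Suc_Suc:
  assumes q: "0 < q" "q < 1"
  shows "qbinom q (Suc m) (Suc j) = qbinom q m (Suc j) + q ^ (m - j) * qbinom q m j"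
proof -
  consider "m < j" | "m = j" | k where "m = Suc j + k"
    by (metis add_Suc less_iff_Suc_add linorder_neqE_nat)
  then show ?thesis
  proof cases
    case 1
    then show ?thesis by simp
  next
    case 2
    then show ?thesis using q by simp
  next
    case 3
    have nz: "qpoch q q j \<noteq> 0" "qpoch q q k \<noteq> 0" "1 - q * q ^ j \<noteq> 0" "1 - q * q ^ k \<noteq> 0"
      using qpoch_pos[OF q q(2), of j] qpoch_pos[OF q q(2), of k]
        qpoch_pos[OF q q(2), of "Suc j"] qpoch_pos[OF q q(2), of "Suc k"]
      by (auto simp: qpoch_Suc)
    have e1: "Suc j \<le> Suc m" "Suc j \<le> m" "j \<le> m" "Suc m - Suc j = Suc k" "m - Suc j = k"
      "m - j = Suc k" using 3 by auto
    have e2: "qpoch q q (Suc m) = qpoch q q m * (1 - q * q ^ m)" by (rule qpoch_Suc)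
    have e3: "q ^ m = q * q ^ j * q ^ k" using 3 by (simp add: power_add)
    show ?thesis
      unfolding qbinom_def using e1 nz unfolding e1 e2 e3 qpoch_Suc
      by (simp add: divide_simps) (simp add: algebra_simps)
  qed
qed

text \<open>The finite q-binomial theorem. By the q-Pascal rule the term with s + 1 chosen factors
  splits according to whether the last factor 1 + x q^n is chosen.\<close>

lemma qpoch_eq_sum_qbinom:
  assumes q: "0 < q" "q < 1"
  shows "qpoch (- x) q n = (\<Sum>s\<le>n. q ^ (s choose 2) * x ^ s * qbinom q n s)"
proof (induction n)
  case 0
  show ?case using q by (simp add: numeral_2_eq_2)
next
  case (Suc n)
  let ?f = "\<lambda>n s. q ^ (s choose 2) * x ^ s * qbinom q n s"
  have step: "?f (Suc n) (Suc s) = ?f n (Suc s) + x * q ^ n * ?f n s" if "s \<le> n" for s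
  proof -
    have "Suc s choose 2 = (s choose 2) + s" by (simp add: numeral_2_eq_2)
    then have "q ^ (Suc s choose 2) * q ^ (n - s) = q ^ (s choose 2) * q ^ n"
      using that by (simp flip: power_add)
    then have "q ^ (Suc s choose 2) * x ^ Suc s * (q ^ (n - s) * qbinom q n s)
      = x * q ^ n * ?f n s"
      by (metis (no_types, lifting) mult.assoc mult.commute power_Suc)
    then show ?thesis by (simp add: qbinom_Suc_Suc[OF q] algebra_simps)
  qed
  have "(\<Sum>s\<le>Suc n. ?f (Suc n) s) = ?f (Suc n) 0 + (\<Sum>s\<le>n. ?f (Suc n) (Suc s))"
    by (rule sum.atMost_Suc_shift)
  also have "(\<Sum>s\<le>n. ?f (Suc n) (Suc s)) = (\<Sum>s\<le>n. ?f n (Suc s)) + x * q ^ n * (\<Sum>s\<le>n. ?f n s)"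
    using step by (simp add: sum.distrib sum_distrib_left)
  also have "?f (Suc n) 0 + ((\<Sum>s\<le>n. ?f n (Suc s)) + x * q ^ n * (\<Sum>s\<le>n. ?f n s))
    = (\<Sum>s\<le>Suc n. ?f n s) + x * q ^ n * (\<Sum>s\<le>n. ?f n s)"
    unfolding sum.atMost_Suc_shift[of "?f n"] using q by (simp add: numeral_2_eq_2)
  also have "(\<Sum>s\<le>Suc n. ?f n s) = (\<Sum>s\<le>n. ?f n s)" by simp
  finally show ?case using Suc by (simp add: qpoch_Suc algebra_simps)
qed

lemma sum_qbinom_alternating:
  assumes q: "0 < q" "q < 1" and "n > 0"
  shows "(\<Sum>s\<le>n. (- 1) ^ s * q ^ (s choose 2) * qbinom q n s) = 0"
proof -
  have "qpoch 1 q n = 0" using \<open>n > 0\<close> unfolding qpoch_def by (intro prod_zero) (auto intro!: bexI[of _ 0])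
  then show ?thesis using qpoch_eq_sum_qbinom[OF q, of "-1" n] by (simp add: mult_ac)
qed

text \<open>A limiting case of the q-Chu-Vandermonde sum. The second half of the q-Pascal rule,
  after 1 - v q is split off the denominator, reproduces the sum of length n at v * q; hence the
  induction runs over all v at once.\<close>

lemma qbinom_vandermonde:
  assumes q: "0 < q" "q < 1" and v: "0 \<le> v" "v * q < 1"
  shows "(\<Sum>s\<le>n. v ^ s * q ^ s\<^sup>2 * qbinom q n s / qpoch (v * q) q s) = 1 / qpoch (v * q) q n"
  using v
proof (induction n arbitrary: v)
  case 0
  show ?case using q by (simp add: qbinom_def)
next
  case (Suc n)
  let ?f = "\<lambda>n v s. v ^ s * q ^ s\<^sup>2 * qbinom q n s / qpoch (v * q) q s"
  have vq: "v * q * q < 1" using Suc.prems q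
    by (smt (verit, best) mult_left_le mult_nonneg_nonneg)
  have pos: "qpoch (v * q) q n > 0" "qpoch (v * q) q (Suc n) > 0" "qpoch (v * q * q) q n > 0"
    using qpoch_pos q Suc.prems vq by auto
  have step: "?f (Suc n) v (Suc s) = ?f n v (Suc s) + v * q ^ Suc n / (1 - v * q) * ?f n (v * q) s"
    if "s \<le> n" for s
  proof -
    have "(Suc s)\<^sup>2 + (n - s) = s\<^sup>2 + s + Suc n" using that by (simp add: power2_eq_square)
    then have "q ^ (Suc s)\<^sup>2 * q ^ (n - s) = q ^ s\<^sup>2 * q ^ s * q ^ Suc n"
      by (simp only: flip: power_add)
    then have "v ^ Suc s * q ^ (Suc s)\<^sup>2 * (q ^ (n - s) * qbinom q n s)
      = v * q ^ Suc n * ((v * q) ^ s * q ^ s\<^sup>2 * qbinom q n s)"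
      by (simp add: power_mult_distrib mult_ac)
    then have *: "v ^ Suc s * q ^ (Suc s)\<^sup>2 * (q ^ (n - s) * qbinom q n s) / ((1 - v * q) * qpoch (v * q * q) q s)
      = v * q ^ Suc n / (1 - v * q) * ?f n (v * q) s"
      by simp
    show ?thesis
      unfolding qbinom_Suc_Suc[OF q] using *
      by (simp only: qpoch_Suc_shift[of "v * q"] distrib_left add_divide_distrib)
  qed
  have "(\<Sum>s\<le>Suc n. ?f (Suc n) v s) = ?f (Suc n) v 0 + (\<Sum>s\<le>n. ?f (Suc n) v (Suc s))"
    by (rule sum.atMost_Suc_shift)
  also have "(\<Sum>s\<le>n. ?f (Suc n) v (Suc s))
    = (\<Sum>s\<le>n. ?f n v (Suc s)) + v * q ^ Suc n / (1 - v * q) * (\<Sum>s\<le>n. ?f n (v * q) s)"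
    unfolding sum_distrib_left sum.distrib[symmetric] by (intro sum.cong refl step) simp
  also have "(\<Sum>s\<le>n. ?f n (v * q) s) = 1 / qpoch (v * q * q) q n"
    using Suc.IH[of "v * q"] Suc.prems q vq by simp
  also have "?f (Suc n) v 0 + ((\<Sum>s\<le>n. ?f n v (Suc s)) + v * q ^ Suc n / (1 - v * q) * (1 / qpoch (v * q * q) q n))
    = (\<Sum>s\<le>Suc n. ?f n v s) + v * q ^ Suc n / qpoch (v * q) q (Suc n)"
    unfolding sum.atMost_Suc_shift[of "?f n v"] qpoch_Suc_shift[of "v * q" q n] using q by simp
  also have "(\<Sum>s\<le>Suc n. ?f n v s) = 1 / qpoch (v * q) q n" using Suc by simp
  also have "1 / qpoch (v * q) q n = (1 - v * q * q ^ n) / qpoch (v * q) q (Suc n)"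
    using pos by (auto simp: qpoch_Suc zero_less_mult_iff)
  also have "\<dots> + v * q ^ Suc n / qpoch (v * q) q (Suc n) = 1 / qpoch (v * q) q (Suc n)"
    unfolding add_divide_distrib[symmetric] by simp
  finally show ?case .
qed

text \<open>Shifted by l, the quotient is (q^(n+1);q)_l, a product of l factors that each tend to
  1.\<close>

lemma qpoch_ratio_limit:
  assumes q: "0 < q" "q < 1"
  shows "(\<lambda>n. qpoch q q n / qpoch q q (n - l)) \<longlonglongrightarrow> 1"
proof (rule LIMSEQ_offset)
  have q0: "(\<lambda>n. q ^ n) \<longlonglongrightarrow> 0" using q by (intro LIMSEQ_realpow_zero) auto
  have "(\<lambda>n. qpoch (q * q ^ n) q l) \<longlonglongrightarrow> (\<Prod>i<l. 1 - q * 0 * q ^ i)"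
    unfolding qpoch_def by (intro tendsto_intros q0)
  moreover have "qpoch q q (n + l) / qpoch q q (n + l - l) = qpoch (q * q ^ n) q l" for n
    using qpoch_add[of q q n l] qpoch_pos[of q q n] q by simp
  ultimately show "(\<lambda>n. qpoch q q (n + l) / qpoch q q (n + l - l)) \<longlonglongrightarrow> 1" by simp
qed

lemma qbinom_limit:
  assumes q: "0 < q" "q < 1"
  shows "(\<lambda>n. qbinom q n s) \<longlonglongrightarrow> 1 / qpoch q q s"
proof -
  have "(\<lambda>n. 1 / qpoch q q s * (qpoch q q n / qpoch q q (n - s))) \<longlonglongrightarrow> 1 / qpoch q q s * 1"
    by (intro tendsto_mult_left qpoch_ratio_limit[OF q])
  moreover have "eventually (\<lambda>n. 1 / qpoch q q s * (qpoch q q n / qpoch q q (n - s)) = qbinom q n s) sequentially"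
    using eventually_ge_at_top[of s] by eventually_elim (simp add: qbinom_def)
  ultimately show ?thesis by (simp add: Lim_transform_eventually)
qed

text \<open>The limit in \<open>qbinom_limit\<close> is also an upper bound, since (q;q)_n /
  (q;q)_(n - s) is a product of factors at most 1. This gives the lower half of the squeeze in
  \<open>euler_expansion\<close>.\<close>

lemma qbinom_le:
  assumes q: "0 < q" "q < 1"
  shows "qbinom q n s \<le> 1 / qpoch q q s"
proof (cases "s \<le> n")
  case True
  have pos: "qpoch q q i > 0" for i using qpoch_pos q by simp
  have "qpoch (q * q ^ (n - s)) q s \<le> 1"
    unfolding qpoch_def
  proof (rule prod_le_1)
    fix i
    have "q * q ^ (n - s) * q ^ i = q ^ Suc (n - s + i)" by (simp add: power_add)
    also have "\<dots> \<le> 1" using q by (intro power_le_one) auto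
    finally show "0 \<le> 1 - q * q ^ (n - s) * q ^ i \<and> 1 - q * q ^ (n - s) * q ^ i \<le> 1" using q by simp
  qed
  then have "qpoch q q n \<le> qpoch q q (n - s)"
    using qpoch_add[of q q "n - s" s] True pos[of "n - s"] by (simp add: mult_le_cancel_left2)
  then have "qpoch q q n / qpoch q q (n - s) \<le> 1" using pos by simp
  then have "1 / qpoch q q s * (qpoch q q n / qpoch q q (n - s)) \<le> 1 / qpoch q q s * 1"
    using pos by (intro mult_left_mono) (auto simp: less_imp_le)
  then show ?thesis using True by (simp add: qbinom_def)
qed (use qpoch_pos[of q q s] q in simp)

section \<open>Nonnegative sums and Euler's expansion\<close>

text \<open>Monotone convergence: every finite subset of A lies in some \<open>F n\<close>, so the
  sums over the \<open>F n\<close> dominate all finite sums.\<close>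

lemma has_sum_nonneg_exhaustion:
  fixes f :: "'a \<Rightarrow> real"
  assumes nonneg: "\<And>a. a \<in> A \<Longrightarrow> f a \<ge> 0"
    and F: "\<And>n. finite (F n)" "incseq F" "(\<Union>n. F n) = A"
    and lim: "(\<lambda>n. sum f (F n)) \<longlonglongrightarrow> S"
  shows "(f has_sum S) A"
proof -
  have FA: "F n \<subseteq> A" for n using F(3) by auto
  have inc: "incseq (\<lambda>n. sum f (F n))"
  proof (intro incseq_SucI sum_mono2)
    show "F n \<subseteq> F (Suc n)" for n using F(2) by (simp add: incseq_Suc_iff)
    show "f b \<ge> 0" if "b \<in> F (Suc n) - F n" for n b using nonneg FA that by blast
  qed (rule F(1))
  have le: "sum f (F n) \<le> S" for n by (rule incseq_le[OF inc lim])
  have bound: "sum f X \<le> S" if X: "finite X" "X \<subseteq> A" for X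
  proof -
    have "\<exists>n. X \<subseteq> F n" using X
    proof (induction X rule: finite_induct)
      case (insert a X)
      then obtain n n' where "X \<subseteq> F n" "a \<in> F n'" using F(3) by auto
      moreover have "F n \<subseteq> F (max n n')" "F n' \<subseteq> F (max n n')" using incseqD[OF F(2)] by (meson max.cobounded1 max.cobounded2)+
      ultimately show ?case by (intro exI[of _ "max n n'"]) auto
    qed auto
    then obtain n where "X \<subseteq> F n" by blast
    then have "sum f X \<le> sum f (F n)" using F(1) nonneg subsetD[OF FA] by (intro sum_mono2) auto
    with le show ?thesis by (meson order_trans)
  qed
  have summ: "f summable_on A"
    using nonneg bound by (intro nonneg_bdd_above_summable_on) (auto intro!: bdd_aboveI2[where M = S])
  have "infsum f A \<le> S" using bound summ by (intro infsum_le_finite_sums) auto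
  moreover have "S \<le> infsum f A"
    using lim by (rule LIMSEQ_le_const2) (use F(1) FA nonneg summ in \<open>auto intro!: exI[of _ 0] finite_sum_le_infsum\<close>)
  ultimately show ?thesis using summ by (simp add: has_sum_infsum has_sum_iff)
qed

text \<open>E is (-x;q)_infinity, kept as a limit. The partial sums of the series lie between
  (-x;q)_n, by \<open>qbinom_le\<close>, and E, because truncating the q-binomial theorem for a
  large N loses only nonnegative terms.\<close>

lemma euler_expansion:
  assumes q: "0 < q" "q < 1" and x: "x \<ge> 0"
  obtains E where "E > 0" "(\<lambda>n. qpoch (- x) q n) \<longlonglongrightarrow> E"
    "((\<lambda>s. q ^ (s choose 2) * x ^ s / qpoch q q s) has_sum E) UNIV"
proof -
  let ?f = "\<lambda>n. qpoch (- x) q n" and ?a = "\<lambda>s. q ^ (s choose 2) * x ^ s"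
  have f1: "?f n \<ge> 1" for n
    unfolding qpoch_def using x q by (intro prod_ge_1) auto
  have inc: "incseq ?f"
  proof (rule incseq_SucI)
    show "?f n \<le> ?f (Suc n)" for n
      using f1[of n] x q by (simp add: qpoch_Suc mult_le_cancel_left1)
  qed
  \<comment> \<open>The bound 1 + y \<le> exp y turns the product into a geometric series in the
    exponent, hence an estimate independent of n.\<close>
  have "?f n \<le> exp (x / (1 - q))" for n
  proof -
    have "?f n \<le> (\<Prod>i<n. exp (x * q ^ i))"
      unfolding qpoch_def using x q by (intro prod_mono) (auto simp: exp_ge_add_one_self)
    also have "\<dots> = exp (x * (\<Sum>i<n. q ^ i))" by (simp add: exp_sum sum_distrib_left)
    also have "(\<Sum>i<n. q ^ i) = (1 - q ^ n) / (1 - q)" using q by (simp add: sum_gp_strict)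
    also have "exp (x * ((1 - q ^ n) / (1 - q))) \<le> exp (x / (1 - q))"
      using x q by (simp add: divide_right_mono mult_left_le)
    finally show ?thesis .
  qed
  then obtain E where E: "?f \<longlonglongrightarrow> E" using incseq_convergent[OF inc] by blast
  have le: "?f n \<le> E" for n by (rule incseq_le[OF inc E])
  have a0: "?a s \<ge> 0" for s using x q by simp
  have up: "(\<Sum>s\<le>n. ?a s / qpoch q q s) \<le> E" for n
  proof (rule LIMSEQ_le_const2)
    have "(\<lambda>N. \<Sum>s\<le>n. ?a s * qbinom q N s) \<longlonglongrightarrow> (\<Sum>s\<le>n. ?a s * (1 / qpoch q q s))"
      by (intro tendsto_sum tendsto_mult_left qbinom_limit[OF q])
    then show "(\<lambda>N. \<Sum>s\<le>n. ?a s * qbinom q N s) \<longlonglongrightarrow> (\<Sum>s\<le>n. ?a s / qpoch q q s)" by simp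
    have "(\<Sum>s\<le>n. ?a s * qbinom q N s) \<le> E" if "N \<ge> n" for N
    proof -
      have "(\<Sum>s\<le>n. ?a s * qbinom q N s) \<le> (\<Sum>s\<le>N. ?a s * qbinom q N s)"
        using that a0 qbinom_nonneg[OF q] by (intro sum_mono2) auto
      also have "\<dots> = ?f N" by (rule qpoch_eq_sum_qbinom[OF q, symmetric])
      finally show ?thesis using le[of N] by simp
    qed
    then show "\<exists>N. \<forall>M\<ge>N. (\<Sum>s\<le>n. ?a s * qbinom q M s) \<le> E" by blast
  qed
  have low: "?f n \<le> (\<Sum>s\<le>n. ?a s / qpoch q q s)" for n
    unfolding qpoch_eq_sum_qbinom[OF q]
  proof (rule sum_mono)
    fix s
    show "?a s * qbinom q n s \<le> ?a s / qpoch q q s"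
      using mult_left_mono[OF qbinom_le[OF q, of n s] a0[of s]] by simp
  qed
  have "(\<lambda>n. \<Sum>s\<le>n. ?a s / qpoch q q s) \<longlonglongrightarrow> E"
    by (rule tendsto_sandwich[OF _ _ E tendsto_const]) (use up low in auto)
  then have "((\<lambda>s. ?a s / qpoch q q s) has_sum E) UNIV"
    using a0 qpoch_pos[of q q] q
    by (intro has_sum_nonneg_exhaustion[where F = "\<lambda>n. {..n}"])
       (auto simp: incseq_def less_imp_le)
  moreover have "E > 0" using f1[of 0] le[of 0] by simp
  ultimately show ?thesis using that E by blast
qed

section \<open>Partitions and their columns\<close>

lemma partitionsD:
  assumes "la \<in> partitions"
  shows "antimono la" "finite {i. la i \<noteq> 0}"
  using assms by (auto simp: partitions_def)

lemma partition_le: "la \<in> partitions \<Longrightarrow> i \<le> j \<Longrightarrow> la j \<le> la i"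
  by (auto simp: partitions_def antimono_def)

lemma lessThan_eq_of_down_closed:
  fixes S :: "nat set"
  assumes "finite S" "\<And>i j. j \<in> S \<Longrightarrow> i \<le> j \<Longrightarrow> i \<in> S"
  shows "S = {..<card S}"
proof (cases "S = {}")
  case False
  have "S = {..Max S}"
  proof
    show "S \<subseteq> {..Max S}" using assms(1) by auto
    show "{..Max S} \<subseteq> S" using assms(2)[OF Max_in[OF assms(1) False]] by auto
  qed
  then show ?thesis by (metis card_atMost lessThan_Suc_atMost)
qed simp

text \<open>Column lengths are indexed from 0: \<open>cnj la k\<close> is $\lambda'_{k+1}$.\<close>

definition cnj :: "(nat \<Rightarrow> nat) \<Rightarrow> nat \<Rightarrow> nat" where
  "cnj la k = card {j. k < la j}"

lemma conj_part_Suc: "conj_part la (Suc k) = cnj la k"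
  by (simp add: conj_part_def cnj_def Suc_le_eq)

lemma plength_eq_cnj: "plength la = cnj la 0"
  by (simp add: plength_def cnj_def)

text \<open>The rows longer than k form an initial segment, so rows and columns are linked by a
  Galois connection. Most facts about \<open>cnj\<close> below are read off from this
  equivalence.\<close>

lemma less_cnj_iff:
  assumes "la \<in> partitions"
  shows "j < cnj la k \<longleftrightarrow> k < la j"
proof -
  have "{j. k < la j} = {..<card {j. k < la j}}"
  proof (rule lessThan_eq_of_down_closed)
    show "finite {j. k < la j}"
      by (rule finite_subset[OF _ partitionsD(2)[OF assms]]) auto
    show "i \<in> {j. k < la j}" if "j \<in> {j. k < la j}" "i \<le> j" for i j
      using that partition_le[OF assms that(2)] by simp
  qed
  then show ?thesis unfolding cnj_def by auto
qed

lemma cnj_cnj: "la \<in> partitions \<Longrightarrow> cnj (cnj la) = la"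
  by (rule ext) (simp add: cnj_def[of "cnj la"] less_cnj_iff)

lemma partition_support: "la \<in> partitions \<Longrightarrow> la i \<noteq> 0 \<longleftrightarrow> i < cnj la 0"
  by (simp add: less_cnj_iff)

lemma cnj_in_partitions:
  assumes "la \<in> partitions"
  shows "cnj la \<in> partitions"
proof -
  have "cnj la j \<le> cnj la i" if "i \<le> j" for i j
  proof (rule ccontr)
    assume "\<not> cnj la j \<le> cnj la i"
    then have "cnj la i < cnj la j" by simp
    then have "j < la (cnj la i)" using less_cnj_iff[OF assms] by blast
    then show False using less_cnj_iff[OF assms, of "cnj la i" i] that by simp
  qed
  moreover have "{k. cnj la k \<noteq> 0} \<subseteq> {..<la 0}"
    using less_cnj_iff[OF assms, of 0] by auto
  ultimately show ?thesis
    unfolding partitions_def antimono_def using finite_subset by blast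
qed

lemma cnj_eq_0: "la \<in> partitions \<Longrightarrow> k \<ge> la 0 \<Longrightarrow> cnj la k = 0"
  using less_cnj_iff[of la 0 k] by simp

lemma bij_betw_cnj: "bij_betw cnj partitions partitions"
  by (rule bij_betw_byWitness[where f' = cnj]) (auto simp: cnj_cnj cnj_in_partitions)

lemma cnj_0: "la \<in> partitions \<Longrightarrow> cnj la 0 = plength la"
  by (simp add: plength_eq_cnj)

lemma plength_cnj: "la \<in> partitions \<Longrightarrow> plength (cnj la) = la 0"
  by (simp add: plength_eq_cnj cnj_cnj)

lemma psize_eq_sum:
  assumes "\<And>k. k \<ge> N \<Longrightarrow> la k = 0"
  shows "psize la = (\<Sum>k<N. la k)"
  unfolding psize_def by (rule sum.mono_neutral_left) (auto, metis assms not_less less_numeral_extra(3))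

text \<open>Both sides count the boxes of the Young diagram, by columns and by rows.\<close>

lemma psize_cnj:
  assumes "la \<in> partitions"
  shows "psize (cnj la) = psize la"
proof -
  have 1: "cnj la k = (\<Sum>j<cnj la 0. if j < cnj la k then 1 else 0)" for k
  proof -
    have "cnj la k \<le> cnj la 0" using partition_le[OF cnj_in_partitions[OF assms]] by simp
    then have "{..<cnj la 0} \<inter> {j. j < cnj la k} = {..<cnj la k}" by auto
    then show ?thesis by (simp add: sum.If_cases)
  qed
  have 2: "la j = (\<Sum>k<la 0. if k < la j then 1 else 0)" for j
  proof -
    have "la j \<le> la 0" using partition_le[OF assms] by simp
    then have "{..<la 0} \<inter> {k. k < la j} = {..<la j}" by auto
    then show ?thesis by (simp add: sum.If_cases)
  qed
  have "psize (cnj la) = (\<Sum>k<la 0. cnj la k)"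
    by (rule psize_eq_sum) (rule cnj_eq_0[OF assms])
  also have "\<dots> = (\<Sum>k<la 0. \<Sum>j<cnj la 0. if j < cnj la k then 1 else 0)"
    by (intro sum.cong refl 1)
  also have "\<dots> = (\<Sum>j<cnj la 0. \<Sum>k<la 0. if k < la j then 1 else 0)"
    by (subst sum.swap) (simp add: less_cnj_iff[OF assms])
  also have "\<dots> = (\<Sum>j<cnj la 0. la j)" by (intro sum.cong refl 2[symmetric])
  also have "\<dots> = psize la"
    by (rule psize_eq_sum[symmetric]) (metis assms not_less partition_support)
  finally show ?thesis .
qed

text \<open>The free bound N lets products attached to two different partitions run over one common
  range; the additional factors are 1.\<close>

lemma b_part_eq:
  assumes "la \<in> partitions" "la 0 \<le> N"
  shows "b_part q la = (\<Prod>k<N. qpoch q q (cnj la k - cnj la (Suc k)))"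
proof -
  have "b_part q la = (\<Prod>k<la 0. qpoch q q (cnj la k - cnj la (Suc k)))"
    unfolding b_part_def by (rule prod.reindex_bij_witness[of _ Suc "\<lambda>i. i - 1"]) (auto simp: mult_part_def simp flip: conj_part_Suc)
  also have "\<dots> = (\<Prod>k<N. qpoch q q (cnj la k - cnj la (Suc k)))"
    using assms by (intro prod.mono_neutral_left) (auto simp: cnj_eq_0)
  finally show ?thesis .
qed

lemma pn_eq:
  assumes "la \<in> partitions" "la 0 \<le> N"
  shows "pn la = (\<Sum>k<N. cnj la k choose 2)"
proof -
  have "pn la = (\<Sum>k<la 0. cnj la k choose 2)"
    unfolding pn_def by (rule sum.reindex_bij_witness[of _ Suc "\<lambda>i. i - 1"]) (auto simp flip: conj_part_Suc)
  also have "\<dots> = (\<Sum>k<N. cnj la k choose 2)"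
    using assms by (intro sum.mono_neutral_left) (auto simp: cnj_eq_0 numeral_2_eq_2)
  finally show ?thesis .
qed

lemma sum_cnj_diff:
  assumes "la \<in> partitions"
  shows "(\<Sum>k<la 0. cnj la k - cnj la (Suc k)) = cnj la 0"
proof -
  have "(\<Sum>k<N. cnj la k - cnj la (Suc k)) + cnj la N = cnj la 0" for N
  proof (induction N)
    case (Suc N)
    have "cnj la (Suc N) \<le> cnj la N" using partition_le[OF cnj_in_partitions[OF assms]] by simp
    with Suc show ?case by simp
  qed simp
  from this[of "la 0"] show ?thesis by (simp add: cnj_eq_0[OF assms])
qed

lemma plength_le_psize:
  assumes "la \<in> partitions"
  shows "plength la \<le> psize la"
  unfolding plength_def psize_def
  using sum_mono[of "{i. la i \<noteq> 0}" "\<lambda>_. 1" la] by (auto simp: Suc_le_eq)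

lemma finite_partitions_psize: "finite {la \<in> partitions. psize la = k}"
proof (rule finite_subset)
  show "finite {f. \<forall>i. (i \<in> {..<k} \<longrightarrow> f i \<in> {..k}) \<and> (i \<notin> {..<k} \<longrightarrow> f i = (0::nat))}"
    by (rule finite_set_of_finite_funs) auto
  show "{la \<in> partitions. psize la = k} \<subseteq> {f. \<forall>i. (i \<in> {..<k} \<longrightarrow> f i \<in> {..k}) \<and> (i \<notin> {..<k} \<longrightarrow> f i = 0)}"
  proof (rule subsetI)
    fix la assume "la \<in> {la \<in> partitions. psize la = k}"
    then have la: "la \<in> partitions" "psize la = k" by auto
    have fin: "finite {i. la i \<noteq> 0}" using partitionsD[OF la(1)] by simp
    have 1: "la i \<le> k" for i
      using member_le_sum[of i "{i. la i \<noteq> 0}" la] fin la(2) unfolding psize_def by (cases "la i = 0") auto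
    have "plength la \<le> k" using plength_le_psize[OF la(1)] la(2) by simp
    then have "la i = 0" if "i \<ge> k" for i
      using that partition_support[OF la(1), of i] by (auto simp: plength_eq_cnj)
    with 1 show "la \<in> {f. \<forall>i. (i \<in> {..<k} \<longrightarrow> f i \<in> {..k}) \<and> (i \<notin> {..<k} \<longrightarrow> f i = 0)}"
      by simp
  qed
qed

lemma contained_psize_le:
  assumes "la \<in> partitions" "mu \<in> partitions" "\<forall>k. cnj mu k \<le> cnj la k"
  shows "psize mu \<le> psize la"
proof -
  have "psize mu = (\<Sum>k<la 0 + mu 0. cnj mu k)"
    unfolding psize_cnj[OF assms(2), symmetric] by (rule psize_eq_sum) (simp add: cnj_eq_0[OF assms(2)])
  also have "\<dots> \<le> (\<Sum>k<la 0 + mu 0. cnj la k)" using assms(3) by (intro sum_mono) simp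
  also have "\<dots> = psize la"
    unfolding psize_cnj[OF assms(1), symmetric] by (rule psize_eq_sum[symmetric]) (simp add: cnj_eq_0[OF assms(1)])
  finally show ?thesis .
qed

lemma finite_partitions_psize_le: "finite {la. la \<in> partitions \<and> psize la \<le> k}"
proof -
  have "{la. la \<in> partitions \<and> psize la \<le> k} = (\<Union>i\<le>k. {la. la \<in> partitions \<and> psize la = i})" by auto
  then show ?thesis by (simp add: finite_partitions_psize)
qed

section \<open>The Pieri rule for elementary symmetric polynomials\<close>

definition hl_delta :: "real \<Rightarrow> nat \<Rightarrow> (nat \<Rightarrow> real) \<Rightarrow> real" where
  "hl_delta q n y = (\<Prod>(i, j) \<in> {(i, j). i < j \<and> j < n}. (y i - q * y j) / (y i - y j))"

text \<open>The symmetriser without its normalisation. It is applied to arbitrary functions f, so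
  that products of variables can be rearranged position by position inside the sum.\<close>

definition hl_sum :: "real \<Rightarrow> nat \<Rightarrow> ((nat \<Rightarrow> real) \<Rightarrow> real) \<Rightarrow> (nat \<Rightarrow> real) \<Rightarrow> real" where
  "hl_sum q n f x = (\<Sum>w | w permutes {..<n}. f (x \<circ> w) * hl_delta q n (x \<circ> w))"

lemma finite_less_pairs: "finite {(i, j). i < j \<and> j < (n::nat)}"
  by (rule finite_subset[of _ "{..<n} \<times> {..<n}"]) auto

text \<open>The transposition permutes all factors except the one of the pair (i, i + 1). For that
  pair the numerator times y_(i+1) - q y_i is symmetric and the denominator is antisymmetric, so the
  two terms cancel.\<close>

lemma hl_delta_transpose:
  assumes inj: "inj_on y {..<n}" and i: "Suc i < n"
  shows "(y (Suc i) - q * y i) * hl_delta q n y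
    + (y i - q * y (Suc i)) * hl_delta q n (y \<circ> Transposition.transpose i (Suc i)) = 0"
proof -
  let ?T = "Transposition.transpose i (Suc i)"
  let ?A = "{(i, j). i < j \<and> j < n}"
  let ?g = "\<lambda>y (a, b). (y a - q * y b) / (y a - y b)"
  let ?D = "\<lambda>y. prod (?g y) (?A - {(i, Suc i)})"
  have split: "hl_delta q n y = (y i - q * y (Suc i)) / (y i - y (Suc i)) * ?D y" for y
    unfolding hl_delta_def using i by (subst prod.remove[of _ "(i, Suc i)"]) (auto simp: finite_less_pairs)
  have T: "?T a < ?T b \<and> ?T b < n \<and> (?T a, ?T b) \<noteq> (i, Suc i)" if "a < b" "b < n" "(a, b) \<noteq> (i, Suc i)" for a b
    using that i unfolding Transposition.transpose_def by (auto split: if_splits)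
  have sym: "?D (y \<circ> ?T) = ?D y"
    by (rule prod.reindex_bij_witness[of _ "\<lambda>(a, b). (?T a, ?T b)" "\<lambda>(a, b). (?T a, ?T b)"])
       (use T in auto)
  have ne: "y i - y (Suc i) \<noteq> 0" using inj_onD[OF inj, of i "Suc i"] i by auto
  show ?thesis
    unfolding split sym using ne by (simp add: divide_simps) (simp add: algebra_simps)
qed

text \<open>The terms of w and of w composed with the transposition cancel by
  \<open>hl_delta_transpose\<close>: next to a factor symmetric in the two positions, y_(i+1) may be
  traded for q y_i.\<close>

lemma hl_sum_Suc:
  assumes inj: "inj_on x {..<n}" and i: "Suc i < n"
    and sym: "\<And>y. f (y \<circ> Transposition.transpose i (Suc i)) = f y"
  shows "hl_sum q n (\<lambda>y. f y * y (Suc i)) x = q * hl_sum q n (\<lambda>y. f y * y i) x"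
proof -
  let ?T = "Transposition.transpose i (Suc i)"
  let ?H = "\<lambda>y. f y * (y (Suc i) - q * y i) * hl_delta q n y"
  let ?W = "{w. w permutes {..<n}}"
  have T: "?T permutes {..<n}" using i by (intro permutes_swap_id) auto
  have "(\<Sum>w\<in>?W. ?H (x \<circ> w)) = (\<Sum>w\<in>?W. ?H (x \<circ> (w \<circ> ?T)))"
    by (rule sum_permutations_compose_right[OF T])
  then have "2 * (\<Sum>w\<in>?W. ?H (x \<circ> w)) = (\<Sum>w\<in>?W. ?H (x \<circ> w) + ?H (x \<circ> w \<circ> ?T))"
    by (simp add: sum.distrib o_assoc)
  also have "\<dots> = 0"
  proof (rule sum.neutral, safe)
    fix w assume w: "w permutes {..<n}"
    have "inj_on (x \<circ> w) {..<n}"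
      by (rule comp_inj_on) (use w inj in \<open>auto simp: permutes_inj_on permutes_image\<close>)
    from hl_delta_transpose[OF this i, of q]
    have "f (x \<circ> w) * (((x \<circ> w) (Suc i) - q * (x \<circ> w) i) * hl_delta q n (x \<circ> w)
      + ((x \<circ> w) i - q * (x \<circ> w) (Suc i)) * hl_delta q n (x \<circ> w \<circ> ?T)) = 0" by simp
    then show "?H (x \<circ> w) + ?H (x \<circ> w \<circ> ?T) = 0"
      by (simp add: sym algebra_simps)
  qed
  finally have "(\<Sum>w\<in>?W. ?H (x \<circ> w)) = 0" by simp
  then show ?thesis
    unfolding hl_sum_def by (simp add: algebra_simps sum_subtractf sum_distrib_left)
qed

lemma hl_sum_move:
  assumes inj: "inj_on x {..<n}" and "b + l < n"
    and sym: "\<And>i y. b \<le> i \<Longrightarrow> i < b + l \<Longrightarrow> f (y \<circ> Transposition.transpose i (Suc i)) = f y"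
  shows "hl_sum q n (\<lambda>y. f y * y (b + l)) x = q ^ l * hl_sum q n (\<lambda>y. f y * y b) x"
  using assms(2,3)
proof (induction l)
  case (Suc l)
  have "hl_sum q n (\<lambda>y. f y * y (Suc (b + l))) x = q * hl_sum q n (\<lambda>y. f y * y (b + l)) x"
  proof (rule hl_sum_Suc[OF inj])
    show "f (y \<circ> Transposition.transpose (b + l) (Suc (b + l))) = f y" for y
      by (rule Suc.prems(2)) auto
  qed (use Suc.prems in auto)
  moreover have "hl_sum q n (\<lambda>y. f y * y (b + l)) x = q ^ l * hl_sum q n (\<lambda>y. f y * y b) x"
  proof (rule Suc.IH)
    show "f (y \<circ> Transposition.transpose i (Suc i)) = f y" if "b \<le> i" "i < b + l" for i y
      by (rule Suc.prems(2)) (use that in auto)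
  qed (use Suc.prems in auto)
  ultimately show ?case by simp
qed simp

text \<open>The condition says that positions i and i + 1 lie on the same side of the end of the
  segment \<open>{..<a}\<close>.\<close>

lemma prod_transpose:
  assumes "Suc i \<noteq> a"
  shows "(\<Prod>j<a. g (y (Transposition.transpose i (Suc i) j))) = (\<Prod>j<a. g (y j :: real) :: real)"
proof (cases "Suc i < a")
  case True
  then have "Transposition.transpose i (Suc i) permutes {..<a}" by (intro permutes_swap_id) auto
  from prod.permute[OF this, of "\<lambda>j. g (y j)"] show ?thesis by (simp add: comp_def)
next
  case False
  then have "Transposition.transpose i (Suc i) j = j" if "j < a" for j
    using that assms by (auto simp: Transposition.transpose_def)
  then show ?thesis by (intro prod.cong) auto
qed

lemma prod_atLeast_add: "(\<Prod>i<a. g i) * (\<Prod>i=a..<a+j. g i) = (\<Prod>i<a + j::nat. g i :: real)"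
  using prod.atLeastLessThan_concat[of 0 a "a + j" g] by (simp add: atLeast0LessThan)

text \<open>Multiplying by $\prod (1 + z y_i)$ over a block of positions in which \<open>f\<close> is symmetric:
  sorting the chosen positions to the front of the block costs a factor $q$ per inversion.\<close>

lemma hl_sum_block:
  assumes q: "0 < q" "q < 1" and inj: "inj_on x {..<n}" and "a + m \<le> n"
    and sym: "\<And>i y. a \<le> i \<Longrightarrow> Suc i < a + m \<Longrightarrow> f (y \<circ> Transposition.transpose i (Suc i)) = f y"
  shows "hl_sum q n (\<lambda>y. f y * (\<Prod>i=a..<a+m. 1 + z * y i)) x
    = (\<Sum>j\<le>m. qbinom q m j * z ^ j * hl_sum q n (\<lambda>y. f y * (\<Prod>i=a..<a+j. y i)) x)"
  using assms(4,5)
proof (induction m arbitrary: f)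
  case 0
  then show ?case using q by simp
next
  case (Suc m)
  define B where "B j = hl_sum q n (\<lambda>y. f y * (\<Prod>i=a..<a+j. y i)) x" for j
  have B: "hl_sum q n (\<lambda>y. f y * (1 + z * y (a + m)) * (\<Prod>i=a..<a+j. y i)) x
    = B j + z * (q ^ (m - j) * B (Suc j))" if "j \<le> m" for j
  proof -
    let ?f = "\<lambda>y. f y * (\<Prod>i=a..<a+j. y i)"
    have "hl_sum q n (\<lambda>y. ?f y * y ((a + j) + (m - j))) x
      = q ^ (m - j) * hl_sum q n (\<lambda>y. ?f y * y (a + j)) x"
    proof (rule hl_sum_move[OF inj])
      show "a + j + (m - j) < n" using that Suc.prems by simp
      fix i and y :: "nat \<Rightarrow> real" assume i: "a + j \<le> i" "i < a + j + (m - j)"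
      have "(\<Prod>k = a..<a + j. (y \<circ> Transposition.transpose i (Suc i)) k) = (\<Prod>k = a..<a + j. y k)"
        by (rule prod.cong) (use i in \<open>auto simp: Transposition.transpose_def\<close>)
      moreover have "f (y \<circ> Transposition.transpose i (Suc i)) = f y"
        using i that by (intro Suc.prems) auto
      ultimately show "?f (y \<circ> Transposition.transpose i (Suc i)) = ?f y" by simp
    qed
    moreover have "hl_sum q n (\<lambda>y. ?f y * y (a + j)) x = B (Suc j)"
      unfolding B_def by (simp add: mult_ac)
    moreover have "hl_sum q n (\<lambda>y. f y * (1 + z * y (a + m)) * (\<Prod>i=a..<a+j. y i)) x
      = B j + z * hl_sum q n (\<lambda>y. ?f y * y (a + m)) x"
      unfolding B_def hl_sum_def sum_distrib_left sum.distrib[symmetric]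
      by (rule sum.cong) (auto simp: algebra_simps)
    ultimately show ?thesis using that by simp
  qed
  have "hl_sum q n (\<lambda>y. f y * (\<Prod>i=a..<a+Suc m. 1 + z * y i)) x
    = hl_sum q n (\<lambda>y. f y * (1 + z * y (a + m)) * (\<Prod>i=a..<a+m. 1 + z * y i)) x"
    by (simp add: mult_ac)
  also have "\<dots> = (\<Sum>j\<le>m. qbinom q m j * z ^ j * hl_sum q n (\<lambda>y. f y * (1 + z * y (a + m)) * (\<Prod>i=a..<a+j. y i)) x)"
  proof (rule Suc.IH)
    fix i and y :: "nat \<Rightarrow> real" assume i: "a \<le> i" "Suc i < a + m"
    have "f (y \<circ> Transposition.transpose i (Suc i)) = f y"
      by (rule Suc.prems(2)) (use i in auto)
    moreover have "(y \<circ> Transposition.transpose i (Suc i)) (a + m) = y (a + m)"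
      using i by (auto simp: Transposition.transpose_def)
    ultimately show "f (y \<circ> Transposition.transpose i (Suc i)) * (1 + z * (y \<circ> Transposition.transpose i (Suc i)) (a + m))
      = f y * (1 + z * y (a + m))" by (simp only:)
  qed (use Suc.prems in auto)
  also have "\<dots> = (\<Sum>j\<le>m. qbinom q m j * z ^ j * B j) + (\<Sum>j\<le>m. q ^ (m - j) * qbinom q m j * z ^ Suc j * B (Suc j))"
    unfolding sum.distrib[symmetric] by (intro sum.cong refl, subst B) (auto simp: algebra_simps)
  also have "(\<Sum>j\<le>m. qbinom q m j * z ^ j * B j) = (\<Sum>j\<le>Suc m. qbinom q m j * z ^ j * B j)"
    by simp
  also have "\<dots> = B 0 + (\<Sum>j\<le>m. qbinom q m (Suc j) * z ^ Suc j * B (Suc j))"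
    unfolding sum.atMost_Suc_shift using q by simp
  also have "\<dots> + (\<Sum>j\<le>m. q ^ (m - j) * qbinom q m j * z ^ Suc j * B (Suc j))
    = B 0 + (\<Sum>j\<le>m. qbinom q (Suc m) (Suc j) * z ^ Suc j * B (Suc j))"
    by (simp add: qbinom_Suc_Suc[OF q] sum.distrib[symmetric] distrib_right)
  also have "\<dots> = (\<Sum>j\<le>Suc m. qbinom q (Suc m) j * z ^ j * B j)"
    unfolding sum.atMost_Suc_shift using q by simp
  finally show ?case unfolding B_def .
qed

section \<open>Distributing a product over the columns of a monomial\<close>

text \<open>The monomial of a partition written by columns, so that lengthening one column
  multiplies it by the variables in consecutive positions.\<close>

definition cmon :: "(nat \<Rightarrow> nat) \<Rightarrow> nat \<Rightarrow> (nat \<Rightarrow> real) \<Rightarrow> real" where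
  "cmon c N y = (\<Prod>k<N. \<Prod>i<c k. y i)"

text \<open>The column to the left of column k. Column 0 gets a virtual neighbour of length n, since
  n variables leave room for n rows.\<close>

definition prev_col :: "nat \<Rightarrow> (nat \<Rightarrow> nat) \<Rightarrow> nat \<Rightarrow> nat" where
  "prev_col n c k = (if k = 0 then n else c (k - 1))"

text \<open>The column lengths of the partitions that arise from \<open>c\<close> by adding a vertical strip in
  the first \<open>s\<close> columns, within \<open>n\<close> rows.\<close>

definition strips :: "nat \<Rightarrow> (nat \<Rightarrow> nat) \<Rightarrow> nat \<Rightarrow> (nat \<Rightarrow> nat) set" where
  "strips n c s = {d. (\<forall>k<s. c k \<le> d k \<and> d k \<le> prev_col n c k) \<and> (\<forall>k\<ge>s. d k = 0)}"

lemma strips_0: "strips n c 0 = {\<lambda>_. 0}"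
  by (auto simp: strips_def)

lemma sum_strips_Suc:
  assumes "c s \<le> prev_col n c s"
  shows "(\<Sum>d\<in>strips n c (Suc s). g d)
    = (\<Sum>d\<in>strips n c s. \<Sum>j\<le>prev_col n c s - c s. g (d(s := c s + j)) :: real)"
  unfolding sum.cartesian_product
  by (rule sum.reindex_bij_witness[of _ "\<lambda>(d, j). d(s := c s + j)" "\<lambda>d. (d(s := 0), d s - c s)"])
     (use assms in \<open>auto simp: strips_def less_Suc_eq fun_eq_iff\<close>)

lemma hl_sum_strips:
  assumes q: "0 < q" "q < 1" and inj: "inj_on x {..<n}"
    and c: "antimono c" "c 0 \<le> n" and "s \<le> N"
  shows "hl_sum q n (\<lambda>y. cmon c N y * (\<Prod>i<n. 1 + z * y i)) x
    = (\<Sum>d\<in>strips n c s. (\<Prod>k<s. qbinom q (prev_col n c k - c k) (d k - c k) * z ^ (d k - c k))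
        * hl_sum q n (\<lambda>y. cmon d s y * (\<Prod>k=s..<N. \<Prod>i<c k. y i) * (\<Prod>i<prev_col n c s. 1 + z * y i)) x)"
  using \<open>s \<le> N\<close>
proof (induction s)
  case 0
  show ?case unfolding strips_0 by (simp add: cmon_def prev_col_def atLeast0LessThan)
next
  case (Suc s)
  let ?p = "prev_col n c"
  have cp: "c s \<le> ?p s" "?p s \<le> n" "?p (Suc s) = c s"
    using antimonoD[OF c(1), of "s - 1" s] antimonoD[OF c(1), of 0 "s - 1"] c(2)
    by (auto simp: prev_col_def)
  have main: "hl_sum q n (\<lambda>y. cmon d s y * (\<Prod>k=s..<N. \<Prod>i<c k. y i) * (\<Prod>i<?p s. 1 + z * y i)) x
    = (\<Sum>j\<le>?p s - c s. qbinom q (?p s - c s) j * z ^ j *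
       hl_sum q n (\<lambda>y. cmon (d(s := c s + j)) (Suc s) y * (\<Prod>k=Suc s..<N. \<Prod>i<c k. y i) * (\<Prod>i<c s. 1 + z * y i)) x)"
    if d: "d \<in> strips n c s" for d
  proof -
    define f where "f y = cmon d s y * (\<Prod>k=s..<N. \<Prod>i<c k. y i) * (\<Prod>i<c s. 1 + z * y i)" for y
    have "hl_sum q n (\<lambda>y. f y * (\<Prod>i=c s..<c s + (?p s - c s). 1 + z * y i)) x
      = (\<Sum>j\<le>?p s - c s. qbinom q (?p s - c s) j * z ^ j * hl_sum q n (\<lambda>y. f y * (\<Prod>i=c s..<c s+j. y i)) x)"
    proof (rule hl_sum_block[OF q inj])
      show "c s + (?p s - c s) \<le> n" using cp by simp
      fix i and y :: "nat \<Rightarrow> real" assume i: "c s \<le> i" "Suc i < c s + (?p s - c s)"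
      \<comment> \<open>Finished columns end at or behind the block and the remaining ones at or
        before its start, so no transposition inside the block straddles the end of a column. This
        is the symmetry that \<open>hl_sum_block\<close> asks for.\<close>
      have 1: "Suc i \<noteq> d k" if "k < s" for k
      proof -
        have "?p s = c (s - 1)" using that by (simp add: prev_col_def)
        also have "\<dots> \<le> c k" using that by (intro antimonoD[OF c(1)]) auto
        also have "\<dots> \<le> d k" using d that by (auto simp: strips_def)
        finally show ?thesis using i by simp
      qed
      have 2: "Suc i \<noteq> c k" if "k \<ge> s" for k
        using antimonoD[OF c(1) that] i by simp
      show "f (y \<circ> Transposition.transpose i (Suc i)) = f y"
        unfolding f_def cmon_def comp_def
        using prod_transpose[OF 2[of s], of "\<lambda>u. 1 + z * u"] 1 2
        by (intro arg_cong2[of _ _ _ _ "(*)"] prod.cong prod_transpose[where g = "\<lambda>u. u"]) auto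
    qed
    moreover have "f y * (\<Prod>i=c s..<c s + (?p s - c s). 1 + z * y i)
      = cmon d s y * (\<Prod>k=s..<N. \<Prod>i<c k. y i) * (\<Prod>i<?p s. 1 + z * y i)" for y
      using prod_atLeast_add[of "\<lambda>i. 1 + z * y i" "c s" "?p s - c s"] cp(1) unfolding f_def
      by (simp add: mult.assoc)
    moreover have "f y * (\<Prod>i=c s..<c s+j. y i) =
      cmon (d(s := c s + j)) (Suc s) y * (\<Prod>k=Suc s..<N. \<Prod>i<c k. y i) * (\<Prod>i<c s. 1 + z * y i)" for y j
    proof -
      have "(\<Prod>k=s..<N. \<Prod>i<c k. y i) = (\<Prod>i<c s. y i) * (\<Prod>k=Suc s..<N. \<Prod>i<c k. y i)"
        using Suc.prems by (simp add: prod.atLeast_Suc_lessThan)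
      moreover have "cmon (d(s := c s + j)) (Suc s) y = cmon d s y * ((\<Prod>i<c s. y i) * (\<Prod>i=c s..<c s+j. y i))"
        unfolding prod_atLeast_add by (simp add: cmon_def)
      ultimately show ?thesis unfolding f_def by (simp only: mult_ac)
    qed
    ultimately show ?thesis by simp
  qed
  have "hl_sum q n (\<lambda>y. cmon c N y * (\<Prod>i<n. 1 + z * y i)) x
    = (\<Sum>d\<in>strips n c s. \<Sum>j\<le>?p s - c s. (\<Prod>k<s. qbinom q (?p k - c k) (d k - c k) * z ^ (d k - c k))
        * (qbinom q (?p s - c s) j * z ^ j *
       hl_sum q n (\<lambda>y. cmon (d(s := c s + j)) (Suc s) y * (\<Prod>k=Suc s..<N. \<Prod>i<c k. y i) * (\<Prod>i<c s. 1 + z * y i)) x))"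
    using Suc by (simp add: main sum_distrib_left)
  also have "\<dots> = (\<Sum>d\<in>strips n c (Suc s). (\<Prod>k<Suc s. qbinom q (?p k - c k) (d k - c k) * z ^ (d k - c k))
        * hl_sum q n (\<lambda>y. cmon d (Suc s) y * (\<Prod>k=Suc s..<N. \<Prod>i<c k. y i) * (\<Prod>i<?p (Suc s). 1 + z * y i)) x)"
    unfolding sum_strips_Suc[OF cp(1)] by (intro sum.cong refl) (simp add: cp(3))
  finally show ?case .
qed

section \<open>Partial fractions and the normalisation of the symmetriser\<close>

text \<open>Adding a point \<open>c\<close> to \<open>A\<close> creates a residue at \<open>c\<close>, which the induction hypothesis gives at
  \<open>t = c\<close>.\<close>

lemma prod_partial_fractions:
  fixes s t :: real
  assumes "finite A" "t \<notin> A"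
  shows "(\<Prod>a\<in>A. (t - s * a) / (t - a))
    = 1 + (\<Sum>a\<in>A. (1 - s) * a / (t - a) * (\<Prod>b\<in>A - {a}. (a - s * b) / (a - b)))"
  using assms
proof (induction A arbitrary: t rule: finite_induct)
  case (insert c A)
  let ?w = "\<lambda>a. (1 - s) * a * (\<Prod>b\<in>A - {a}. (a - s * b) / (a - b))"
  have t: "t \<noteq> c" "t \<notin> A" using insert.prems by auto
  have IH: "(\<Prod>a\<in>A. (t - s * a) / (t - a)) = 1 + (\<Sum>a\<in>A. ?w a / (t - a))" if "t \<notin> A" for t
    using insert.IH[OF that] by simp
  have split: "1 / (t - a) * ((t - s * c) / (t - c))
    = (a - s * c) / (a - c) / (t - a) + (1 - s) * c / ((c - a) * (t - c))" if "a \<in> A" for a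
  proof -
    have "t - a \<noteq> 0" "t - c \<noteq> 0" "a - c \<noteq> 0" "c - a \<noteq> 0" using that t insert by auto
    then show ?thesis by (simp add: divide_simps) (simp add: algebra_simps)
  qed
  have "(\<Prod>a\<in>insert c A. (t - s * a) / (t - a))
    = (t - s * c) / (t - c) * (1 + (\<Sum>a\<in>A. ?w a / (t - a)))"
    using insert.hyps IH[OF t(2)] by simp
  also have "\<dots> = (t - s * c) / (t - c) + (\<Sum>a\<in>A. ?w a * (1 / (t - a) * ((t - s * c) / (t - c))))"
    by (simp add: distrib_left sum_distrib_left mult_ac)
  also have "(\<Sum>a\<in>A. ?w a * (1 / (t - a) * ((t - s * c) / (t - c))))
    = (\<Sum>a\<in>A. ?w a * ((a - s * c) / (a - c) / (t - a) + (1 - s) * c / ((c - a) * (t - c))))"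
    using split by (intro sum.cong refl) (simp only:)
  also have "\<dots> = (\<Sum>a\<in>A. ?w a * ((a - s * c) / (a - c)) / (t - a))
      + (1 - s) * c / (t - c) * (\<Sum>a\<in>A. ?w a / (c - a))"
    by (simp add: distrib_left sum.distrib sum_distrib_left mult_ac)
  also have "(t - s * c) / (t - c) = 1 + (1 - s) * c / (t - c)"
    using t by (simp add: field_simps)
  also have "1 + (1 - s) * c / (t - c) + ((\<Sum>a\<in>A. ?w a * ((a - s * c) / (a - c)) / (t - a))
      + (1 - s) * c / (t - c) * (\<Sum>a\<in>A. ?w a / (c - a)))
    = 1 + ((1 - s) * c / (t - c) * (1 + (\<Sum>a\<in>A. ?w a / (c - a)))
       + (\<Sum>a\<in>A. ?w a * ((a - s * c) / (a - c)) / (t - a)))"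
    by (simp add: algebra_simps)
  also have "1 + (\<Sum>a\<in>A. ?w a / (c - a)) = (\<Prod>b\<in>insert c A - {c}. (c - s * b) / (c - b))"
    using IH[of c] insert.hyps by simp
  also have "(\<Sum>a\<in>A. ?w a * ((a - s * c) / (a - c)) / (t - a))
    = (\<Sum>a\<in>A. (1 - s) * a / (t - a) * (\<Prod>b\<in>insert c A - {a}. (a - s * b) / (a - b)))"
  proof (rule sum.cong[OF refl])
    fix a assume a: "a \<in> A"
    then have "insert c A - {a} = insert c (A - {a})" using insert.hyps by auto
    then show "?w a * ((a - s * c) / (a - c)) / (t - a)
      = (1 - s) * a / (t - a) * (\<Prod>b\<in>insert c A - {a}. (a - s * b) / (a - b))"
      using insert.hyps by (simp add: mult_ac)
  qed
  also have "(1 - s) * c / (t - c) * (\<Prod>b\<in>insert c A - {c}. (c - s * b) / (c - b))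
       + (\<Sum>a\<in>A. (1 - s) * a / (t - a) * (\<Prod>b\<in>insert c A - {a}. (a - s * b) / (a - b)))
    = (\<Sum>a\<in>insert c A. (1 - s) * a / (t - a) * (\<Prod>b\<in>insert c A - {a}. (a - s * b) / (a - b)))"
    using insert.hyps by simp
  finally show ?case .
qed simp

text \<open>At t = 0 every coefficient (1 - s) a / (t - a) in \<open>prod_partial_fractions\<close>
  becomes s - 1. This presupposes that 0 is not in A; an element 0 is split off beforehand, as it
  contributes s^(card A - 1) by itself and a factor 1 to every other term.\<close>

lemma sum_prod_quotients:
  fixes s :: real
  assumes "finite A" "s \<noteq> 1"
  shows "(\<Sum>a\<in>A. \<Prod>b\<in>A - {a}. (a - s * b) / (a - b)) = (1 - s ^ card A) / (1 - s)"
proof -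
  have nz: "(\<Sum>a\<in>A. \<Prod>b\<in>A - {a}. (a - s * b) / (a - b)) = (1 - s ^ card A) / (1 - s)"
    if "finite A" "0 \<notin> A" for A
  proof -
    have "(\<Sum>a\<in>A. (1 - s) * a / (0 - a) * (\<Prod>b\<in>A - {a}. (a - s * b) / (a - b)))
      = (s - 1) * (\<Sum>a\<in>A. \<Prod>b\<in>A - {a}. (a - s * b) / (a - b))"
      unfolding sum_distrib_left
    proof (intro sum.cong refl)
      fix a assume "a \<in> A"
      then have "(1 - s) * a / (0 - a) = s - 1" using that by (cases "a = 0") (auto simp: field_simps)
      then show "(1 - s) * a / (0 - a) * (\<Prod>b\<in>A - {a}. (a - s * b) / (a - b))
        = (s - 1) * (\<Prod>b\<in>A - {a}. (a - s * b) / (a - b))" by simp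
    qed
    moreover have "(\<Prod>a\<in>A. (0 - s * a) / (0 - a)) = s ^ card A"
      using that by (subst prod.cong[of _ A _ "\<lambda>_. s"]) auto
    ultimately have "s ^ card A = 1 + (s - 1) * (\<Sum>a\<in>A. \<Prod>b\<in>A - {a}. (a - s * b) / (a - b))"
      using prod_partial_fractions[OF that, of s] by simp
    then show ?thesis using \<open>s \<noteq> 1\<close> by (simp add: field_simps)
  qed
  show ?thesis
  proof (cases "0 \<in> A")
    case True
    define B where "B = A - {0}"
    have B: "A = insert 0 B" "finite B" "0 \<notin> B" using True assms by (auto simp: B_def)
    have "(\<Sum>a\<in>A. \<Prod>b\<in>A - {a}. (a - s * b) / (a - b))
      = (\<Prod>b\<in>B. (0 - s * b) / (0 - b)) + (\<Sum>a\<in>B. \<Prod>b\<in>A - {a}. (a - s * b) / (a - b))"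
      using B by simp
    also have "(\<Prod>b\<in>B. (0 - s * b) / (0 - b)) = s ^ card B"
      using B by (subst prod.cong[of _ B _ "\<lambda>_. s"]) auto
    also have "(\<Sum>a\<in>B. \<Prod>b\<in>A - {a}. (a - s * b) / (a - b)) = (\<Sum>a\<in>B. \<Prod>b\<in>B - {a}. (a - s * b) / (a - b))"
    proof (rule sum.cong[OF refl])
      fix a assume a: "a \<in> B"
      then have "A - {a} = insert 0 (B - {a})" "a \<noteq> 0" using B by auto
      then show "(\<Prod>b\<in>A - {a}. (a - s * b) / (a - b)) = (\<Prod>b\<in>B - {a}. (a - s * b) / (a - b))"
        using B by simp
    qed
    also have "\<dots> = (1 - s ^ card B) / (1 - s)" by (rule nz[OF B(2,3)])
    finally show ?thesis using B \<open>s \<noteq> 1\<close> by (simp add: field_simps)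
  qed (use nz assms in auto)
qed

lemma hl_delta_Suc:
  "hl_delta q (Suc n) y = hl_delta q n y * (\<Prod>i<n. (y i - q * y n) / (y i - y n))"
proof -
  have 1: "{(i, j). i < j \<and> j < Suc n} = {(i, j). i < j \<and> j < n} \<union> (\<lambda>i. (i, n)) ` {..<n}" by auto
  have 2: "prod (\<lambda>(i, j). (y i - q * y j) / (y i - y j)) ((\<lambda>i. (i, n)) ` {..<n})
    = (\<Prod>i<n. (y i - q * y n) / (y i - y n))"
    by (subst prod.reindex) (auto simp: inj_on_def)
  show ?thesis
    unfolding hl_delta_def 1 by (subst prod.union_disjoint) (auto simp: finite_less_pairs 2)
qed

text \<open>Classify the permutations by the variable in the last position; \<open>sum_prod_quotients\<close> with
  \<open>s = 1 / q\<close> evaluates the sum over that variable.\<close>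

lemma hl_sum_const:
  assumes q: "0 < q" "q < 1" and inj: "inj_on x {..<n}"
  shows "hl_sum q n (\<lambda>_. 1) x = qpoch q q n / (1 - q) ^ n"
  using inj
proof (induction n arbitrary: x)
  case 0
  then show ?case by (simp add: hl_sum_def hl_delta_def)
next
  case (Suc n)
  let ?T = "\<lambda>b. Transposition.transpose n b"
  have lt: "{..<Suc n} = insert n {..<n}" by auto
  have peel: "hl_delta q (Suc n) (x \<circ> (?T b \<circ> w))
      = hl_delta q n ((x \<circ> ?T b) \<circ> w) * (\<Prod>i\<in>{..<Suc n} - {b}. (x i - q * x b) / (x i - x b))"
    if w: "w permutes {..<n}" and b: "b \<in> {..<Suc n}" for w b
  proof -
    have wn: "w n = n" using w by (auto simp: permutes_def)
    have "(\<Prod>i<n. (x (?T b (w i)) - q * x b) / (x (?T b (w i)) - x b))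
      = (\<Prod>i<n. (x (?T b i) - q * x b) / (x (?T b i) - x b))"
      using prod.permute[OF w, of "\<lambda>i. (x (?T b i) - q * x b) / (x (?T b i) - x b)"]
      by (simp add: comp_def)
    also have "\<dots> = (\<Prod>i\<in>{..<Suc n} - {b}. (x i - q * x b) / (x i - x b))"
      by (rule prod.reindex_bij_witness[of _ "?T b" "?T b"])
         (use b in \<open>auto simp: Transposition.transpose_def\<close>)
    finally show ?thesis unfolding hl_delta_Suc by (simp add: wn o_assoc comp_def)
  qed
  have "hl_sum q (Suc n) (\<lambda>_. 1) x
    = (\<Sum>b\<in>{..<Suc n}. \<Sum>w | w permutes {..<n}. hl_delta q (Suc n) (x \<circ> (?T b \<circ> w)))"
    unfolding hl_sum_def lt by (subst sum_over_permutations_insert) auto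
  also have "\<dots> = (\<Sum>b\<in>{..<Suc n}. hl_sum q n (\<lambda>_. 1) (x \<circ> ?T b)
      * (\<Prod>i\<in>{..<Suc n} - {b}. (x i - q * x b) / (x i - x b)))"
    by (intro sum.cong refl) (simp add: hl_sum_def sum_distrib_right peel)
  also have "\<dots> = (\<Sum>b\<in>{..<Suc n}. qpoch q q n / (1 - q) ^ n
      * (\<Prod>i\<in>{..<Suc n} - {b}. (x i - q * x b) / (x i - x b)))"
  proof (intro sum.cong refl)
    fix b assume b: "b \<in> {..<Suc n}"
    have "inj_on (x \<circ> ?T b) {..<n}"
    proof (rule comp_inj_on)
      show "inj_on (?T b) {..<n}" by (rule inj_on_transpose)
      have "?T b ` {..<n} \<subseteq> {..<Suc n}" using b by (auto simp: Transposition.transpose_def)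
      then show "inj_on x (?T b ` {..<n})" using Suc.prems inj_on_subset by blast
    qed
    from Suc.IH[OF this] show "hl_sum q n (\<lambda>_. 1) (x \<circ> ?T b)
      * (\<Prod>i\<in>{..<Suc n} - {b}. (x i - q * x b) / (x i - x b)) = qpoch q q n / (1 - q) ^ n
      * (\<Prod>i\<in>{..<Suc n} - {b}. (x i - q * x b) / (x i - x b))" by (simp only:)
  qed
  \<comment> \<open>Reversing both differences puts the variable of the last position in front and
    extracts one factor q for each of the n others.\<close>
  also have "\<dots> = qpoch q q n / (1 - q) ^ n *
      (\<Sum>b\<in>{..<Suc n}. q ^ n * (\<Prod>i\<in>{..<Suc n} - {b}. (x b - (1 / q) * x i) / (x b - x i)))"
    unfolding sum_distrib_left
  proof (intro sum.cong refl)
    fix b assume b: "b \<in> {..<Suc n}"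
    have "(\<Prod>i\<in>{..<Suc n} - {b}. (x i - q * x b) / (x i - x b))
      = (\<Prod>i\<in>{..<Suc n} - {b}. q * ((x b - (1 / q) * x i) / (x b - x i)))"
    proof (intro prod.cong refl)
      fix i assume "i \<in> {..<Suc n} - {b}"
      then have "x i - x b \<noteq> 0" "x b - x i \<noteq> 0" using inj_onD[OF Suc.prems, of i b] b by auto
      then show "(x i - q * x b) / (x i - x b) = q * ((x b - (1 / q) * x i) / (x b - x i))"
        using q by (simp add: divide_simps) (simp add: algebra_simps)
    qed
    also have "\<dots> = q ^ n * (\<Prod>i\<in>{..<Suc n} - {b}. (x b - (1 / q) * x i) / (x b - x i))"
      unfolding prod.distrib using b by simp
    finally show "qpoch q q n / (1 - q) ^ n * (\<Prod>i\<in>{..<Suc n} - {b}. (x i - q * x b) / (x i - x b))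
      = qpoch q q n / (1 - q) ^ n * (q ^ n * (\<Prod>i\<in>{..<Suc n} - {b}. (x b - (1 / q) * x i) / (x b - x i)))"
      by simp
  qed
  also have "(\<Sum>b\<in>{..<Suc n}. q ^ n * (\<Prod>i\<in>{..<Suc n} - {b}. (x b - (1 / q) * x i) / (x b - x i)))
    = q ^ n * (\<Sum>b\<in>x ` {..<Suc n}. \<Prod>a\<in>x ` {..<Suc n} - {b}. (b - (1 / q) * a) / (b - a))"
    unfolding sum_distrib_left sum.reindex[OF Suc.prems] comp_def
  proof (intro sum.cong refl)
    fix b assume b: "b \<in> {..<Suc n}"
    have "x ` {..<Suc n} - {x b} = x ` ({..<Suc n} - {b})"
      using b Suc.prems by (auto simp: inj_on_def)
    moreover have "inj_on x ({..<Suc n} - {b})" using Suc.prems by (rule inj_on_subset) auto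
    ultimately show "q ^ n * (\<Prod>i\<in>{..<Suc n} - {b}. (x b - (1 / q) * x i) / (x b - x i))
      = q ^ n * (\<Prod>a\<in>x ` {..<Suc n} - {x b}. (x b - (1 / q) * a) / (x b - a))"
      by (simp add: prod.reindex)
  qed
  also have "\<dots> = q ^ n * ((1 - (1 / q) ^ Suc n) / (1 - 1 / q))"
    using q by (subst sum_prod_quotients) (auto simp: card_image[OF Suc.prems])
  also have "\<dots> = (1 - q * q ^ n) / (1 - q)"
    using q by (simp add: divide_simps power_one_over) (simp add: algebra_simps)
  finally show ?case by (simp add: qpoch_Suc)
qed

lemma prod_power_eq_cmon:
  assumes la: "la \<in> partitions" "plength la \<le> n" "la 0 \<le> N"
  shows "(\<Prod>i<n. y i ^ la i) = cmon (cnj la) N y"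
proof -
  have "(\<Prod>i<n. y i ^ la i) = (\<Prod>i<n. \<Prod>k<N. if i < cnj la k then y i else 1)"
  proof (intro prod.cong refl)
    fix i
    have "la i \<le> N" using partition_le[OF la(1), of 0 i] la by simp
    then have "{..<N} \<inter> {k. k < la i} = {..<la i}" by auto
    then show "y i ^ la i = (\<Prod>k<N. if i < cnj la k then y i else 1)"
      by (simp add: less_cnj_iff[OF la(1)] prod.If_cases)
  qed
  also have "\<dots> = (\<Prod>k<N. \<Prod>i<n. if i < cnj la k then y i else 1)" by (rule prod.swap)
  also have "\<dots> = cmon (cnj la) N y"
    unfolding cmon_def
  proof (rule prod.cong[OF refl])
    fix k
    have "cnj la k \<le> n" using partition_le[OF cnj_in_partitions[OF la(1)], of 0 k] la(2)
      by (simp add: plength_eq_cnj)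
    then have "{..<n} \<inter> {i. i < cnj la k} = {..<cnj la k}" by auto
    then show "(\<Prod>i<n. if i < cnj la k then y i else 1) = (\<Prod>i<cnj la k. y i)"
      by (simp add: prod.If_cases)
  qed
  finally show ?thesis .
qed

text \<open>The multiplicities add up to l(lambda), so the powers of 1 - q combine to one that
  depends on n alone.\<close>

lemma hl_v_eq:
  assumes la: "la \<in> partitions" "plength la \<le> n"
  shows "hl_v q n la = qpoch q q (n - plength la) * b_part q la / (1 - q) ^ n"
proof -
  have "(\<Sum>i = 1..la 0. mult_part la i) = (\<Sum>k<la 0. cnj la k - cnj la (Suc k))"
    by (rule sum.reindex_bij_witness[of _ Suc "\<lambda>i. i - 1"]) (auto simp: mult_part_def simp flip: conj_part_Suc)
  then have "(\<Sum>i = 1..la 0. mult_part la i) = plength la"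
    using sum_cnj_diff[OF la(1)] by (simp add: plength_eq_cnj)
  then have "(\<Prod>i = 1..la 0. (1 - q) ^ mult_part la i) = (1 - q) ^ plength la"
    by (metis power_sum)
  then show ?thesis
    unfolding hl_v_def b_part_def prod_dividef using la(2) by (simp flip: power_add)
qed

lemma hl_P_eq:
  assumes la: "la \<in> partitions" "plength la \<le> n" "la 0 \<le> N"
  shows "hl_P q la n x = (1 - q) ^ n / (qpoch q q (n - plength la) * b_part q la)
    * hl_sum q n (cmon (cnj la) N) x"
  unfolding hl_P_def hl_v_eq[OF la(1,2)] hl_sum_def hl_delta_def
    prod_power_eq_cmon[OF la, symmetric] using la(2) by simp

lemma b_part_pos:
  assumes "0 < q" "q < 1"
  shows "b_part q la > 0"
  unfolding b_part_def using assms by (intro prod_pos) (auto intro: qpoch_pos)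

lemma hl_P_zero:
  assumes q: "0 < q" "q < 1" and inj: "inj_on x {..<n}"
  shows "hl_P q (\<lambda>_. 0) n x = 1"
proof -
  have "(\<lambda>_. 0) \<in> partitions" by (auto simp: partitions_def antimono_def)
  from hl_P_eq[OF this, of n 0 q x] hl_sum_const[OF q inj] qpoch_pos[of q q n] q
  show ?thesis by (simp add: plength_def b_part_def cmon_def[abs_def])
qed

section \<open>Vertical strips and the Pieri coefficients\<close>

text \<open>At most one box of lambda / mu in each row, expressed by interlacing column
  lengths.\<close>

definition vstrip :: "(nat \<Rightarrow> nat) \<Rightarrow> (nat \<Rightarrow> nat) \<Rightarrow> bool" where
  "vstrip la mu \<longleftrightarrow> (\<forall>k. cnj mu k \<le> cnj la k \<and> cnj la (Suc k) \<le> cnj mu k)"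

text \<open>The coefficient of P_lambda in e_r P_mu for r = |lambda| - |mu|; it no longer involves
  the number n of variables.\<close>

definition e_coeff :: "real \<Rightarrow> (nat \<Rightarrow> nat) \<Rightarrow> (nat \<Rightarrow> nat) \<Rightarrow> real" where
  "e_coeff q la mu = (if vstrip la mu
     then \<Prod>k<la 0. qbinom q (cnj la k - cnj la (Suc k)) (cnj la k - cnj mu k) else 0)"

lemma e_coeff_eq:
  assumes "la \<in> partitions" "vstrip la mu" "la 0 \<le> N" "0 < q" "q < 1"
  shows "e_coeff q la mu = (\<Prod>k<N. qbinom q (cnj la k - cnj la (Suc k)) (cnj la k - cnj mu k))"
proof -
  have "cnj mu k = 0" if "k \<ge> la 0" for k
    using assms(1,2) cnj_eq_0[OF assms(1) that] unfolding vstrip_def by (metis le_zero_eq)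
  then have "(\<Prod>k<la 0. qbinom q (cnj la k - cnj la (Suc k)) (cnj la k - cnj mu k))
    = (\<Prod>k<N. qbinom q (cnj la k - cnj la (Suc k)) (cnj la k - cnj mu k))"
    using assms by (intro prod.mono_neutral_left ballI) (auto simp: cnj_eq_0 not_less)
  then show ?thesis using assms(2) by (simp add: e_coeff_def)
qed

lemma strips_in_partitions:
  assumes mu: "mu \<in> partitions" "plength mu \<le> n" and N: "mu 0 < N" and d: "d \<in> strips n (cnj mu) N"
  shows "d \<in> partitions"
proof -
  let ?c = "cnj mu"
  have "d (Suc k) \<le> d k" for k
  proof (cases "Suc k < N")
    case True
    with d have "d (Suc k) \<le> ?c k" "?c k \<le> d k" by (auto simp: strips_def prev_col_def)
    then show ?thesis by simp
  qed (use d in \<open>auto simp: strips_def\<close>)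
  then have "antimono d" by (rule decseq_SucI)
  moreover have "{k. d k \<noteq> 0} \<subseteq> {..<N}" using d by (auto simp: strips_def not_less[symmetric])
  ultimately show ?thesis by (auto simp: partitions_def intro: finite_subset)
qed

lemma bij_betw_strips:
  assumes mu: "mu \<in> partitions" "plength mu \<le> n" and N: "mu 0 < N"
  shows "bij_betw cnj (strips n (cnj mu) N) {la \<in> partitions. vstrip la mu \<and> plength la \<le> n}"
proof -
  let ?c = "cnj mu"
  note part = strips_in_partitions[OF assms]
  have 1: "vstrip (cnj d) mu" if d: "d \<in> strips n ?c N" for d
    unfolding vstrip_def cnj_cnj[OF part[OF d]]
  proof (intro allI)
    fix k
    have "?c k = 0" if "k \<ge> N" using cnj_eq_0[OF mu(1)] that N by auto
    then show "?c k \<le> d k \<and> d (Suc k) \<le> ?c k"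
      using d by (cases "k < N"; cases "Suc k < N") (fastforce simp: strips_def prev_col_def)+
  qed
  have 2: "plength (cnj d) \<le> n" if d: "d \<in> strips n ?c N" for d
    using d N unfolding plength_eq_cnj cnj_cnj[OF part[OF d]] strips_def prev_col_def by fastforce
  have 3: "cnj la \<in> strips n ?c N" if "la \<in> partitions" "vstrip la mu" "plength la \<le> n" for la
    unfolding strips_def
  proof (safe)
    fix k
    show "?c k \<le> cnj la k" using that by (auto simp: vstrip_def)
    show "cnj la k \<le> prev_col n ?c k"
      using that by (cases k) (auto simp: vstrip_def prev_col_def plength_eq_cnj)
    assume k: "k \<ge> N"
    then have "?c (k - 1) = 0" using cnj_eq_0[OF mu(1)] N by auto
    then show "cnj la k = 0" using that(2) k N unfolding vstrip_def
      by (cases k) (auto, metis le_zero_eq)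
  qed
  show ?thesis
    by (rule bij_betw_byWitness[where f' = cnj])
       (use part 1 2 3 in \<open>auto simp: cnj_cnj cnj_in_partitions\<close>)
qed

text \<open>Trades the q-binomials counted inside n rows for \<open>e_coeff\<close>. When they are
  expanded, the numerators cancel the normalisation of mu, and the factors with
  \<open>prev_col\<close> in the denominator, shifted by one column, split off (q;q)_(n - l(lambda))
  and leave the denominators of \<open>e_coeff\<close>.\<close>

lemma strip_coefficient:
  assumes q: "0 < q" "q < 1" and mu: "mu \<in> partitions" "plength mu \<le> n"
    and la: "la \<in> partitions" "vstrip la mu" "plength la \<le> n"
    and N: "mu 0 < N" "la 0 \<le> N"
  shows "(\<Prod>k<N. qbinom q (prev_col n (cnj mu) k - cnj mu k) (cnj la k - cnj mu k))
      / (qpoch q q (n - plength mu) * b_part q mu)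
    = e_coeff q la mu / (qpoch q q (n - plength la) * b_part q la)"
proof -
  let ?c = "cnj mu" and ?d = "cnj la" and ?p = "prev_col n (cnj mu)"
  obtain M where M: "N = Suc M" using N by (cases N) auto
  have dc: "?c k \<le> ?d k" "?d k \<le> ?p k" "?d (Suc k) \<le> ?c k" for k
    using la mu by (cases k; auto simp: vstrip_def prev_col_def plength_eq_cnj)+
  have pos: "qpoch q q i > 0" for i using qpoch_pos q by simp
  have 1: "qpoch q q (n - plength mu) * b_part q mu = (\<Prod>k<N. qpoch q q (?p k - ?c k))"
    unfolding M prod.lessThan_Suc_shift b_part_eq[OF mu(1), of M] using N M
    by (subst b_part_eq[OF mu(1), of M]) (auto simp: prev_col_def plength_eq_cnj)
  have "(\<Prod>k<N. qpoch q q (?p k - ?d k))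
    = qpoch q q (n - plength la) * (\<Prod>k<M. qpoch q q (?c k - ?d (Suc k)))"
    unfolding M prod.lessThan_Suc_shift by (simp add: prev_col_def plength_eq_cnj)
  \<comment> \<open>Since N > mu 0, column M of mu is empty, so the factor that extends the product
    from M to N is 1.\<close>
  moreover have "?c M = 0" using cnj_eq_0[OF mu(1)] N M by simp
  then have "?c M - ?d (Suc M) = 0" by simp
  ultimately have 2: "(\<Prod>k<N. qpoch q q (?p k - ?d k))
    = qpoch q q (n - plength la) * (\<Prod>k<N. qpoch q q (?c k - ?d (Suc k)))"
    unfolding M by simp
  have 3: "e_coeff q la mu = b_part q la / ((\<Prod>k<N. qpoch q q (?d k - ?c k)) * (\<Prod>k<N. qpoch q q (?c k - ?d (Suc k))))"
  proof -
    have "e_coeff q la mu = (\<Prod>k<N. qpoch q q (?d k - ?d (Suc k)) /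
      (qpoch q q (?d k - ?c k) * qpoch q q (?c k - ?d (Suc k))))"
      unfolding e_coeff_eq[OF la(1,2) N(2) q]
    proof (intro prod.cong refl)
      fix k
      have "?d k - ?c k \<le> ?d k - ?d (Suc k)" "?d k - ?d (Suc k) - (?d k - ?c k) = ?c k - ?d (Suc k)"
        using dc[of k] by auto
      then show "qbinom q (?d k - ?d (Suc k)) (?d k - ?c k) = qpoch q q (?d k - ?d (Suc k)) /
        (qpoch q q (?d k - ?c k) * qpoch q q (?c k - ?d (Suc k)))"
        by (simp add: qbinom_def)
    qed
    then show ?thesis unfolding b_part_eq[OF la(1) N(2)] by (simp add: prod_dividef prod.distrib)
  qed
  have 4: "(\<Prod>k<N. qbinom q (?p k - ?c k) (?d k - ?c k))
    = (\<Prod>k<N. qpoch q q (?p k - ?c k)) / ((\<Prod>k<N. qpoch q q (?d k - ?c k)) * (\<Prod>k<N. qpoch q q (?p k - ?d k)))"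
    unfolding prod.distrib[symmetric] prod_dividef[symmetric] qbinom_def
    using dc by (intro prod.cong refl) (auto simp: diff_le_mono)
  have nz: "(\<Prod>k<N. qpoch q q (?p k - ?c k)) \<noteq> 0" "b_part q la \<noteq> 0"
    using pos b_part_pos[OF q, of la] by (auto simp: less_imp_neq[symmetric])
  show ?thesis unfolding 4 3 1 2 using nz by simp
qed

text \<open>The product of the 1 + z x_i is symmetric and hence may be moved inside the symmetriser,
  where \<open>hl_sum_strips\<close> spreads it over the columns. The power of z records the size of
  the strip, which treats all e_r together.\<close>

lemma prod_pieri:
  assumes q: "0 < q" "q < 1" and inj: "inj_on x {..<n}"
    and mu: "mu \<in> partitions" "plength mu \<le> n"
  shows "(\<Prod>i<n. 1 + z * x i) * hl_P q mu n x
    = (\<Sum>la | la \<in> partitions \<and> vstrip la mu \<and> plength la \<le> n.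
        e_coeff q la mu * z ^ (psize la - psize mu) * hl_P q la n x)"
proof -
  let ?c = "cnj mu" and ?p = "prev_col n (cnj mu)"
  define N where "N = Suc (mu 0)"
  have N: "mu 0 < N" by (simp add: N_def)
  let ?C = "(1 - q) ^ n"
  have c: "antimono ?c" "?c 0 \<le> n"
    using partitionsD(1)[OF cnj_in_partitions[OF mu(1)]] mu(2) by (auto simp: plength_eq_cnj)
  have p0: "?p N = 0" using cnj_eq_0[OF mu(1)] by (simp add: N_def prev_col_def)
  have "(\<Prod>i<n. 1 + z * x i) * hl_P q mu n x = ?C / (qpoch q q (n - plength mu) * b_part q mu)
    * hl_sum q n (\<lambda>y. cmon ?c N y * (\<Prod>i<n. 1 + z * y i)) x"
  proof -
    have "(\<Prod>i<n. 1 + z * (x \<circ> w) i) = (\<Prod>i<n. 1 + z * x i)" if "w permutes {..<n}" for w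
      using prod.permute[OF that, of "\<lambda>i. 1 + z * x i"] by (simp add: comp_def)
    then show ?thesis
      unfolding hl_P_eq[OF mu less_imp_le[OF N]] hl_sum_def sum_distrib_left
      by (intro sum.cong refl) (simp add: mult_ac)
  qed
  also have "hl_sum q n (\<lambda>y. cmon ?c N y * (\<Prod>i<n. 1 + z * y i)) x
    = (\<Sum>d\<in>strips n ?c N. (\<Prod>k<N. qbinom q (?p k - ?c k) (d k - ?c k) * z ^ (d k - ?c k))
        * hl_sum q n (cmon d N) x)"
    unfolding hl_sum_strips[OF q inj c order_refl] by (simp add: p0)
  also have "?C / (qpoch q q (n - plength mu) * b_part q mu) * \<dots>
    = (\<Sum>d\<in>strips n ?c N. e_coeff q (cnj d) mu * z ^ (psize (cnj d) - psize mu) * hl_P q (cnj d) n x)"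
    unfolding sum_distrib_left
  proof (rule sum.cong[OF refl])
    fix d assume d: "d \<in> strips n ?c N"
    then have "cnj d \<in> cnj ` strips n ?c N" by blast
    then have la: "cnj d \<in> partitions" "vstrip (cnj d) mu" "plength (cnj d) \<le> n"
      unfolding bij_betw_imp_surj_on[OF bij_betw_strips[OF mu N]] by auto
    have dN: "d k = 0" if "k \<ge> N" for k using d that by (simp add: strips_def)
    have dp: "d \<in> partitions" by (rule strips_in_partitions[OF mu N d])
    have cc: "cnj (cnj d) = d" by (rule cnj_cnj[OF dp])
    have la0: "cnj d 0 \<le> N"
      using plength_cnj[OF la(1)] dN cnj_0[OF dp] less_cnj_iff[OF dp, of N 0] by simp
    have zz: "(\<Prod>k<N. z ^ (d k - ?c k)) = z ^ (psize (cnj d) - psize mu)"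
    proof -
      have "(\<Sum>k<N. d k - ?c k) = (\<Sum>k<N. d k) - (\<Sum>k<N. ?c k)"
        using d by (intro sum_subtractf_nat) (auto simp: strips_def)
      also have "(\<Sum>k<N. d k) = psize (cnj d)"
        using psize_eq_sum[of N d] dN psize_cnj[OF dp] by simp
      also have "(\<Sum>k<N. ?c k) = psize mu"
        using psize_eq_sum[of N ?c] cnj_eq_0[OF mu(1)] N psize_cnj[OF mu(1)] by simp
      finally show ?thesis by (simp flip: power_sum)
    qed
    have "?C / (qpoch q q (n - plength mu) * b_part q mu)
      * ((\<Prod>k<N. qbinom q (?p k - ?c k) (d k - ?c k) * z ^ (d k - ?c k)) * hl_sum q n (cmon d N) x)
      = (\<Prod>k<N. qbinom q (?p k - ?c k) (d k - ?c k)) / (qpoch q q (n - plength mu) * b_part q mu)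
       * (?C * (z ^ (psize (cnj d) - psize mu) * hl_sum q n (cmon d N) x))"
      by (simp add: prod.distrib zz)
    also have "\<dots> = e_coeff q (cnj d) mu * z ^ (psize (cnj d) - psize mu) * hl_P q (cnj d) n x"
      using strip_coefficient[OF q mu la N la0]
      unfolding hl_P_eq[OF la(1,3) la0] cc by (simp add: mult_ac)
    finally show "?C / (qpoch q q (n - plength mu) * b_part q mu)
      * ((\<Prod>k<N. qbinom q (?p k - ?c k) (d k - ?c k) * z ^ (d k - ?c k)) * hl_sum q n (cmon d N) x)
      = e_coeff q (cnj d) mu * z ^ (psize (cnj d) - psize mu) * hl_P q (cnj d) n x" .
  qed
  also have "\<dots> = (\<Sum>la | la \<in> partitions \<and> vstrip la mu \<and> plength la \<le> n.
        e_coeff q la mu * z ^ (psize la - psize mu) * hl_P q la n x)"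
    by (rule sum.reindex_bij_betw[OF bij_betw_strips[OF mu N]])
  finally show ?thesis .
qed

definition elem_sym :: "nat \<Rightarrow> nat \<Rightarrow> (nat \<Rightarrow> real) \<Rightarrow> real" where
  "elem_sym r n x = (\<Sum>S | S \<subseteq> {..<n} \<and> card S = r. \<Prod>i\<in>S. x i)"

lemma elem_sym_0 [simp]: "elem_sym 0 n x = 1"
proof -
  have "S = {}" if "S \<subseteq> {..<n}" "card S = 0" for S
    using that finite_subset[OF that(1)] by simp
  then have "{S. S \<subseteq> {..<n} \<and> card S = 0} = {{}}" by auto
  then have "elem_sym 0 n x = (\<Sum>S\<in>{{}}. prod x S)" by (simp only: elem_sym_def)
  then show ?thesis by simp
qed

lemma elem_sym_eq_0:
  assumes "n < r"
  shows "elem_sym r n x = 0"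
proof -
  have "\<not> (S \<subseteq> {..<n} \<and> card S = r)" for S
    using card_mono[of "{..<n}" S] assms by auto
  then have "{S. S \<subseteq> {..<n} \<and> card S = r} = {}" by blast
  then show ?thesis by (simp only: elem_sym_def sum.empty)
qed

lemma prod_eq_elem_sym: "(\<Prod>i<n. 1 + z * x i) = (\<Sum>r\<le>n. elem_sym r n x * z ^ r)"
proof -
  have "(\<Prod>i<n. 1 + z * x i) = (\<Prod>i<n. z * x i + 1)" by (simp add: add.commute)
  also have "\<dots> = (\<Sum>S\<in>Pow {..<n}. z ^ card S * (\<Prod>i\<in>S. x i))"
    by (simp add: prod_add prod.distrib)
  also have "\<dots> = (\<Sum>r\<le>n. \<Sum>S | S \<in> Pow {..<n} \<and> card S = r. z ^ card S * (\<Prod>i\<in>S. x i))"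
    by (rule sum.group[symmetric]) (auto intro!: card_mono[of "{..<n}", simplified])
  also have "\<dots> = (\<Sum>r\<le>n. elem_sym r n x * z ^ r)"
    by (intro sum.cong refl) (simp add: elem_sym_def sum_distrib_left mult.commute)
  finally show ?thesis .
qed

lemma vstrip_psize_le:
  assumes "la \<in> partitions" "mu \<in> partitions" "vstrip la mu"
  shows "psize mu \<le> psize la" "plength mu \<le> plength la"
  using contained_psize_le[OF assms(1,2)] assms(3) by (auto simp: vstrip_def plength_eq_cnj)

text \<open>Coefficients of powers of z in \<open>prod_pieri\<close> are compared. With fewer than
  l(mu) variables both sides vanish, because adding a strip never removes rows, so the rule holds
  for every n.\<close>

lemma elem_sym_pieri:
  assumes q: "0 < q" "q < 1" and inj: "inj_on x {..<n}" and mu: "mu \<in> partitions"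
  shows "elem_sym r n x * hl_P q mu n x
    = (\<Sum>la | la \<in> partitions \<and> psize la = psize mu + r. e_coeff q la mu * hl_P q la n x)"
proof (cases "plength mu \<le> n")
  case True
  let ?V = "{la. la \<in> partitions \<and> vstrip la mu \<and> plength la \<le> n}"
  let ?c = "\<lambda>r. \<Sum>la | la \<in> ?V \<and> psize la - psize mu = r. e_coeff q la mu * hl_P q la n x"
  have finV: "finite ?V"
  proof -
    have "strips n (cnj mu) (Suc (mu 0)) \<subseteq> {f. \<forall>k. (k \<in> {..mu 0} \<longrightarrow> f k \<in> {..n}) \<and> (k \<notin> {..mu 0} \<longrightarrow> f k = 0)}"
    proof -
      have "prev_col n (cnj mu) k \<le> n" for k
        using partition_le[OF cnj_in_partitions[OF mu], of 0 "k - 1"] True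
        by (auto simp: prev_col_def plength_eq_cnj)
      then show ?thesis by (auto simp: strips_def less_Suc_eq_le intro: order_trans)
    qed
    moreover have "finite \<dots>" by (rule finite_set_of_finite_funs) auto
    ultimately have "finite (strips n (cnj mu) (Suc (mu 0)))" by (rule finite_subset)
    then show ?thesis
      using bij_betw_finite[OF bij_betw_strips[OF mu True, of "Suc (mu 0)"]] by simp
  qed
  define M where "M = r + n + (\<Sum>la\<in>?V. psize la)"
  have "(\<Sum>i\<le>M. (elem_sym i n x * hl_P q mu n x) * z ^ i) = (\<Sum>i\<le>M. ?c i * z ^ i)" for z
  proof -
    have "(\<Sum>i\<le>M. (elem_sym i n x * hl_P q mu n x) * z ^ i) = (\<Sum>i\<le>n. (elem_sym i n x * hl_P q mu n x) * z ^ i)"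
      by (rule sum.mono_neutral_right) (auto simp: M_def elem_sym_eq_0)
    also have "\<dots> = (\<Prod>i<n. 1 + z * x i) * hl_P q mu n x"
      unfolding prod_eq_elem_sym sum_distrib_right by (simp add: mult_ac)
    also have "\<dots> = (\<Sum>la\<in>?V. e_coeff q la mu * z ^ (psize la - psize mu) * hl_P q la n x)"
      by (rule prod_pieri[OF q inj mu True])
    also have "\<dots> = (\<Sum>i\<le>M. \<Sum>la | la \<in> ?V \<and> psize la - psize mu = i. e_coeff q la mu * z ^ (psize la - psize mu) * hl_P q la n x)"
    proof (rule sum.group[symmetric])
      show "(\<lambda>la. psize la - psize mu) ` ?V \<subseteq> {..M}"
      proof (rule image_subsetI)
        fix la assume "la \<in> ?V"
        then have "psize la \<le> (\<Sum>la\<in>?V. psize la)" using finV by (intro member_le_sum) auto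
        then show "psize la - psize mu \<in> {..M}" by (simp add: M_def)
      qed
    qed (use finV in auto)
    also have "\<dots> = (\<Sum>i\<le>M. ?c i * z ^ i)"
      by (intro sum.cong refl) (simp add: sum_distrib_left sum_distrib_right mult_ac)
    finally show ?thesis .
  qed
  then have "elem_sym r n x * hl_P q mu n x = ?c r"
    using polyfun_eq_coeffs[of "\<lambda>i. elem_sym i n x * hl_P q mu n x" M ?c] by (auto simp: M_def)
  also have "\<dots> = (\<Sum>la | la \<in> partitions \<and> psize la = psize mu + r. e_coeff q la mu * hl_P q la n x)"
  proof (rule sum.mono_neutral_left)
    show "finite {la \<in> partitions. psize la = psize mu + r}" by (rule finite_partitions_psize)
    show "{la \<in> ?V. psize la - psize mu = r} \<subseteq> {la \<in> partitions. psize la = psize mu + r}"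
      using vstrip_psize_le(1)[OF _ mu] by fastforce
  qed (auto simp: e_coeff_def hl_P_def)
  finally show ?thesis .
next
  case False
  have "e_coeff q la mu * hl_P q la n x = 0" if "la \<in> partitions" for la
    using vstrip_psize_le(2)[OF that mu] False by (auto simp: e_coeff_def hl_P_def)
  then have "(\<Sum>la | la \<in> partitions \<and> psize la = psize mu + r. e_coeff q la mu * hl_P q la n x) = 0"
    by (intro sum.neutral) blast
  moreover have "hl_P q mu n x = 0" using False by (simp add: hl_P_def)
  ultimately show ?thesis by simp
qed

section \<open>Products of Hall-Littlewood functions stay in their span\<close>

text \<open>The coefficients are chosen before n and x: an expansion counts only if it holds in all
  numbers of variables at once, that is, as an identity of symmetric functions.\<close>

definition hl_span :: "real \<Rightarrow> nat \<Rightarrow> (nat \<Rightarrow> (nat \<Rightarrow> real) \<Rightarrow> real) set" where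
  "hl_span q k = {f. \<exists>a. \<forall>n x. inj_on x {..<n} \<longrightarrow>
     f n x = (\<Sum>la | la \<in> partitions \<and> psize la = k. a la * hl_P q la n x)}"

lemma hl_span_sum:
  assumes "\<And>i. i \<in> I \<Longrightarrow> f i \<in> hl_span q k"
  shows "(\<lambda>n x. \<Sum>i\<in>I. b i * f i n x) \<in> hl_span q k"
proof -
  have "\<forall>i\<in>I. \<exists>a. \<forall>n x. inj_on x {..<n} \<longrightarrow>
     f i n x = (\<Sum>la | la \<in> partitions \<and> psize la = k. a la * hl_P q la n x)"
    using assms unfolding hl_span_def by blast
  then obtain a where "\<forall>i\<in>I. \<forall>n x. inj_on x {..<n} \<longrightarrow>
     f i n x = (\<Sum>la | la \<in> partitions \<and> psize la = k. a i la * hl_P q la n x)"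
    unfolding bchoice_iff by blast
  then have a: "f i n x = (\<Sum>la | la \<in> partitions \<and> psize la = k. a i la * hl_P q la n x)"
    if "i \<in> I" "inj_on x {..<n}" for i n x
    using that by blast
  show ?thesis unfolding hl_span_def mem_Collect_eq
  proof (intro exI allI impI)
    fix n and x :: "nat \<Rightarrow> real" assume x: "inj_on x {..<n}"
    have "(\<Sum>i\<in>I. b i * f i n x) = (\<Sum>i\<in>I. \<Sum>la | la \<in> partitions \<and> psize la = k. b i * a i la * hl_P q la n x)"
      by (simp add: a[OF _ x] sum_distrib_left mult_ac)
    also have "\<dots> = (\<Sum>la | la \<in> partitions \<and> psize la = k. (\<Sum>i\<in>I. b i * a i la) * hl_P q la n x)"
      by (subst sum.swap) (simp add: sum_distrib_right)
    finally show "(\<Sum>i\<in>I. b i * f i n x) = \<dots>" .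
  qed
qed

lemma hl_span_diff:
  assumes "f \<in> hl_span q k" "g \<in> hl_span q k"
  shows "(\<lambda>n x. f n x - g n x) \<in> hl_span q k"
  using hl_span_sum[of UNIV "\<lambda>b. if b then f else g" q k "\<lambda>b. if b then 1 else -1"] assms
  by (simp add: UNIV_bool)

lemma hl_span_cong:
  assumes "f \<in> hl_span q k" "\<And>n x. inj_on x {..<n} \<Longrightarrow> g n x = f n x"
  shows "g \<in> hl_span q k"
  using assms unfolding hl_span_def by auto

lemma elem_sym_hl_span:
  assumes q: "0 < q" "q < 1" and f: "f \<in> hl_span q k"
  shows "(\<lambda>n x. elem_sym r n x * f n x) \<in> hl_span q (k + r)"
proof -
  obtain a where a: "f n x = (\<Sum>la | la \<in> partitions \<and> psize la = k. a la * hl_P q la n x)"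
    if "inj_on x {..<n}" for n x using f unfolding hl_span_def by auto
  have "(\<lambda>n x. elem_sym r n x * hl_P q mu n x) \<in> hl_span q (k + r)"
    if "mu \<in> partitions \<and> psize mu = k" for mu
    unfolding hl_span_def using elem_sym_pieri[OF q, of _ _ mu r] that by auto
  from hl_span_sum[of "{mu. mu \<in> partitions \<and> psize mu = k}" "\<lambda>mu n x. elem_sym r n x * hl_P q mu n x", OF this]
  show ?thesis
    by (rule hl_span_cong) (simp_all add: a sum_distrib_left mult_ac)
qed

definition tail_col :: "(nat \<Rightarrow> nat) \<Rightarrow> nat \<Rightarrow> nat" where
  "tail_col mu = cnj (\<lambda>k. cnj mu (Suc k))"

lemma tail_col:
  assumes mu: "mu \<in> partitions"
  shows "tail_col mu \<in> partitions" "cnj (tail_col mu) k = cnj mu (Suc k)"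
    "psize mu = psize (tail_col mu) + plength mu"
proof -
  let ?c = "\<lambda>k. cnj mu (Suc k)"
  have c: "?c \<in> partitions"
    using cnj_in_partitions[OF mu] finite_vimageI[of "{i. cnj mu i \<noteq> 0}" Suc]
    by (auto simp: partitions_def antimono_def vimage_def)
  show "tail_col mu \<in> partitions" unfolding tail_col_def by (rule cnj_in_partitions[OF c])
  show "cnj (tail_col mu) k = ?c k" unfolding tail_col_def by (simp add: cnj_cnj[OF c])
  have "psize mu = (\<Sum>k<Suc (mu 0). cnj mu k)"
    unfolding psize_cnj[OF mu, symmetric] by (rule psize_eq_sum) (simp add: cnj_eq_0[OF mu])
  also have "\<dots> = plength mu + (\<Sum>k<mu 0. ?c k)"
    by (simp only: sum.lessThan_Suc_shift plength_eq_cnj)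
  also have "(\<Sum>k<mu 0. ?c k) = psize (tail_col mu)"
    unfolding tail_col_def psize_cnj[OF c] by (rule psize_eq_sum[symmetric]) (simp add: cnj_eq_0[OF mu])
  finally show "psize mu = psize (tail_col mu) + plength mu" by simp
qed

lemma partition_zero: "(\<lambda>_. 0) \<in> partitions"
  by (auto simp: partitions_def antimono_def)

lemma partition_eq_zero: "mu \<in> partitions \<Longrightarrow> plength mu = 0 \<Longrightarrow> mu = (\<lambda>_. 0)"
  using partition_support[of mu] by (auto simp: plength_eq_cnj)

text \<open>If \<open>la\<close> had no more rows than \<open>mu\<close>, its first column would be
  at most that of \<open>mu\<close>, and by interlacing so would every later one. Equal sizes would
  then force \<open>la = mu\<close>.\<close>

lemma vstrip_tail_col:
  assumes mu: "mu \<in> partitions" and la: "la \<in> partitions" "psize la = psize mu" "vstrip la (tail_col mu)"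
    and "la \<noteq> mu"
  shows "plength mu < plength la"
proof (rule ccontr)
  assume "\<not> plength mu < plength la"
  then have le: "cnj la k \<le> cnj mu k" for k
    using la(3) tail_col(2)[OF mu] by (cases k) (auto simp: vstrip_def plength_eq_cnj)
  have "cnj la = cnj mu"
  proof (rule ccontr)
    assume "cnj la \<noteq> cnj mu"
    then obtain k where k: "cnj la k < cnj mu k" using le by (meson ext le_neq_implies_less)
    have "psize la = (\<Sum>k<la 0 + mu 0. cnj la k)"
      unfolding psize_cnj[OF la(1), symmetric] by (rule psize_eq_sum) (simp add: cnj_eq_0[OF la(1)])
    also have "\<dots> < (\<Sum>k<la 0 + mu 0. cnj mu k)"
    proof (rule sum_strict_mono_ex1)
      have "k < mu 0" using k cnj_eq_0[OF mu, of k] by (cases "k < mu 0") auto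
      then show "\<exists>a\<in>{..<la 0 + mu 0}. cnj la a < cnj mu a" using k by (intro bexI[of _ k]) auto
    qed (use le in auto)
    also have "\<dots> = psize mu"
      unfolding psize_cnj[OF mu, symmetric] by (rule psize_eq_sum[symmetric]) (simp add: cnj_eq_0[OF mu])
    finally show False using la(2) by simp
  qed
  then show False using \<open>la \<noteq> mu\<close> cnj_cnj[OF mu] cnj_cnj[OF la(1)] by simp
qed

lemma e_coeff_tail_col:
  assumes q: "0 < q" "q < 1" and mu: "mu \<in> partitions"
  shows "e_coeff q mu (tail_col mu) = 1"
proof -
  have "vstrip mu (tail_col mu)"
    using partition_le[OF cnj_in_partitions[OF mu]] by (auto simp: vstrip_def tail_col(2)[OF mu])
  then show ?thesis unfolding e_coeff_def tail_col(2)[OF mu] using q by simp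
qed

text \<open>Solve the Pieri rule for $P_\mu$: by \<open>vstrip_tail_col\<close> every other term of the product of
  $e_{l(\mu)}$ with $P$ of the remaining columns has more parts.\<close>

lemma hl_P_hl_span:
  assumes q: "0 < q" "q < 1"
  shows "mu \<in> partitions \<Longrightarrow> f \<in> hl_span q k \<Longrightarrow> (\<lambda>n x. hl_P q mu n x * f n x) \<in> hl_span q (k + psize mu)"
\<comment> \<open>Removing a column lowers the size; the other terms keep the size but have more
  parts, which lowers the second measure. Keeping f arbitrary turns a formula for P_mu into closure
  under multiplication by P_mu.\<close>
proof (induction mu arbitrary: f k rule: wf_induct[OF wf_measures, of "[psize, \<lambda>mu. psize mu - plength mu]"])
  case (1 mu)
  note mu = \<open>mu \<in> partitions\<close>
  show ?case
  proof (cases "plength mu = 0")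
    case True
    then have "mu = (\<lambda>_. 0)" by (rule partition_eq_zero[OF mu])
    moreover have "psize (\<lambda>_. 0) = 0" by (simp add: psize_def)
    ultimately show ?thesis using 1 by (auto intro!: hl_span_cong[of f] simp: hl_P_zero[OF q])
  next
    case False
    let ?t = "tail_col mu" and ?r = "plength mu"
    let ?L = "{la. la \<in> partitions \<and> psize la = psize mu}"
    have "(\<lambda>n x. hl_P q ?t n x * f n x) \<in> hl_span q (k + psize ?t)"
      using 1 tail_col[OF mu] False by auto
    then have 2: "(\<lambda>n x. elem_sym ?r n x * (hl_P q ?t n x * f n x)) \<in> hl_span q (k + psize mu)"
      using elem_sym_hl_span[OF q, of _ "k + psize ?t" ?r] by (simp add: tail_col(3)[OF mu] add.assoc)
    \<comment> \<open>Outside vertical strips \<open>e_coeff\<close> is 0. The guard replaces such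
      terms by 0, since the induction hypothesis is only available for the strips.\<close>
    have 3: "(\<lambda>n x. \<Sum>la\<in>?L - {mu}. e_coeff q la ?t * (if vstrip la ?t then hl_P q la n x * f n x else 0))
      \<in> hl_span q (k + psize mu)"
    proof (rule hl_span_sum)
      fix la assume la: "la \<in> ?L - {mu}"
      show "(\<lambda>n x. if vstrip la ?t then hl_P q la n x * f n x else 0) \<in> hl_span q (k + psize mu)"
      proof (cases "vstrip la ?t")
        case True
        then have "plength mu < plength la" using vstrip_tail_col[OF mu] la by auto
        moreover have "plength la \<le> psize la" using la by (intro plength_le_psize) auto
        ultimately have "(la, mu) \<in> measures [psize, \<lambda>mu. psize mu - plength mu]" using la by auto
        then show ?thesis using 1 la True by auto
      qed (use hl_span_sum[of "{}" "\<lambda>_ _ _. 0" q "k + psize mu" "\<lambda>_. 0"] in simp)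
    qed
    show ?thesis
    proof (rule hl_span_cong[OF hl_span_diff[OF 2 3]])
      fix n and x :: "nat \<Rightarrow> real" assume x: "inj_on x {..<n}"
      have "elem_sym ?r n x * hl_P q ?t n x = (\<Sum>la\<in>?L. e_coeff q la ?t * hl_P q la n x)"
        using elem_sym_pieri[OF q x tail_col(1)[OF mu], of ?r] by (simp add: tail_col(3)[OF mu])
      also have "\<dots> = hl_P q mu n x + (\<Sum>la\<in>?L - {mu}. e_coeff q la ?t * hl_P q la n x)"
        using mu by (subst sum.remove[of _ mu]) (auto simp: e_coeff_tail_col[OF q mu] finite_partitions_psize)
      finally have "hl_P q mu n x * f n x = elem_sym ?r n x * (hl_P q ?t n x * f n x)
        - (\<Sum>la\<in>?L - {mu}. e_coeff q la ?t * hl_P q la n x) * f n x"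
        by (simp add: algebra_simps)
      also have "(\<Sum>la\<in>?L - {mu}. e_coeff q la ?t * hl_P q la n x) * f n x
        = (\<Sum>la\<in>?L - {mu}. e_coeff q la ?t * (if vstrip la ?t then hl_P q la n x * f n x else 0))"
        unfolding sum_distrib_right by (intro sum.cong refl) (auto simp: e_coeff_def)
      finally show "hl_P q mu n x * f n x = elem_sym ?r n x * (hl_P q ?t n x * f n x)
        - (\<Sum>la\<in>?L - {mu}. e_coeff q la ?t * (if vstrip la ?t then hl_P q la n x * f n x else 0))" .
    qed
  qed
qed

lemma hl_P_in_span:
  assumes "mu \<in> partitions"
  shows "hl_P q mu \<in> hl_span q (psize mu)"
  unfolding hl_span_def mem_Collect_eq
proof (intro exI allI impI)
  fix n and x :: "nat \<Rightarrow> real"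
  show "hl_P q mu n x = (\<Sum>la | la \<in> partitions \<and> psize la = psize mu. (if la = mu then 1 else 0) * hl_P q la n x)"
    using assms by (subst sum.remove[of _ mu]) (auto simp: finite_partitions_psize)
qed

section \<open>Structure constants\<close>

text \<open>The limit is 1 for a < b and q for a > b. Its sign is the point: positive limits keep
  the terms of different permutations from cancelling.\<close>

lemma quotient_limit:
  assumes q: "0 < q" "q < (1::real)" and "a \<noteq> (b::nat)"
  shows "\<exists>L>0. ((\<lambda>s. (s ^ a - q * s ^ b) / (s ^ a - s ^ b)) \<longlongrightarrow> L) (at_right 0)"
proof -
  have pos: "eventually (\<lambda>s::real. 0 < s) (at_right 0)" by (rule eventually_at_right_less)
  consider c where "b = a + Suc c" | c where "a = b + Suc c"
    using assms(3) by (metis add_Suc_right less_iff_Suc_add linorder_neqE_nat)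
  then show ?thesis
  proof cases
    case 1
    have "((\<lambda>s::real. (1 - q * s ^ Suc c) / (1 - s ^ Suc c)) \<longlongrightarrow> (1 - q * 0 ^ Suc c) / (1 - 0 ^ Suc c)) (at_right 0)"
      by (intro tendsto_intros) auto
    moreover have "eventually (\<lambda>s. (1 - q * s ^ Suc c) / (1 - s ^ Suc c) = (s ^ a - q * s ^ b) / (s ^ a - s ^ b)) (at_right 0)"
      using pos
    proof eventually_elim
      case (elim s)
      have "(s ^ a - q * s ^ b) / (s ^ a - s ^ b) = (s ^ a * (1 - q * s ^ Suc c)) / (s ^ a * (1 - s ^ Suc c))"
        unfolding 1 power_add by (simp add: algebra_simps)
      then show ?case using elim by (simp del: power_Suc)
    qed
    ultimately have "((\<lambda>s. (s ^ a - q * s ^ b) / (s ^ a - s ^ b)) \<longlongrightarrow> 1) (at_right 0)"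
      by (simp add: tendsto_cong)
    then show ?thesis by (intro exI[of _ 1]) auto
  next
    case 2
    have "((\<lambda>s::real. (s ^ Suc c - q) / (s ^ Suc c - 1)) \<longlongrightarrow> (0 ^ Suc c - q) / (0 ^ Suc c - 1)) (at_right 0)"
      by (intro tendsto_intros) auto
    moreover have "eventually (\<lambda>s. (s ^ Suc c - q) / (s ^ Suc c - 1) = (s ^ a - q * s ^ b) / (s ^ a - s ^ b)) (at_right 0)"
      using pos
    proof eventually_elim
      case (elim s)
      have "(s ^ a - q * s ^ b) / (s ^ a - s ^ b) = (s ^ b * (s ^ Suc c - q)) / (s ^ b * (s ^ Suc c - 1))"
        unfolding 2 power_add by (simp add: algebra_simps)
      then show ?case using elim by (simp del: power_Suc)
    qed
    ultimately have "((\<lambda>s. (s ^ a - q * s ^ b) / (s ^ a - s ^ b)) \<longlongrightarrow> q) (at_right 0)"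
      by (simp add: tendsto_cong)
    then show ?thesis using q by (intro exI[of _ q]) auto
  qed
qed

lemma hl_delta_limit:
  assumes q: "0 < q" "q < 1" and inj: "inj_on e {..<n}"
  shows "\<exists>L>0. ((\<lambda>s. hl_delta q n (\<lambda>i. s ^ e i)) \<longlongrightarrow> L) (at_right 0)"
proof -
  let ?A = "{(i, j). i < j \<and> j < n}"
  have "\<forall>p\<in>?A. \<exists>L>0. ((\<lambda>s. case p of (i, j) \<Rightarrow> (s ^ e i - q * s ^ e j) / (s ^ e i - s ^ e j)) \<longlongrightarrow> L) (at_right 0)"
  proof safe
    fix i j assume "i < j" "j < n"
    then have "e i \<noteq> e j" using inj_onD[OF inj, of i j] by auto
    then show "\<exists>L>0. ((\<lambda>s. (s ^ e i - q * s ^ e j) / (s ^ e i - s ^ e j)) \<longlongrightarrow> L) (at_right 0)"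
      by (rule quotient_limit[OF q])
  qed
  then obtain L where L: "\<forall>p\<in>?A. L p > 0 \<and> ((\<lambda>s. case p of (i, j) \<Rightarrow> (s ^ e i - q * s ^ e j) / (s ^ e i - s ^ e j)) \<longlongrightarrow> L p) (at_right 0)"
    unfolding bchoice_iff by blast
  have "((\<lambda>s. hl_delta q n (\<lambda>i. s ^ e i)) \<longlongrightarrow> (\<Prod>p\<in>?A. L p)) (at_right 0)"
    unfolding hl_delta_def using L by (intro tendsto_prod) blast
  moreover have "(\<Prod>p\<in>?A. L p) > 0" using L by (intro prod_pos) blast
  ultimately show ?thesis by blast
qed

text \<open>The terms of least exponent have positive limits, so their sum cannot cancel and the
  least exponent is the exact order of vanishing.\<close>

lemma sum_min_exponent_limit:
  fixes E :: "'a \<Rightarrow> nat" and D :: "'a \<Rightarrow> real \<Rightarrow> real"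
  assumes "finite W" "W \<noteq> {}" and D: "\<And>w. w \<in> W \<Longrightarrow> \<exists>L>0. (D w \<longlongrightarrow> L) (at_right 0)"
  shows "\<exists>L>0. ((\<lambda>s. (\<Sum>w\<in>W. s ^ E w * D w s) / s ^ Min (E ` W)) \<longlongrightarrow> L) (at_right 0)"
proof -
  let ?m = "Min (E ` W)"
  obtain L where L: "L w > 0" "(D w \<longlongrightarrow> L w) (at_right 0)" if "w \<in> W" for w
    using D by metis
  have le: "?m \<le> E w" if "w \<in> W" for w using that assms by simp
  have "((\<lambda>s. \<Sum>w\<in>W. s ^ (E w - ?m) * D w s) \<longlongrightarrow> (\<Sum>w\<in>W. 0 ^ (E w - ?m) * L w)) (at_right 0)"
    using L(2) by (intro tendsto_intros) auto
  moreover have "eventually (\<lambda>s. (\<Sum>w\<in>W. s ^ (E w - ?m) * D w s) = (\<Sum>w\<in>W. s ^ E w * D w s) / s ^ ?m) (at_right 0)"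
    using eventually_at_right_less
  proof eventually_elim
    case (elim s)
    then show ?case unfolding sum_divide_distrib using le
      by (intro sum.cong refl) (simp add: power_diff)
  qed
  ultimately have "((\<lambda>s. (\<Sum>w\<in>W. s ^ E w * D w s) / s ^ ?m) \<longlongrightarrow> (\<Sum>w\<in>W. 0 ^ (E w - ?m) * L w)) (at_right 0)"
    by (simp add: tendsto_cong)
  moreover have "(\<Sum>w\<in>W. 0 ^ (E w - ?m) * L w) > 0"
  proof -
    have "?m \<in> E ` W" using assms by simp
    then obtain v where "v \<in> W" "E v = ?m" by auto
    then show ?thesis using L(1) by (intro sum_pos2[OF assms(1), of v]) (auto simp: less_imp_le)
  qed
  ultimately show ?thesis by blast
qed

lemma digits_unique:
  assumes "(\<Sum>j<n. f j * B ^ j) = (\<Sum>j<n. g j * B ^ j)"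
    and "\<And>j. j < n \<Longrightarrow> f j < B" "\<And>j. j < n \<Longrightarrow> g j < (B::nat)" and "j < n"
  shows "f j = g j"
  using assms
proof (induction n arbitrary: f g j)
  case (Suc n)
  have B: "f 0 < B" "g 0 < B" using Suc.prems by auto
  have split: "(\<Sum>j<Suc n. f j * B ^ j) = f 0 + B * (\<Sum>j<n. f (Suc j) * B ^ j)" for f
    unfolding sum.lessThan_Suc_shift by (simp add: sum_distrib_left mult_ac)
  have eq: "f 0 + B * (\<Sum>j<n. f (Suc j) * B ^ j) = g 0 + B * (\<Sum>j<n. g (Suc j) * B ^ j)"
    using Suc.prems(1) unfolding split .
  from arg_cong[OF eq, of "\<lambda>u. u mod B"] have 0: "f 0 = g 0" using B by simp
  with eq B have "(\<Sum>j<n. f (Suc j) * B ^ j) = (\<Sum>j<n. g (Suc j) * B ^ j)" by simp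
  then have "f (Suc i) = g (Suc i)" if "i < n" for i
    using Suc.IH[of "\<lambda>j. f (Suc j)" "\<lambda>j. g (Suc j)" i] Suc.prems that by auto
  with 0 show ?case using Suc.prems(4) by (cases j) auto
qed simp

text \<open>Column lengths see only the multiset of parts. This recovers a partition from its parts
  in unknown order.\<close>

lemma cnj_permute:
  assumes la: "la \<in> partitions" "plength la \<le> n" and v: "v permutes {..<n}"
  shows "cnj la k = card {j \<in> {..<n}. k < la (v j)}"
proof -
  have "j < n" if "k < la j" for j
    using that partition_support[OF la(1), of j] la(2) by (simp add: plength_eq_cnj)
  then have "{j. k < la j} \<subseteq> {..<n}" by auto
  then have "{j. k < la j} = v ` {j \<in> {..<n}. k < la (v j)}"
    using permutes_image[OF v] by auto
  then show ?thesis unfolding cnj_def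
    using card_image[OF inj_on_subset[OF permutes_inj[OF v] subset_UNIV]] by simp
qed

text \<open>Evaluate at \<open>x i = s ^ (B ^ i)\<close>: for large \<open>B\<close> the Hall-Littlewood polynomials of distinct
  partitions vanish to distinct orders as \<open>s\<close> tends to \<open>0\<close>.\<close>

lemma hl_P_independent:
  assumes q: "0 < q" "q < 1" and F: "finite F" "F \<subseteq> partitions"
    and zero: "\<And>n x. inj_on x {..<n} \<Longrightarrow> (\<Sum>la\<in>F. a la * hl_P q la n x) = 0"
    and "la \<in> F"
  shows "a la = 0"
proof (rule ccontr)
  assume "a la \<noteq> 0"
  define F' where "F' = {la \<in> F. a la \<noteq> 0}"
  have F': "finite F'" "F' \<noteq> {}" "F' \<subseteq> partitions" using F \<open>la \<in> F\<close> \<open>a la \<noteq> 0\<close> by (auto simp: F'_def)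
  define n where "n = (\<Sum>la\<in>F. plength la)"
  \<comment> \<open>Larger than every part, so that parts can serve as digits to base B; the summand
    2 makes the powers of B distinct.\<close>
  define B where "B = (\<Sum>la\<in>F. la 0) + 2"
  have n: "plength la \<le> n" if "la \<in> F'" for la
    using that F unfolding n_def F'_def by (intro member_le_sum) auto
  have B: "la i < B" if "la \<in> F'" for la i
  proof -
    have "la i \<le> la 0" using partition_le[of la 0 i] that F' by auto
    also have "la 0 \<le> (\<Sum>la\<in>F. la 0)" using that F unfolding F'_def by (intro member_le_sum) auto
    finally show ?thesis by (simp add: B_def)
  qed
  let ?W = "{w. w permutes {..<n}}"
  let ?E = "\<lambda>la w. \<Sum>i<n. B ^ w i * la i"
  let ?x = "\<lambda>s i. s ^ (B ^ i) :: real"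
  define m where "m la = Min (?E la ` ?W)" for la
  have W: "finite ?W" "?W \<noteq> {}" using permutes_id[of "{..<n}"] by (auto simp: finite_permutations simp del: permutes_id)
  have "\<forall>la\<in>F'. \<exists>L>0. ((\<lambda>s. hl_P q la n (?x s) / s ^ m la) \<longlongrightarrow> L) (at_right 0)"
  proof
    fix la assume la: "la \<in> F'"
    have "\<exists>L>0. ((\<lambda>s. (\<Sum>w\<in>?W. s ^ ?E la w * hl_delta q n (\<lambda>i. s ^ (B ^ w i))) / s ^ m la) \<longlongrightarrow> L) (at_right 0)"
      unfolding m_def
    proof (rule sum_min_exponent_limit[OF W])
      fix w assume "w \<in> ?W"
      then have "inj_on (\<lambda>i. B ^ w i) {..<n}"
        by (auto simp: inj_on_def B_def dest: permutes_inj injD)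
      then show "\<exists>L>0. ((\<lambda>s. hl_delta q n (\<lambda>i. s ^ (B ^ w i))) \<longlongrightarrow> L) (at_right 0)"
        by (rule hl_delta_limit[OF q])
    qed
    then obtain L where L: "L > 0"
      "((\<lambda>s. (\<Sum>w\<in>?W. s ^ ?E la w * hl_delta q n (\<lambda>i. s ^ (B ^ w i))) / s ^ m la) \<longlongrightarrow> L) (at_right 0)" by blast
    have v: "hl_v q n la > 0"
      using F' la n[OF la] qpoch_pos[of q q "n - plength la"] b_part_pos[OF q, of la] q
      by (subst hl_v_eq) auto
    have "hl_P q la n (?x s) = 1 / hl_v q n la * (\<Sum>w\<in>?W. s ^ ?E la w * hl_delta q n (\<lambda>i. s ^ (B ^ w i)))" for s
    proof -
      have "(\<Prod>i<n. (s ^ B ^ w i) ^ la i) = s ^ ?E la w" for w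
        by (simp add: power_sum flip: power_mult)
      then show ?thesis using n[OF la] by (simp add: hl_P_def hl_delta_def)
    qed
    then have "((\<lambda>s. hl_P q la n (?x s) / s ^ m la) \<longlongrightarrow> 1 / hl_v q n la * L) (at_right 0)"
      using tendsto_mult[OF tendsto_const[of "1 / hl_v q n la"] L(2)] by simp
    then show "\<exists>L>0. ((\<lambda>s. hl_P q la n (?x s) / s ^ m la) \<longlongrightarrow> L) (at_right 0)"
      using L(1) v by (intro exI[of _ "1 / hl_v q n la * L"]) auto
  qed
  then obtain L where "\<forall>la\<in>F'. L la > 0 \<and> ((\<lambda>s. hl_P q la n (?x s) / s ^ m la) \<longlongrightarrow> L la) (at_right 0)"
    unfolding bchoice_iff by blast
  then have L: "L la > 0" "((\<lambda>s. hl_P q la n (?x s) / s ^ m la) \<longlongrightarrow> L la) (at_right 0)"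
    if "la \<in> F'" for la using that by auto
  \<comment> \<open>Equal orders mean that some arrangement of the parts of \<open>la\<close> and
    some arrangement of those of \<open>ka\<close> are digit sequences of the same number.\<close>
  have m_inj: "la = ka" if h: "la \<in> F'" "ka \<in> F'" "m la = m ka" for la ka
  proof -
    have "m la \<in> ?E la ` ?W" "m ka \<in> ?E ka ` ?W" unfolding m_def using W by (auto intro!: Min_in)
    then obtain w w' where w: "w permutes {..<n}" "w' permutes {..<n}" "?E la w = ?E ka w'"
      unfolding h(3) image_iff by auto
    have E: "?E la w = (\<Sum>j<n. la (inv w j) * B ^ j)" if "w permutes {..<n}" for la w
      using sum.permute[OF permutes_inv[OF that], of "\<lambda>i. B ^ w i * la i"]
      by (simp add: comp_def permutes_inverses[OF that] mult.commute)
    have eq: "la (inv w j) = ka (inv w' j)" if "j < n" for j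
      by (rule digits_unique[where n = n and B = B and f = "\<lambda>j. la (inv w j)" and g = "\<lambda>j. ka (inv w' j)"])
         (use E w that B h in auto)
    have "cnj la = cnj ka"
    proof
      fix k
      have "{j \<in> {..<n}. k < la (inv w j)} = {j \<in> {..<n}. k < ka (inv w' j)}" using eq by auto
      then show "cnj la k = cnj ka k"
        using cnj_permute[of la n "inv w" k] cnj_permute[of ka n "inv w'" k]
          n[OF h(1)] n[OF h(2)] w subsetD[OF F'(3) h(1)] subsetD[OF F'(3) h(2)] by (simp add: permutes_inv)
    qed
    then show ?thesis using cnj_cnj h F' by (metis subsetD)
  qed
  have "Min (m ` F') \<in> m ` F'" using F' by (intro Min_in) auto
  then obtain l where "l \<in> F'" "m l = Min (m ` F')" by auto
  then have l: "l \<in> F'" "\<And>ka. ka \<in> F' \<Longrightarrow> m l \<le> m ka" using F' by auto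
  \<comment> \<open>After division by s^(m l) only the partition of least order survives in the
    limit, which forces its coefficient to vanish.\<close>
  have lim: "((\<lambda>s. \<Sum>ka\<in>F'. a ka * (hl_P q ka n (?x s) / s ^ m ka) * s ^ (m ka - m l))
    \<longlongrightarrow> (\<Sum>ka\<in>F'. a ka * L ka * 0 ^ (m ka - m l))) (at_right 0)"
    using L(2) by (intro tendsto_intros) auto
  have val: "(\<Sum>ka\<in>F'. a ka * L ka * 0 ^ (m ka - m l)) = a l * L l"
  proof -
    have "(\<Sum>ka\<in>F'. a ka * L ka * 0 ^ (m ka - m l)) = (\<Sum>ka\<in>F'. if ka = l then a ka * L ka else 0)"
    proof (intro sum.cong refl)
      fix ka assume "ka \<in> F'"
      then show "a ka * L ka * 0 ^ (m ka - m l) = (if ka = l then a ka * L ka else 0)"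
        using l(1) l(2)[of ka] m_inj[of ka l] by (cases "m ka = m l") (auto simp: le_less)
    qed
    then show ?thesis using F' l by simp
  qed
  have "eventually (\<lambda>s. (\<Sum>ka\<in>F'. a ka * (hl_P q ka n (?x s) / s ^ m ka) * s ^ (m ka - m l)) = 0) (at_right 0)"
  proof -
    have "eventually (\<lambda>s::real. s \<in> {0<..<1}) (at_right 0)"
      by (rule eventually_at_right_real) simp
    then show ?thesis
    proof eventually_elim
      case (elim s)
      have "inj_on (?x s) {..<n}"
      proof (rule inj_onI)
        fix i j assume "s ^ B ^ i = s ^ B ^ j"
        then have "B ^ i = B ^ j" using elim
          by (metis greaterThanLessThan_iff linorder_neqE_nat order_less_irrefl power_strict_decreasing)
        then show "i = j" by (simp add: B_def)
      qed
      then have "0 = (\<Sum>ka\<in>F. a ka * hl_P q ka n (?x s))" using zero by simp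
      also have "\<dots> = (\<Sum>ka\<in>F'. a ka * hl_P q ka n (?x s))"
        unfolding F'_def using F by (intro sum.mono_neutral_right) auto
      finally have z: "(\<Sum>ka\<in>F'. a ka * hl_P q ka n (?x s)) = 0" by simp
      have "(\<Sum>ka\<in>F'. a ka * (hl_P q ka n (?x s) / s ^ m ka) * s ^ (m ka - m l))
        = (\<Sum>ka\<in>F'. a ka * hl_P q ka n (?x s) / s ^ m l)"
        using elim l by (intro sum.cong refl) (auto simp: power_diff)
      also have "\<dots> = 0" unfolding sum_divide_distrib[symmetric] z by simp
      finally show ?case .
    qed
  qed
  from Lim_transform_eventually[OF lim this] have "a l * L l = 0"
    unfolding val by (simp add: tendsto_const_iff)
  then show False using L(1)[OF l(1)] l(1) by (auto simp: F'_def)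
qed

text \<open>Resolves the definite description: existence comes from \<open>hl_P_hl_span\<close>,
  uniqueness from \<open>hl_P_independent\<close>. The restriction on sizes is not part of the
  definition; it is inherited from the witness g.\<close>

lemma hl_g:
  assumes q: "0 < q" "q < 1" and mu: "mu \<in> partitions" and nu: "nu \<in> partitions"
  shows "hl_g q mu nu la \<noteq> 0 \<Longrightarrow> la \<in> partitions \<and> psize la = psize mu + psize nu"
    and "inj_on x {..<n} \<Longrightarrow> hl_Q q mu n x * hl_Q q nu n x
      = (\<Sum>la | la \<in> partitions \<and> psize la = psize mu + psize nu. hl_g q mu nu la * hl_Q q la n x)"
proof -
  let ?L = "{la. la \<in> partitions \<and> psize la = psize mu + psize nu}"
  let ?P = "\<lambda>g. finite {la. g la \<noteq> 0} \<and> {la. g la \<noteq> 0} \<subseteq> partitions \<and>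
        (\<forall>n x. inj_on x {..<n} \<longrightarrow>
           hl_Q q mu n x * hl_Q q nu n x = (\<Sum>la | g la \<noteq> 0. g la * hl_Q q la n x))"
  have b: "b_part q la \<noteq> 0" for la using b_part_pos[OF q, of la] by simp
  have "(\<lambda>n x. hl_P q mu n x * hl_P q nu n x) \<in> hl_span q (psize nu + psize mu)"
    by (rule hl_P_hl_span[OF q mu hl_P_in_span[OF nu]])
  then obtain a where a: "hl_P q mu n x * hl_P q nu n x = (\<Sum>la\<in>?L. a la * hl_P q la n x)"
    if "inj_on x {..<n}" for n x unfolding hl_span_def by (auto simp: add.commute)
  define g where "g la = (if la \<in> ?L then b_part q mu * b_part q nu * a la / b_part q la else 0)" for la
  have fin: "finite ?L" by (rule finite_partitions_psize)
  have gL: "{la. g la \<noteq> 0} \<subseteq> ?L" by (auto simp: g_def)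
  have gsum: "hl_Q q mu n x * hl_Q q nu n x = (\<Sum>la\<in>?L. g la * hl_Q q la n x)" if "inj_on x {..<n}" for n x
  proof -
    have "hl_Q q mu n x * hl_Q q nu n x = b_part q mu * b_part q nu * (\<Sum>la\<in>?L. a la * hl_P q la n x)"
      using a[OF that] by (simp add: hl_Q_def)
    also have "\<dots> = (\<Sum>la\<in>?L. g la * hl_Q q la n x)"
      unfolding sum_distrib_left using b by (intro sum.cong refl) (simp add: g_def hl_Q_def)
    finally show ?thesis .
  qed
  have Pg: "?P g"
  proof (intro conjI allI impI)
    fix n and x :: "nat \<Rightarrow> real" assume x: "inj_on x {..<n}"
    have "(\<Sum>la\<in>?L. g la * hl_Q q la n x) = (\<Sum>la | g la \<noteq> 0. g la * hl_Q q la n x)"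
      using gL fin by (intro sum.mono_neutral_right) auto
    then show "hl_Q q mu n x * hl_Q q nu n x = (\<Sum>la | g la \<noteq> 0. g la * hl_Q q la n x)"
      using gsum[OF x] by simp
  qed (use gL fin in \<open>auto intro: finite_subset\<close>)
  have Pg_sum: "(\<Sum>la | g la \<noteq> 0. g la * hl_Q q la n x) = hl_Q q mu n x * hl_Q q nu n x"
    if "?P g" "inj_on x {..<n}" for g n x using that by simp
  have uniq: "g' = g" if g': "?P g'" for g'
  proof
    fix la
    let ?F = "{la. g la \<noteq> 0} \<union> {la. g' la \<noteq> 0}"
    have F: "finite ?F" "?F \<subseteq> partitions" using Pg g' by auto
    have ext: "(\<Sum>la | h la \<noteq> 0. h la * hl_Q q la n x) = (\<Sum>la\<in>?F. h la * hl_Q q la n x)"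
      if "h = g \<or> h = g'" for h n x using F that by (intro sum.mono_neutral_left) auto
    have "(\<Sum>la\<in>?F. ((g' la - g la) * b_part q la) * hl_P q la n x) = 0" if x: "inj_on x {..<n}" for n x
    proof -
      have "(\<Sum>la\<in>?F. g la * hl_Q q la n x) = (\<Sum>la\<in>?F. g' la * hl_Q q la n x)"
        unfolding ext[of g, simplified, symmetric] ext[of g', simplified, symmetric]
          Pg_sum[OF Pg x] Pg_sum[OF g' x] ..
      then show ?thesis by (simp add: hl_Q_def algebra_simps sum_subtractf)
    qed
    from hl_P_independent[OF q F, of "\<lambda>la. (g' la - g la) * b_part q la" la, OF this]
    show "g' la = g la" using b by (cases "la \<in> ?F") auto
  qed
  have "hl_g q mu nu = g" unfolding hl_g_def by (rule the_equality[where P = ?P]) (fact Pg, fact uniq)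
  then show "hl_g q mu nu la \<noteq> 0 \<Longrightarrow> la \<in> partitions \<and> psize la = psize mu + psize nu"
    and "inj_on x {..<n} \<Longrightarrow> hl_Q q mu n x * hl_Q q nu n x = (\<Sum>la\<in>?L. hl_g q mu nu la * hl_Q q la n x)"
    using gL gsum by auto
qed

section \<open>The Pieri rule for the functions h_r\<close>

text \<open>The candidate for the coefficient of P_lambda in h_r P_mu, confirmed by
  \<open>h_mult_eq\<close>. Here lambda may be any partition containing mu, not only a
  strip.\<close>

definition h_coeff :: "real \<Rightarrow> (nat \<Rightarrow> nat) \<Rightarrow> (nat \<Rightarrow> nat) \<Rightarrow> real" where
  "h_coeff q la mu = (if \<forall>k. cnj mu k \<le> cnj la k
     then \<Prod>k<la 0. q ^ (cnj la k - cnj mu k choose 2) * qbinom q (cnj la k - cnj mu (Suc k)) (cnj la k - cnj mu k)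
     else 0)"

lemma h_coeff_eq:
  assumes la: "la \<in> partitions" "\<forall>k. cnj mu k \<le> cnj la k" "la 0 \<le> N" and q: "0 < q" "q < 1"
  shows "h_coeff q la mu = (\<Prod>k<N. q ^ (cnj la k - cnj mu k choose 2) * qbinom q (cnj la k - cnj mu (Suc k)) (cnj la k - cnj mu k))"
proof -
  have "h_coeff q la mu = (\<Prod>k<la 0. q ^ (cnj la k - cnj mu k choose 2) * qbinom q (cnj la k - cnj mu (Suc k)) (cnj la k - cnj mu k))"
    unfolding h_coeff_def using la by simp
  also have "\<dots> = (\<Prod>k<N. q ^ (cnj la k - cnj mu k choose 2) * qbinom q (cnj la k - cnj mu (Suc k)) (cnj la k - cnj mu k))"
    using la q by (intro prod.mono_neutral_left ballI) (auto simp: cnj_eq_0 not_less numeral_2_eq_2)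
  finally show ?thesis .
qed

text \<open>With y = m + s the two q-binomials regroup as [A + M, A - s] [M + s, s] = [A + M, M]
  [A, s]. What depends on s is the alternating sum of length A, which is 0 because A > 0.\<close>

lemma column_sum_zero:
  assumes q: "0 < q" "q < 1" and "b \<le> m" "m < (a::nat)"
  shows "(\<Sum>y=b..a. (- 1) ^ (a - y) * qbinom q (a - b) (a - y)
    * (if m \<le> y then q ^ (y - m choose 2) * qbinom q (y - b) (y - m) else 0)) = 0"
proof -
  define A M where "A = a - m" and "M = m - b"
  have a: "a = b + M + A" "m = b + M" using assms by (auto simp: A_def M_def)
  have pos: "qpoch q q i > 0" for i using qpoch_pos q by simp
  let ?f = "\<lambda>y. (- 1) ^ (a - y) * qbinom q (a - b) (a - y)
    * (if m \<le> y then q ^ (y - m choose 2) * qbinom q (y - b) (y - m) else 0)"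
  have "(\<Sum>y=b..a. ?f y) = (\<Sum>y=m..a. ?f y)"
    using assms by (intro sum.mono_neutral_right) auto
  also have "\<dots> = (\<Sum>s\<le>A. ?f (m + s))"
    by (rule sum.reindex_bij_witness[of _ "\<lambda>s. m + s" "\<lambda>y. y - m"]) (use assms in \<open>auto simp: A_def\<close>)
  also have "\<dots> = (\<Sum>s\<le>A. (- 1) ^ A * qbinom q (A + M) M * ((- 1) ^ s * q ^ (s choose 2) * qbinom q A s))"
  proof (intro sum.cong refl)
    fix s assume s: "s \<in> {..A}"
    have e: "a - (m + s) = A - s" "a - b = M + A" "m + s - m = s" "m + s - b = M + s"
      "M + A - (A - s) = M + s" "M + s - s = M" "A + M - M = A"
      using s a by auto
    have "(- 1 :: real) ^ A = (- 1) ^ (A - s) * (- 1) ^ s" using s by (simp flip: power_add)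
    then have sgn: "(- 1 :: real) ^ (A - s) = (- 1) ^ A * (- 1) ^ s"
      by (simp add: mult.assoc flip: power_mult_distrib)
    show "?f (m + s) = (- 1) ^ A * qbinom q (A + M) M * ((- 1) ^ s * q ^ (s choose 2) * qbinom q A s)"
      unfolding e sgn qbinom_def using s pos[of s] pos[of M] pos[of A] pos[of "M + s"] pos[of "A - s"]
      by (simp add: e add.commute mult_ac)
  qed
  also have "\<dots> = 0"
    unfolding sum_distrib_left[symmetric] using sum_qbinom_alternating[OF q, of A] assms by (simp add: A_def)
  finally show ?thesis .
qed

text \<open>The two Pieri rules are inverse to each other: the sum over \<open>ka\<close> factorises over the columns,
  and the factor of the last column in which \<open>la\<close> and \<open>mu\<close> differ vanishes.\<close>

lemma e_h_inverse:
  assumes q: "0 < q" "q < 1" and la: "la \<in> partitions" and mu: "mu \<in> partitions"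
  shows "(\<Sum>ka | ka \<in> partitions \<and> vstrip la ka. (- 1) ^ (psize la - psize ka) * e_coeff q la ka * h_coeff q ka mu)
    = (if la = mu then 1 else 0)"
proof (cases "\<forall>k. cnj mu k \<le> cnj la k")
  case False
  then obtain k where k: "cnj la k < cnj mu k" by (auto simp: not_le)
  have "h_coeff q ka mu = 0" if "vstrip la ka" for ka
  proof -
    have "cnj ka k < cnj mu k" using that k by (meson le_less_trans vstrip_def)
    then have "\<not> (\<forall>k. cnj mu k \<le> cnj ka k)" by (meson not_le)
    then show ?thesis unfolding h_coeff_def by (rule if_not_P)
  qed
  moreover have "la \<noteq> mu" using k by auto
  ultimately show ?thesis by simp
next
  case True
  let ?N = "la 0" and ?l = "cnj la" and ?m = "cnj mu"
  \<comment> \<open>For fixed \<open>la\<close> the strip condition lets each column of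
    \<open>ka\<close> range over its own interval, independently of the others, and such intervals
    always give weakly decreasing columns.\<close>
  let ?B = "\<lambda>k. {?l (Suc k)..?l k}"
  let ?f = "\<lambda>k y. (- 1) ^ (?l k - y) * qbinom q (?l k - ?l (Suc k)) (?l k - y)
    * (if ?m k \<le> y then q ^ (y - ?m k choose 2) * qbinom q (y - ?m (Suc k)) (y - ?m k) else 0)"
  let ?K = "{ka. ka \<in> partitions \<and> vstrip la ka}"
  let ?c = "\<lambda>g k. if k < ?N then g k else 0"
  have l0: "?l k = 0" if "k \<ge> ?N" for k using cnj_eq_0[OF la that] .
  have m0: "?m k = 0" if "k \<ge> ?N" for k using True l0[OF that] by (metis le_zero_eq)
  have gp: "?c g \<in> partitions" if g: "g \<in> Pi\<^sub>E {..<?N} ?B" for g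
  proof -
    have "?c g (Suc k) \<le> ?c g k" for k
    proof (cases "Suc k < ?N")
      case True
      then have "g (Suc k) \<le> ?l (Suc k)" "?l (Suc k) \<le> g k" using g by (fastforce simp: PiE_iff)+
      then show ?thesis using True by simp
    qed auto
    then have "antimono (?c g)" by (rule decseq_SucI)
    moreover have "finite {k. ?c g k \<noteq> 0}" by (rule finite_subset[of _ "{..<?N}"]) auto
    ultimately show ?thesis by (simp add: partitions_def)
  qed
  have factor: "(- 1) ^ (psize la - psize ka) * e_coeff q la ka * h_coeff q ka mu = (\<Prod>k<?N. ?f k (cnj ka k))"
    if ka: "ka \<in> partitions" "vstrip la ka" for ka
  proof -
    have kl: "cnj ka k \<le> ?l k" for k using ka by (simp add: vstrip_def)
    have k0: "cnj ka k = 0" if "k \<ge> ?N" for k using kl[of k] l0[OF that] by simp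
    have kaN: "ka 0 \<le> ?N" using less_cnj_iff[OF ka(1), of 0 ?N] k0[of ?N] by simp
    have "(\<Sum>k<?N. ?l k - cnj ka k) = (\<Sum>k<?N. ?l k) - (\<Sum>k<?N. cnj ka k)"
      using kl by (intro sum_subtractf_nat) auto
    also have "(\<Sum>k<?N. ?l k) = psize la"
      using psize_eq_sum[of ?N ?l] l0 psize_cnj[OF la] by simp
    also have "(\<Sum>k<?N. cnj ka k) = psize ka"
      using psize_eq_sum[of ?N "cnj ka"] k0 psize_cnj[OF ka(1)] by simp
    finally have s: "(- 1 :: real) ^ (psize la - psize ka) = (\<Prod>k<?N. (- 1) ^ (?l k - cnj ka k))"
      by (simp flip: power_sum)
    show ?thesis
    proof (cases "\<forall>k. ?m k \<le> cnj ka k")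
      case True
      then show ?thesis
        unfolding s e_coeff_eq[OF la ka(2) order_refl q] h_coeff_eq[OF ka(1) True kaN q]
        by (simp flip: prod.distrib)
    next
      case False
      then obtain k where k: "\<not> ?m k \<le> cnj ka k" by blast
      then have "k < ?N" using m0[of k] by (cases "k < ?N") auto
      then have "(\<Prod>k<?N. ?f k (cnj ka k)) = 0" using k by (intro prod_zero) auto
      moreover have "h_coeff q ka mu = 0" using False unfolding h_coeff_def by (rule if_not_P)
      ultimately show ?thesis by (simp only: mult_zero_right)
    qed
  qed
  have "(\<Sum>ka\<in>?K. (- 1) ^ (psize la - psize ka) * e_coeff q la ka * h_coeff q ka mu)
    = (\<Sum>ka\<in>?K. \<Prod>k<?N. ?f k (cnj ka k))"
    using factor by (intro sum.cong refl) auto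
  also have "\<dots> = (\<Sum>g\<in>Pi\<^sub>E {..<?N} ?B. \<Prod>k<?N. ?f k (g k))"
  proof (rule sum.reindex_bij_witness[of _ "\<lambda>g. cnj (?c g)" "\<lambda>ka. restrict (cnj ka) {..<?N}"])
    fix ka assume ka: "ka \<in> ?K"
    have k0: "cnj ka k = 0" if "k \<ge> ?N" for k using ka l0[OF that] by (auto simp: vstrip_def) (metis le_zero_eq)
    have "?c (restrict (cnj ka) {..<?N}) = cnj ka" using k0 by auto
    then show "cnj (?c (restrict (cnj ka) {..<?N})) = ka" using ka cnj_cnj by auto
    show "restrict (cnj ka) {..<?N} \<in> Pi\<^sub>E {..<?N} ?B" using ka by (auto simp: vstrip_def)
  next
    fix g assume g: "g \<in> Pi\<^sub>E {..<?N} ?B"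
    have c: "cnj (cnj (?c g)) = ?c g" by (rule cnj_cnj[OF gp[OF g]])
    show "restrict (cnj (cnj (?c g))) {..<?N} = g" unfolding c using g by (auto simp: PiE_iff extensional_def)
    have "vstrip la (cnj (?c g))"
      unfolding vstrip_def c using g l0 by (auto simp: PiE_iff)
    then show "cnj (?c g) \<in> ?K" using cnj_in_partitions[OF gp[OF g]] by simp
  next
    fix ka
    show "(\<Prod>k<?N. ?f k (restrict (cnj ka) {..<?N} k)) = (\<Prod>k<?N. ?f k (cnj ka k))"
      by (intro prod.cong refl) simp
  qed
  also have "\<dots> = (\<Prod>k<?N. \<Sum>y\<in>?B k. ?f k y)"
    by (rule prod_sum_PiE[symmetric]) auto
  also have "\<dots> = (if la = mu then 1 else 0)"
  proof (cases "la = mu")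
    case True
    have "(\<Sum>y\<in>?B k. ?f k y) = 1" for k
    proof -
      have "?l (Suc k) \<le> ?l k" using partition_le[OF cnj_in_partitions[OF la]] by simp
      then have "(\<Sum>y\<in>?B k. ?f k y) = (\<Sum>y\<in>{?l k}. ?f k y)"
        using True by (intro sum.mono_neutral_right) auto
      then show ?thesis using True q by (simp add: numeral_2_eq_2)
    qed
    then show ?thesis using True by simp
  next
    case False
    define D where "D = {k. ?m k < ?l k}"
    have "?l \<noteq> ?m" using False cnj_cnj[OF la] cnj_cnj[OF mu] by metis
    then obtain k where "?l k \<noteq> ?m k" by (auto simp: fun_eq_iff)
    then have "k \<in> D" using True[rule_format, of k] unfolding D_def by simp
    then have "D \<noteq> {}" by blast
    moreover have "D \<subseteq> {..<?N}" using l0 unfolding D_def by (auto simp: not_less[symmetric]) (metis less_zeroE not_less)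
    then have "finite D" by (rule finite_subset) simp
    ultimately have max: "Max D \<in> D" "\<And>k. k \<in> D \<Longrightarrow> k \<le> Max D" by auto
    let ?k = "Max D"
    have "Suc ?k \<notin> D" using max(2)[of "Suc ?k"] by auto
    \<comment> \<open>Behind the last difference the columns agree, so the interval for column
      \<open>?k\<close> starts at \<open>?m (Suc ?k)\<close>, the value of b needed in
      \<open>column_sum_zero\<close>.\<close>
    then have e: "?l (Suc ?k) = ?m (Suc ?k)" using True by (auto simp: D_def not_less intro: antisym)
    have "(\<Sum>y\<in>?B ?k. ?f ?k y) = 0"
      unfolding e using max(1) partition_le[OF cnj_in_partitions[OF mu], of ?k "Suc ?k"]
      by (intro column_sum_zero[OF q]) (auto simp: D_def)
    moreover have "?k < ?N" using max \<open>D \<subseteq> {..<?N}\<close> by auto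
    ultimately show ?thesis using False by (auto intro!: prod_zero)
  qed
  finally show ?thesis .
qed

definition h_mult :: "real \<Rightarrow> nat \<Rightarrow> (nat \<Rightarrow> nat) \<Rightarrow> nat \<Rightarrow> (nat \<Rightarrow> real) \<Rightarrow> real" where
  "h_mult q r mu n x = (\<Sum>la | la \<in> partitions \<and> psize la = psize mu + r. h_coeff q la mu * hl_P q la n x)"

text \<open>In generating functions: the series of \<open>h_mult\<close> times the product of the 1
  - z x_i is P_mu. Once the Pieri rule is applied, the coefficient of each P_lambda is the sum in
  \<open>e_h_inverse\<close>.\<close>

lemma h_mult_recurrence:
  assumes q: "0 < q" "q < 1" and x: "inj_on x {..<n}" and mu: "mu \<in> partitions"
  shows "(\<Sum>i\<le>r. (- 1) ^ i * elem_sym i n x * h_mult q (r - i) mu n x) = (if r = 0 then hl_P q mu n x else 0)"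
proof -
  let ?L = "{la. la \<in> partitions \<and> psize la = psize mu + r}"
  let ?K = "\<lambda>i. {ka. ka \<in> partitions \<and> psize ka = psize mu + (r - i)}"
  let ?t = "\<lambda>la ka. (- 1) ^ (psize la - psize ka) * e_coeff q la ka * h_coeff q ka mu"
  have "(- 1) ^ i * elem_sym i n x * h_mult q (r - i) mu n x
    = (\<Sum>la\<in>?L. (\<Sum>ka\<in>?K i. ?t la ka) * hl_P q la n x)" if i: "i \<le> r" for i
  proof -
    have "(- 1) ^ i * elem_sym i n x * h_mult q (r - i) mu n x
      = (\<Sum>ka\<in>?K i. (- 1) ^ i * h_coeff q ka mu * (elem_sym i n x * hl_P q ka n x))"
      unfolding h_mult_def sum_distrib_left by (intro sum.cong refl) (simp add: mult_ac)
    also have "\<dots> = (\<Sum>ka\<in>?K i. \<Sum>la\<in>?L. ?t la ka * hl_P q la n x)"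
    proof (intro sum.cong refl)
      fix ka assume ka: "ka \<in> ?K i"
      then have e: "psize ka + i = psize mu + r" using i by auto
      have "elem_sym i n x * hl_P q ka n x = (\<Sum>la\<in>?L. e_coeff q la ka * hl_P q la n x)"
        using elem_sym_pieri[OF q x, of ka i] ka unfolding e by simp
      moreover have "psize la - psize ka = i" if "la \<in> ?L" for la using that e by simp
      ultimately show "(- 1) ^ i * h_coeff q ka mu * (elem_sym i n x * hl_P q ka n x)
        = (\<Sum>la\<in>?L. ?t la ka * hl_P q la n x)"
        by (simp add: sum_distrib_left mult_ac)
    qed
    also have "\<dots> = (\<Sum>la\<in>?L. (\<Sum>ka\<in>?K i. ?t la ka) * hl_P q la n x)"
      by (subst sum.swap) (simp add: sum_distrib_right)
    finally show ?thesis .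
  qed
  then have "(\<Sum>i\<le>r. (- 1) ^ i * elem_sym i n x * h_mult q (r - i) mu n x)
    = (\<Sum>i\<le>r. \<Sum>la\<in>?L. (\<Sum>ka\<in>?K i. ?t la ka) * hl_P q la n x)" by simp
  also have "\<dots> = (\<Sum>la\<in>?L. (\<Sum>i\<le>r. \<Sum>ka\<in>?K i. ?t la ka) * hl_P q la n x)"
    by (subst sum.swap) (simp add: sum_distrib_right)
  also have "\<dots> = (\<Sum>la\<in>?L. (if la = mu then 1 else 0) * hl_P q la n x)"
  proof (intro sum.cong refl)
    fix la assume la: "la \<in> ?L"
    \<comment> \<open>The sum by degrees runs over \<open>?U\<close>, the sum in
      \<open>e_h_inverse\<close> over \<open>?V\<close>. They agree since \<open>e_coeff\<close>
      vanishes off \<open>?V\<close>, and \<open>h_coeff\<close> vanishes below the size of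
      \<open>mu\<close>.\<close>
    let ?U = "{ka. ka \<in> partitions \<and> psize mu \<le> psize ka \<and> psize ka \<le> psize la}"
    let ?V = "{ka. ka \<in> partitions \<and> vstrip la ka}"
    have fin: "finite ?U" "finite ?V"
      by (rule finite_subset[OF _ finite_partitions_psize_le[of "psize la"]];
          use la vstrip_psize_le(1)[of la] in auto)+
    have "(\<Sum>i\<le>r. \<Sum>ka\<in>?K i. ?t la ka) = (\<Sum>i\<le>r. \<Sum>ka | ka \<in> ?U \<and> psize la - psize ka = i. ?t la ka)"
      by (intro sum.cong refl) (use la in auto)
    also have "\<dots> = (\<Sum>ka\<in>?U. ?t la ka)"
      by (rule sum.group) (use la fin in auto)
    also have "\<dots> = (\<Sum>ka\<in>?U \<inter> ?V. ?t la ka)"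
      using fin by (intro sum.mono_neutral_right) (auto simp: e_coeff_def)
    also have "\<dots> = (\<Sum>ka\<in>?V. ?t la ka)"
    proof (rule sum.mono_neutral_left)
      show "\<forall>ka\<in>?V - ?U \<inter> ?V. ?t la ka = 0"
      proof
        fix ka assume ka: "ka \<in> ?V - ?U \<inter> ?V"
        then have "\<not> psize mu \<le> psize ka" using vstrip_psize_le(1)[of la ka] la by auto
        then have "\<not> (\<forall>k. cnj mu k \<le> cnj ka k)" using contained_psize_le[OF _ mu] ka by auto
        then have "h_coeff q ka mu = 0" unfolding h_coeff_def by (rule if_not_P)
        then show "?t la ka = 0" by simp
      qed
    qed (use fin in auto)
    also have "\<dots> = (if la = mu then 1 else 0)" using e_h_inverse[OF q _ mu, of la] la by auto
    finally show "(\<Sum>i\<le>r. \<Sum>ka\<in>?K i. ?t la ka) * hl_P q la n x = (if la = mu then 1 else 0) * hl_P q la n x"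
      by simp
  qed
  also have "\<dots> = (\<Sum>la\<in>?L. if la = mu then hl_P q mu n x else 0)"
    by (intro sum.cong refl) auto
  also have "\<dots> = (if r = 0 then hl_P q mu n x else 0)"
    using finite_partitions_psize[of "psize mu + r"] mu by (subst sum.delta) auto
  finally show ?thesis .
qed

text \<open>As e_0 = 1, the recurrence determines its solution degree by degree, and both sides
  satisfy it with the same value at r = 0.\<close>

lemma h_mult_eq:
  assumes q: "0 < q" "q < 1" and x: "inj_on x {..<n}" and mu: "mu \<in> partitions"
  shows "h_mult q r mu n x = h_mult q r (\<lambda>_. 0) n x * hl_P q mu n x"
proof (induction r rule: less_induct)
  case (less r)
  have head: "(\<Sum>i\<le>r. (- 1) ^ i * elem_sym i n x * h_mult q (r - i) ka n x)
    = h_mult q r ka n x + (\<Sum>i\<in>{..r} - {0}. (- 1) ^ i * elem_sym i n x * h_mult q (r - i) ka n x)" for ka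
    by (subst sum.remove[of _ 0]) auto
  let ?z = "\<lambda>_. 0 :: nat"
  have "h_mult q r mu n x + (\<Sum>i\<in>{..r} - {0}. (- 1) ^ i * elem_sym i n x * h_mult q (r - i) mu n x)
    = (h_mult q r ?z n x + (\<Sum>i\<in>{..r} - {0}. (- 1) ^ i * elem_sym i n x * h_mult q (r - i) ?z n x)) * hl_P q mu n x"
    unfolding head[symmetric] h_mult_recurrence[OF q x mu] h_mult_recurrence[OF q x partition_zero]
    using hl_P_zero[OF q x] by simp
  moreover have "(\<Sum>i\<in>{..r} - {0}. (- 1) ^ i * elem_sym i n x * h_mult q (r - i) mu n x)
    = (\<Sum>i\<in>{..r} - {0}. (- 1) ^ i * elem_sym i n x * h_mult q (r - i) ?z n x) * hl_P q mu n x"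
    unfolding sum_distrib_right
  proof (intro sum.cong refl)
    fix i assume "i \<in> {..r} - {0}"
    then have "r - i < r" by auto
    from less[OF this] show "(- 1) ^ i * elem_sym i n x * h_mult q (r - i) mu n x
      = (- 1) ^ i * elem_sym i n x * h_mult q (r - i) ?z n x * hl_P q mu n x" by simp
  qed
  ultimately show ?case by (simp add: distrib_right)
qed

lemma h_coeff_zero:
  assumes q: "0 < q" "q < 1" and nu: "nu \<in> partitions"
  shows "h_coeff q nu (\<lambda>_. 0) = q ^ pn nu"
proof -
  have "cnj (\<lambda>_. 0) k = 0" for k by (simp add: cnj_def)
  then show ?thesis unfolding h_coeff_def pn_eq[OF nu order_refl] using q by (simp add: power_sum)
qed

text \<open>Compares the coefficients of $P_\lambda$ in
  $h_r P_\mu = \sum_{|\nu| = r} q^{n(\nu)} P_\nu P_\mu$.\<close>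

lemma sum_hl_g:
  assumes q: "0 < q" "q < 1" and mu: "mu \<in> partitions"
    and la: "la \<in> partitions" "psize la = psize mu + r"
  shows "(\<Sum>nu | nu \<in> partitions \<and> psize nu = r. hl_g q mu nu la * q ^ pn nu / b_part q nu)
    = h_coeff q la mu * b_part q mu / b_part q la"
proof -
  let ?L = "{la. la \<in> partitions \<and> psize la = psize mu + r}"
  let ?R = "{nu. nu \<in> partitions \<and> psize nu = r}"
  let ?s = "\<lambda>la. \<Sum>nu\<in>?R. hl_g q mu nu la * q ^ pn nu / b_part q nu"
  have b: "b_part q la \<noteq> 0" for la using b_part_pos[OF q, of la] by simp
  have "h_coeff q la mu - ?s la * b_part q la / b_part q mu = 0"
  proof (rule hl_P_independent[OF q, of ?L "\<lambda>la. h_coeff q la mu - ?s la * b_part q la / b_part q mu"])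
    fix n and x :: "nat \<Rightarrow> real" assume x: "inj_on x {..<n}"
    have "(\<Sum>la\<in>?L. h_coeff q la mu * hl_P q la n x) = h_mult q r (\<lambda>_. 0) n x * hl_P q mu n x"
      using h_mult_eq[OF q x mu, of r] unfolding h_mult_def[of q r mu] .
    also have "\<dots> = (\<Sum>nu\<in>?R. q ^ pn nu * (hl_P q nu n x * hl_P q mu n x))"
      unfolding h_mult_def sum_distrib_right using h_coeff_zero[OF q]
      by (intro sum.cong) (auto simp: psize_def)
    also have "\<dots> = (\<Sum>nu\<in>?R. \<Sum>la\<in>?L. hl_g q mu nu la * q ^ pn nu / b_part q nu * b_part q la / b_part q mu * hl_P q la n x)"
    proof (intro sum.cong refl)
      fix nu assume nu: "nu \<in> ?R"
      have "hl_Q q mu n x * hl_Q q nu n x = (\<Sum>la\<in>?L. hl_g q mu nu la * hl_Q q la n x)"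
        using hl_g(2)[OF q mu _ x, of nu] nu by auto
      then have "hl_P q nu n x * hl_P q mu n x = (\<Sum>la\<in>?L. hl_g q mu nu la * hl_Q q la n x) / (b_part q mu * b_part q nu)"
        using b by (simp add: hl_Q_def field_simps)
      then show "q ^ pn nu * (hl_P q nu n x * hl_P q mu n x)
        = (\<Sum>la\<in>?L. hl_g q mu nu la * q ^ pn nu / b_part q nu * b_part q la / b_part q mu * hl_P q la n x)"
        by (simp add: hl_Q_def sum_distrib_left sum_divide_distrib mult_ac)
    qed
    also have "\<dots> = (\<Sum>la\<in>?L. ?s la * b_part q la / b_part q mu * hl_P q la n x)"
      by (subst sum.swap) (simp add: sum_distrib_right sum_divide_distrib)
    finally show "(\<Sum>la\<in>?L. (h_coeff q la mu - ?s la * b_part q la / b_part q mu) * hl_P q la n x) = 0"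
      by (simp add: left_diff_distrib sum_subtractf)
  qed (use la finite_partitions_psize in auto)
  then show ?thesis using b[of la] b[of mu] by (simp add: field_simps)
qed

section \<open>Principal specialisations and the surjection numbers\<close>

text \<open>At a geometric progression only the identity permutation contributes: every other one places
  some \<open>k + 1\<close> before \<open>k\<close>.\<close>

lemma hl_delta_geometric:
  assumes w: "w permutes {..<n}" "w \<noteq> id"
  shows "hl_delta q n (\<lambda>i. a * q ^ w i) = 0"
proof -
  have "\<exists>k. Suc k < n \<and> inv w (Suc k) < inv w k"
  proof (rule ccontr)
    assume *: "\<nexists>k. Suc k < n \<and> inv w (Suc k) < inv w k"
    have "k \<le> inv w k" if "k < n" for k
      using that
    proof (induction k)
      case (Suc k)
      have "inv w k \<noteq> inv w (Suc k)" 
        by (simp add: inj_eq[OF permutes_inj[OF permutes_inv[OF w(1)]]])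
      moreover have "\<not> inv w (Suc k) < inv w k" using * Suc.prems by blast
      ultimately have "inv w k < inv w (Suc k)" by linarith
      then show ?case using Suc by simp
    qed simp
    then have "inv w = id" by (intro permutes_natset_ge[OF permutes_inv[OF w(1)]]) auto
    then show False using w by (metis inv_id permutes_inv_inv)
  qed
  then obtain k where k: "Suc k < n" "inv w (Suc k) < inv w k" by blast
  have "inv w k < n" using permutes_in_image[OF permutes_inv[OF w(1)], of k] k by simp
  then show ?thesis unfolding hl_delta_def
    using k permutes_inverses(1)[OF w(1)]
    by (intro prod_zero[OF finite_less_pairs] bexI[of _ "(inv w (Suc k), inv w k)"]) auto
qed

lemma inj_on_geometric:
  assumes "0 < q" "q < (1::real)" "a \<noteq> 0"
  shows "inj_on (\<lambda>i. a * q ^ i) A"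
proof (rule inj_onI)
  fix i j :: nat assume "a * q ^ i = a * q ^ j"
  then have "q ^ i = q ^ j" using assms by simp
  then show "i = j" using assms
    by (metis linorder_neqE_nat order_less_irrefl power_strict_decreasing)
qed

text \<open>With one permutation left, the symmetriser multiplies f by a constant independent of f.
  Taking f = 1 reveals this constant through \<open>hl_sum_const\<close>.\<close>

lemma hl_P_geometric:
  assumes q: "0 < q" "q < 1" and "a \<noteq> 0" and la: "la \<in> partitions" "plength la \<le> n"
  shows "hl_P q la n (\<lambda>i. a * q ^ i)
    = a ^ psize la * q ^ pn la / b_part q la * (qpoch q q n / qpoch q q (n - plength la))"
proof -
  let ?x = "\<lambda>i. a * q ^ i"
  have sum: "hl_sum q n f ?x = f ?x * hl_delta q n ?x" for f
  proof -
    have "hl_sum q n f ?x = (\<Sum>w | w permutes {..<n}. if w = id then f ?x * hl_delta q n ?x else 0)"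
      unfolding hl_sum_def
      by (intro sum.cong refl) (auto simp: comp_def hl_delta_geometric)
    then show ?thesis by (simp add: finite_permutations permutes_id)
  qed
  have 1: "hl_delta q n ?x = qpoch q q n / (1 - q) ^ n"
    using sum[of "\<lambda>_. 1"] hl_sum_const[OF q inj_on_geometric[OF q \<open>a \<noteq> 0\<close>]] by simp
  have 2: "(\<Prod>i<m. a * q ^ i) = a ^ m * q ^ (m choose 2)" for m
    by (induction m) (simp_all add: numeral_2_eq_2 power_add)
  have "psize la = (\<Sum>k<la 0. cnj la k)"
    using psize_eq_sum[of "la 0" "cnj la"] cnj_eq_0[OF la(1)] psize_cnj[OF la(1)] by simp
  then have 3: "cmon (cnj la) (la 0) ?x = a ^ psize la * q ^ pn la"
    unfolding cmon_def 2 pn_eq[OF la(1) order_refl] by (simp add: prod.distrib power_sum)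
  show ?thesis
    unfolding hl_P_eq[OF la order_refl] sum 1 3 using q by simp
qed

lemma hl_P_principal_limit:
  assumes q: "0 < q" "q < 1" and "a \<noteq> 0" and la: "la \<in> partitions"
  shows "(\<lambda>n. hl_P q la n (\<lambda>i. a * q ^ i)) \<longlonglongrightarrow> a ^ psize la * q ^ pn la / b_part q la"
proof -
  have "(\<lambda>n. a ^ psize la * q ^ pn la / b_part q la * (qpoch q q n / qpoch q q (n - plength la)))
    \<longlonglongrightarrow> a ^ psize la * q ^ pn la / b_part q la * 1"
    by (intro tendsto_mult_left qpoch_ratio_limit[OF q])
  moreover have "eventually (\<lambda>n. a ^ psize la * q ^ pn la / b_part q la * (qpoch q q n / qpoch q q (n - plength la))
    = hl_P q la n (\<lambda>i. a * q ^ i)) sequentially"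
    using eventually_ge_at_top[of "plength la"]
    by eventually_elim (simp only: hl_P_geometric[OF q \<open>a \<noteq> 0\<close> la])
  ultimately show ?thesis unfolding mult_1_right by (rule Lim_transform_eventually)
qed

text \<open>The specialisations supply exactly the weights of \<open>sum_hl_g\<close>, so the skew
  function becomes a multiple of \<open>h_coeff\<close>. In each column the factor (q;q)_(m - m')
  from b_mu cancels a denominator of the q-binomial, and the powers of q balance by
  \<open>choose_two_diff\<close>.\<close>

lemma sur_eq:
  assumes p: "p > 1" and q: "q = 1 / p" and la: "la \<in> partitions" and mu: "mu \<in> partitions"
    and N: "la 0 \<le> N"
  shows "sur p la mu = (if \<forall>k. cnj mu k \<le> cnj la k
    then \<Prod>k<N. p ^ (cnj la k * cnj mu k) * qpoch q q (cnj la k - cnj mu (Suc k)) / qpoch q q (cnj la k - cnj mu k)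
    else 0)"
proof -
  have q01: "0 < q" "q < 1" using p q by auto
  have b: "b_part q la \<noteq> 0" for la using b_part_pos[OF q01, of la] by simp
  have pos: "qpoch q q i > 0" for i using qpoch_pos q01 by simp
  have shift: "(\<lambda>i. q ^ (i + 1)) = (\<lambda>i. q * q ^ i)" by auto
  have P: "at_seq (hl_P q la) (\<lambda>i. q ^ (i + 1)) = q ^ psize la * q ^ pn la / b_part q la"
    unfolding at_seq_def shift using q01 la by (intro limI hl_P_principal_limit) auto
  have Q: "at_seq (hl_Q q mu) (\<lambda>i. q ^ i) = q ^ pn mu"
  proof -
    have "(\<lambda>n. b_part q mu * hl_P q mu n (\<lambda>i. 1 * q ^ i)) \<longlonglongrightarrow> b_part q mu * (1 ^ psize mu * q ^ pn mu / b_part q mu)"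
      using q01 mu by (intro tendsto_mult_left hl_P_principal_limit) auto
    then show ?thesis unfolding at_seq_def hl_Q_def using b[of mu] by (intro limI) simp
  qed
  let ?G = "{nu. nu \<in> partitions \<and> hl_g q mu nu la \<noteq> 0}"
  have S: "at_seq (hl_P_skew q la mu) (\<lambda>i. q ^ (i + 1))
    = (\<Sum>nu\<in>?G. hl_g q mu nu la * (q ^ psize nu * q ^ pn nu / b_part q nu))"
    unfolding at_seq_def shift hl_P_skew_def using q01
    by (intro limI tendsto_sum tendsto_mult_left hl_P_principal_limit) auto
  show ?thesis
  proof (cases "psize mu \<le> psize la")
    case False
    have "?G = {}" using hl_g(1)[OF q01 mu, of _ la] False by fastforce
    then have "at_seq (hl_P_skew q la mu) (\<lambda>i. q ^ (i + 1)) = 0" unfolding S by (simp only: sum.empty)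
    then have "sur p la mu = 0" by (simp add: sur_def flip: q)
    moreover have "\<not> (\<forall>k. cnj mu k \<le> cnj la k)" using contained_psize_le[OF la mu] False by blast
    ultimately show ?thesis by (simp only: if_False)
  next
    case True
    then obtain r where r: "psize la = psize mu + r" using le_Suc_ex by blast
    have "at_seq (hl_P_skew q la mu) (\<lambda>i. q ^ (i + 1))
      = (\<Sum>nu | nu \<in> partitions \<and> psize nu = r. hl_g q mu nu la * (q ^ psize nu * q ^ pn nu / b_part q nu))"
      unfolding S using hl_g(1)[OF q01 mu, of _ la] r
      by (intro sum.mono_neutral_left finite_partitions_psize) auto
    also have "\<dots> = q ^ r * (\<Sum>nu | nu \<in> partitions \<and> psize nu = r. hl_g q mu nu la * q ^ pn nu / b_part q nu)"
      unfolding sum_distrib_left by (intro sum.cong refl) auto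
    also have "\<dots> = q ^ r * (h_coeff q la mu * b_part q mu / b_part q la)"
      unfolding sum_hl_g[OF q01 mu la r] ..
    finally have sur: "sur p la mu = q ^ r * (h_coeff q la mu * b_part q mu / b_part q la)
        / (q ^ psize la * q ^ pn la / b_part q la * q ^ pn mu)"
      unfolding sur_def Let_def q[symmetric] P Q by simp
    also have "\<dots> = h_coeff q la mu * b_part q mu / (q ^ psize mu * q ^ pn la * q ^ pn mu)"
      using b[of la] q01 unfolding r power_add by simp
    finally have sur: "sur p la mu = h_coeff q la mu * b_part q mu / (q ^ psize mu * q ^ pn la * q ^ pn mu)" .
    show ?thesis
    proof (cases "\<forall>k. cnj mu k \<le> cnj la k")
      case False
      then have "h_coeff q la mu = 0" unfolding h_coeff_def by (rule if_not_P)
      then show ?thesis unfolding sur if_not_P[OF False] by simp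
    next
      case True
      have m0: "cnj mu k = 0" if "k \<ge> N" for k
        using True cnj_eq_0[OF la, of k] N that by (metis le_trans le_zero_eq)
      have muN: "mu 0 \<le> N" using less_cnj_iff[OF mu, of 0 N] m0[of N] by simp
      have "psize mu = (\<Sum>k<N. cnj mu k)"
        using psize_eq_sum[of N "cnj mu"] m0 psize_cnj[OF mu] by simp
      then have den: "q ^ psize mu * q ^ pn la * q ^ pn mu
        = (\<Prod>k<N. q ^ (cnj mu k) * q ^ (cnj la k choose 2) * q ^ (cnj mu k choose 2))"
        unfolding pn_eq[OF la N] pn_eq[OF mu muN] by (simp add: power_sum prod.distrib)
      have "sur p la mu = (\<Prod>k<N. p ^ (cnj la k * cnj mu k) * qpoch q q (cnj la k - cnj mu (Suc k)) / qpoch q q (cnj la k - cnj mu k))"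
        unfolding sur den h_coeff_eq[OF la True N q01] b_part_eq[OF mu muN]
          prod.distrib[symmetric] prod_dividef[symmetric]
      proof (intro prod.cong refl)
        fix k
        let ?l = "cnj la k" and ?m = "cnj mu k" and ?m' = "cnj mu (Suc k)"
        have le: "?m' \<le> ?m" "?m \<le> ?l"
          using partition_le[OF cnj_in_partitions[OF mu], of k "Suc k"] True by auto
        have "q ^ (?l - ?m choose 2) * q ^ (?l * ?m) = q ^ ?m * q ^ (?l choose 2) * q ^ (?m choose 2)"
          using choose_two_diff[OF le(2)] by (simp flip: power_add) (simp add: add_ac)
        moreover have "q ^ (?l * ?m) * p ^ (?l * ?m) = 1"
          using p q by (simp flip: power_mult_distrib)
        ultimately have e: "q ^ (?l - ?m choose 2) = q ^ ?m * q ^ (?l choose 2) * q ^ (?m choose 2) * p ^ (?l * ?m)"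
          by (metis mult.assoc mult.right_neutral)
        have d: "?l - ?m' - (?l - ?m) = ?m - ?m'" "?l - ?m \<le> ?l - ?m'" using le by auto
        show "q ^ (?l - ?m choose 2) * qbinom q (?l - ?m') (?l - ?m) * qpoch q q (?m - ?m')
            / (q ^ ?m * q ^ (?l choose 2) * q ^ (?m choose 2))
          = p ^ (?l * ?m) * qpoch q q (?l - ?m') / qpoch q q (?l - ?m)"
          unfolding e qbinom_def d using d(2) q01 pos[of "?m - ?m'"] by simp
      qed
      then show ?thesis using True by simp
    qed
  qed
qed

section \<open>Summation over the columns\<close>

text \<open>Tonelli's principle: for nonnegative terms, summing the fibres and then their sums gives
  convergence together with the value.\<close>

lemma has_sum_nonneg_fibres:
  fixes f :: "'a \<Rightarrow> real" and h :: "'a \<Rightarrow> nat"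
  assumes nonneg: "\<And>a. a \<in> A \<Longrightarrow> f a \<ge> 0"
    and fib: "\<And>r. (f has_sum g r) {a \<in> A. h a = r}"
    and g: "(g has_sum S) UNIV"
  shows "(f has_sum S) A"
proof -
  let ?S = "Sigma UNIV (\<lambda>r. {a \<in> A. h a = r})"
  have fib': "((\<lambda>a. (f \<circ> snd) (r, a)) has_sum g r) {a \<in> A. h a = r}" for r using fib by simp
  have "(f \<circ> snd) summable_on ?S"
    by (rule summable_on_SigmaI[OF fib']) (use g nonneg in \<open>auto simp: summable_on_def\<close>)
  from has_sum_SigmaI[OF fib' g this] have "((f \<circ> snd) has_sum S) ?S" .
  then have "(f has_sum S) (snd ` ?S)"
    by (subst has_sum_reindex) (auto simp: inj_on_def)
  moreover have "snd ` ?S = A" by force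
  ultimately show ?thesis by simp
qed

section \<open>Column weights and their transfer recursion\<close>

text \<open>The share of a column of length c with right neighbour c' in u^|lambda| q^(2 n(lambda) +
  |lambda|) / b_lambda times the surjection number; m and m' are the matching columns of mu. The
  square is 2 * (c choose 2) + c, and \<open>col_weight_cnj\<close> justifies the form.\<close>

definition col_factor :: "real \<Rightarrow> real \<Rightarrow> nat \<Rightarrow> nat \<Rightarrow> nat \<Rightarrow> nat \<Rightarrow> real" where
  "col_factor q u m m' c c' =
     u ^ c * q ^ c\<^sup>2 * (1 / q) ^ (c * m) * qpoch q q (c - m') / (qpoch q q (c - m) * qpoch q q (c - c'))"

text \<open>Here m and c are sequences of column lengths, that is, conjugate partitions, so
  \<open>plength c\<close> is the number of columns.\<close>

definition col_weight :: "real \<Rightarrow> real \<Rightarrow> (nat \<Rightarrow> nat) \<Rightarrow> (nat \<Rightarrow> nat) \<Rightarrow> real" where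
  "col_weight q u m c = (if \<forall>k. m k \<le> c k
     then \<Prod>k<plength c. col_factor q u (m k) (m (Suc k)) (c k) (c (Suc k)) else 0)"

lemma partition_plength: "c \<in> partitions \<Longrightarrow> c k = 0 \<longleftrightarrow> plength c \<le> k"
  using partition_support[of c k] by (auto simp: plength_eq_cnj not_less)

lemma col_weight_eq:
  assumes c: "c \<in> partitions" "plength c \<le> N" and m: "\<forall>k. m k \<le> c k"
  shows "col_weight q u m c = (\<Prod>k<N. col_factor q u (m k) (m (Suc k)) (c k) (c (Suc k)))"
proof -
  have 0: "c k = 0 \<and> m k = 0" if "k \<ge> plength c" for k
    using that partition_plength[OF c(1), of k] m by (metis le_zero_eq)
  have "col_factor q u (m k) (m (Suc k)) (c k) (c (Suc k)) = 1" if "k \<ge> plength c" for k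
    using 0[OF that] 0[of "Suc k"] that by (simp add: col_factor_def)
  then have "(\<Prod>k<plength c. col_factor q u (m k) (m (Suc k)) (c k) (c (Suc k)))
    = (\<Prod>k<N. col_factor q u (m k) (m (Suc k)) (c k) (c (Suc k)))"
    using c(2) by (intro prod.mono_neutral_left ballI) (auto simp: not_less)
  then show ?thesis unfolding col_weight_def using m by simp
qed

lemma col_weight_nonneg:
  assumes "0 < q" "q < 1" "0 < u"
  shows "col_weight q u m c \<ge> 0"
proof -
  have "qpoch q q i \<ge> 0" for i using qpoch_pos[of q q i] assms by simp
  then have "col_factor q u a b i j \<ge> 0" for a b i j
    unfolding col_factor_def using assms by (intro mult_nonneg_nonneg divide_nonneg_nonneg) auto
  then show ?thesis unfolding col_weight_def by (auto intro: prod_nonneg)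
qed

definition pcons :: "nat \<Rightarrow> (nat \<Rightarrow> nat) \<Rightarrow> nat \<Rightarrow> nat" where
  "pcons r c k = (case k of 0 \<Rightarrow> r | Suc j \<Rightarrow> c j)"

lemma pcons_simps [simp]: "pcons r c 0 = r" "pcons r c (Suc k) = c k"
  by (simp_all add: pcons_def)

lemma pcons_tail: "pcons (c 0) (\<lambda>k. c (Suc k)) = c"
  by (rule ext) (simp add: pcons_def split: nat.split)

lemma partitions_tail:
  assumes "c \<in> partitions"
  shows "(\<lambda>k. c (Suc k)) \<in> partitions"
  using assms finite_vimageI[of "{i. c i \<noteq> 0}" Suc]
  by (auto simp: partitions_def antimono_def vimage_def)

lemma pcons_in_partitions:
  assumes "c \<in> partitions" "c 0 \<le> r"
  shows "pcons r c \<in> partitions"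
proof -
  have "pcons r c (Suc k) \<le> pcons r c k" for k
    using assms partition_le[OF assms(1)] by (cases k) auto
  then have "antimono (pcons r c)" by (rule decseq_SucI)
  moreover have "{k. pcons r c k \<noteq> 0} \<subseteq> insert 0 (Suc ` {k. c k \<noteq> 0})"
  proof
    fix k assume "k \<in> {k. pcons r c k \<noteq> 0}"
    then show "k \<in> insert 0 (Suc ` {k. c k \<noteq> 0})" by (cases k) auto
  qed
  ultimately show ?thesis using assms partitionsD(2)[OF assms(1)]
    by (auto simp: partitions_def intro: finite_subset)
qed

lemma bij_betw_pcons:
  "bij_betw (pcons r) {c \<in> partitions. c 0 \<le> r} {c \<in> partitions. c 0 = r}"
proof (rule bij_betw_byWitness[where f' = "\<lambda>c k. c (Suc k)"])
  show "\<forall>c\<in>{c \<in> partitions. c 0 = r}. pcons r (\<lambda>k. c (Suc k)) = c" using pcons_tail by auto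
  show "(\<lambda>c k. c (Suc k)) ` {c \<in> partitions. c 0 = r} \<subseteq> {c \<in> partitions. c 0 \<le> r}"
    using partition_le partitions_tail by auto
qed (use pcons_in_partitions in auto)

lemma col_weight_pcons:
  assumes c: "c \<in> partitions" "c 0 \<le> r"
  shows "col_weight q u m (pcons r c)
    = (if m 0 \<le> r then col_factor q u (m 0) (m 1) r (c 0) * col_weight q u (\<lambda>k. m (Suc k)) c else 0)"
proof (cases "\<forall>k. m k \<le> pcons r c k")
  case True
  then have m: "m 0 \<le> r" "\<forall>k. m (Suc k) \<le> c k" using pcons_simps by metis+
  have "plength (pcons r c) \<le> Suc (plength c)"
    using partition_plength[OF pcons_in_partitions[OF c], of "Suc (plength c)"]
      partition_plength[OF c(1), of "plength c"] by simp
  from col_weight_eq[OF pcons_in_partitions[OF c] this True]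
  have "col_weight q u m (pcons r c) = col_factor q u (m 0) (m 1) r (c 0) *
    (\<Prod>k<plength c. col_factor q u (m (Suc k)) (m (Suc (Suc k))) (c k) (c (Suc k)))"
    unfolding prod.lessThan_Suc_shift by simp
  then show ?thesis using m by (simp add: col_weight_def)
next
  case False
  then obtain k where "\<not> m k \<le> pcons r c k" by blast
  then have "m 0 \<le> r \<Longrightarrow> \<not> (\<forall>k. m (Suc k) \<le> c k)" by (cases k) auto
  then show ?thesis unfolding col_weight_def if_not_P[OF False] by (cases "m 0 \<le> r") auto
qed

text \<open>\<open>col_sum\<close> is the total weight of all \<open>c\<close> with first column at most \<open>k\<close>, weighted by
  $1/(q;q)_{k - c_0}$, and \<open>fibre_sum\<close> is the total weight of all \<open>c\<close> with first column \<open>r\<close>.\<close>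

definition col_sum :: "real \<Rightarrow> real \<Rightarrow> (nat \<Rightarrow> nat) \<Rightarrow> nat \<Rightarrow> real" where
  "col_sum q u m k = (if m 0 \<le> k then u ^ psize m / (qpoch (u * q) q k * qpoch q q (k - m 0)) else 0)"

definition fibre_sum :: "real \<Rightarrow> real \<Rightarrow> (nat \<Rightarrow> nat) \<Rightarrow> nat \<Rightarrow> real" where
  "fibre_sum q u m r = (if m 0 \<le> r
     then u ^ (psize m - m 0 + r) * q ^ r\<^sup>2 * (1 / q) ^ (r * m 0) / (qpoch q q (r - m 0) * qpoch (u * q) q r) else 0)"

text \<open>A preceding column of length k influences c only through the bound c 0 \<le> k and the
  factor 1/(q;q)_(k - c 0). Summing this weight therefore sums out everything to the right of that
  column.\<close>

definition cut_weight :: "real \<Rightarrow> real \<Rightarrow> (nat \<Rightarrow> nat) \<Rightarrow> nat \<Rightarrow> (nat \<Rightarrow> nat) \<Rightarrow> real" where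
  "cut_weight q u m k c = (if c 0 \<le> k then col_weight q u m c / qpoch q q (k - c 0) else 0)"

lemma psize_partition_tail:
  assumes "m \<in> partitions"
  shows "psize m = m 0 + psize (\<lambda>k. m (Suc k))"
proof -
  have "psize m = (\<Sum>k<Suc (plength m). m k)"
    by (rule psize_eq_sum) (use partition_plength[OF assms] in auto)
  also have "\<dots> = m 0 + (\<Sum>k<plength m. m (Suc k))" by (rule sum.lessThan_Suc_shift)
  also have "(\<Sum>k<plength m. m (Suc k)) = psize (\<lambda>k. m (Suc k))"
    by (rule psize_eq_sum[symmetric]) (use partition_plength[OF assms] in auto)
  finally show ?thesis .
qed

text \<open>Once the first column is r, the others carry the weight \<open>cut_weight\<close> with k
  = r for the tail of m; the numerator (q;q)_(r - m 1) cancels a denominator of the tail's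
  \<open>col_sum\<close>.\<close>

lemma fibre_has_sum:
  assumes q: "0 < q" "q < 1" and m: "m \<in> partitions"
    and tail: "\<And>k. (cut_weight q u (\<lambda>k. m (Suc k)) k has_sum col_sum q u (\<lambda>k. m (Suc k)) k) partitions"
  shows "(col_weight q u m has_sum fibre_sum q u m r) {c \<in> partitions. c 0 = r}"
proof -
  let ?t = "\<lambda>k. m (Suc k)"
  let ?a = "u ^ r * q ^ r\<^sup>2 * (1 / q) ^ (r * m 0) * qpoch q q (r - m 1) / qpoch q q (r - m 0)"
  have pos: "qpoch q q i > 0" for i using qpoch_pos q by simp
  have "((\<lambda>c. if m 0 \<le> r then ?a * cut_weight q u ?t r c else 0) has_sum fibre_sum q u m r) {c \<in> partitions. c 0 \<le> r}"
  proof (cases "m 0 \<le> r")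
    case True
    have m1: "m 1 \<le> m 0" using partition_le[OF m] by simp
    have "((\<lambda>c. ?a * cut_weight q u ?t r c) has_sum ?a * col_sum q u ?t r) partitions"
      by (intro has_sum_cmult_right tail)
    also have "?a * col_sum q u ?t r = fibre_sum q u m r"
      using True m1 pos[of "r - m 1"] psize_partition_tail[OF m]
      by (simp add: col_sum_def fibre_sum_def power_add mult_ac)
    finally have "((\<lambda>c. ?a * cut_weight q u ?t r c) has_sum fibre_sum q u m r) partitions" .
    then have "((\<lambda>c. ?a * cut_weight q u ?t r c) has_sum fibre_sum q u m r) {c \<in> partitions. c 0 \<le> r}"
      by (subst has_sum_cong_neutral[where T = partitions and g = "\<lambda>c. ?a * cut_weight q u ?t r c"])
         (auto simp: cut_weight_def)
    then show ?thesis using True by simp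
  qed (simp add: fibre_sum_def)
  also have "?this \<longleftrightarrow> ((\<lambda>c. col_weight q u m (pcons r c)) has_sum fibre_sum q u m r) {c \<in> partitions. c 0 \<le> r}"
    by (intro has_sum_cong) (auto simp: col_weight_pcons cut_weight_def col_factor_def)
  also have "\<dots> \<longleftrightarrow> ?thesis" by (rule has_sum_reindex_bij_betw[OF bij_betw_pcons])
  finally show ?thesis .
qed

text \<open>After the shift r = m 0 + s this is \<open>qbinom_vandermonde\<close> at v = u q^(m 0):
  subtracting r * m 0 from r^2 leaves s^2 + m 0 * s, and the linear part is absorbed into v.\<close>

lemma sum_fibre_sum:
  assumes q: "0 < q" "q < 1" and u: "0 < u" "u * q < 1" and m: "m \<in> partitions"
  shows "(\<Sum>r\<le>k. fibre_sum q u m r / qpoch q q (k - r)) = col_sum q u m k"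
proof (cases "m 0 \<le> k")
  case False
  then show ?thesis by (intro trans[OF sum.neutral]) (auto simp: fibre_sum_def col_sum_def)
next
  case True
  let ?m = "m 0" and ?K = "k - m 0"
  define v where "v = u * q ^ ?m"
  have pos: "qpoch q q i > 0" for i using qpoch_pos q by simp
  have upos: "qpoch (u * q) q i > 0" for i using qpoch_pos q u by simp
  have "q ^ ?m \<le> 1" using q by (simp add: power_le_one)
  then have v: "0 \<le> v" "v * q < 1"
  proof -
    have "v * q \<le> u * q" unfolding v_def using \<open>q ^ ?m \<le> 1\<close> u q by (simp add: mult_left_le)
    then show "v * q < 1" using u by simp
    show "0 \<le> v" unfolding v_def using u q by simp
  qed
  have uadd: "qpoch (u * q) q (?m + s) = qpoch (u * q) q ?m * qpoch (v * q) q s" for s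
    unfolding qpoch_add v_def by (simp add: mult_ac)
  have "(\<Sum>r\<le>k. fibre_sum q u m r / qpoch q q (k - r)) = (\<Sum>r=?m..k. fibre_sum q u m r / qpoch q q (k - r))"
    by (rule sum.mono_neutral_right) (auto simp: fibre_sum_def)
  also have "\<dots> = (\<Sum>s\<le>?K. fibre_sum q u m (?m + s) / qpoch q q (k - (?m + s)))"
    by (rule sum.reindex_bij_witness[of _ "\<lambda>s. ?m + s" "\<lambda>r. r - ?m"]) (use True in auto)
  also have "\<dots> = (\<Sum>s\<le>?K. u ^ psize m / (qpoch (u * q) q ?m * qpoch q q ?K)
      * (v ^ s * q ^ s\<^sup>2 * qbinom q ?K s / qpoch (v * q) q s))"
  proof (intro sum.cong refl)
    fix s assume s: "s \<in> {..?K}"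
    have "(?m + s)\<^sup>2 = s\<^sup>2 + ?m * s + (?m + s) * ?m" by (simp add: power2_eq_square algebra_simps)
    then have "q ^ (?m + s)\<^sup>2 * (1 / q) ^ ((?m + s) * ?m) = q ^ s\<^sup>2 * (q ^ ?m) ^ s"
      using q by (simp add: power_add power_one_over power_mult)
    then have "u ^ (psize m - ?m + (?m + s)) * q ^ (?m + s)\<^sup>2 * (1 / q) ^ ((?m + s) * ?m)
      = u ^ psize m * (v ^ s * q ^ s\<^sup>2)"
      using psize_partition_tail[OF m] by (simp add: power_add v_def power_mult_distrib mult_ac)
    then show "fibre_sum q u m (?m + s) / qpoch q q (k - (?m + s))
      = u ^ psize m / (qpoch (u * q) q ?m * qpoch q q ?K) * (v ^ s * q ^ s\<^sup>2 * qbinom q ?K s / qpoch (v * q) q s)"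
      using s pos[of ?K] True unfolding fibre_sum_def qbinom_def uadd by simp
  qed
  also have "\<dots> = u ^ psize m / (qpoch (u * q) q ?m * qpoch q q ?K) * (1 / qpoch (v * q) q ?K)"
    unfolding sum_distrib_left[symmetric] qbinom_vandermonde[OF q v] ..
  also have "\<dots> = col_sum q u m k"
    using True uadd[of ?K] by (simp add: col_sum_def mult_ac)
  finally show ?thesis .
qed

lemma cut_weight_has_sum:
  assumes q: "0 < q" "q < 1" and u: "0 < u" "u * q < 1" and m: "m \<in> partitions"
    and fib: "\<And>r. (col_weight q u m has_sum fibre_sum q u m r) {c \<in> partitions. c 0 = r}"
  shows "(cut_weight q u m k has_sum col_sum q u m k) partitions"
proof (rule has_sum_nonneg_fibres[where h = "\<lambda>c. c 0"])
  let ?g = "\<lambda>r. if r \<le> k then fibre_sum q u m r / qpoch q q (k - r) else 0"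
  show "cut_weight q u m k c \<ge> 0" for c
    unfolding cut_weight_def using col_weight_nonneg[OF q u(1)] qpoch_pos[of q q] q by (simp add: less_imp_le)
  show "(cut_weight q u m k has_sum ?g r) {c \<in> partitions. c 0 = r}" for r
  proof (cases "r \<le> k")
    case True
    have "((\<lambda>c. col_weight q u m c * (1 / qpoch q q (k - r))) has_sum fibre_sum q u m r * (1 / qpoch q q (k - r))) {c \<in> partitions. c 0 = r}"
      by (rule has_sum_cmult_left[OF fib])
    also have "fibre_sum q u m r * (1 / qpoch q q (k - r)) = ?g r" using True by simp
    also have "((\<lambda>c. col_weight q u m c * (1 / qpoch q q (k - r))) has_sum ?g r) {c \<in> partitions. c 0 = r}
      \<longleftrightarrow> (cut_weight q u m k has_sum ?g r) {c \<in> partitions. c 0 = r}"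
      using True by (intro has_sum_cong) (auto simp: cut_weight_def)
    finally show ?thesis .
  next
    case False
    then show ?thesis by (intro has_sum_finite_neutralI[of "{}"]) (auto simp: cut_weight_def)
  qed
  show "(?g has_sum col_sum q u m k) UNIV"
    unfolding sum_fibre_sum[OF q u m, symmetric]
    by (rule has_sum_finite_neutralI[of "{..k}"]) auto
qed

text \<open>Monotonicity and boundedness provide a limit, and for \<rho> < 1 the limiting equation
  has C as its only solution.\<close>

lemma recursion_limit:
  fixes a b :: "nat \<Rightarrow> real"
  assumes "incseq a" "\<And>n. a n \<le> C" "\<And>n. a (Suc n) = \<rho> * a n + b n" "b \<longlonglongrightarrow> C - \<rho> * C" "\<rho> < 1"
  shows "a \<longlonglongrightarrow> C"
proof -
  obtain L where L: "a \<longlonglongrightarrow> L" using incseq_convergent[OF assms(1)] assms(2) by blast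
  have "(\<lambda>n. \<rho> * a n + b n) \<longlonglongrightarrow> \<rho> * L + (C - \<rho> * C)"
    by (intro tendsto_intros L assms(4))
  then have "(\<lambda>n. a (Suc n)) \<longlonglongrightarrow> \<rho> * L + (C - \<rho> * C)" by (simp only: assms(3))
  then have "L = \<rho> * L + (C - \<rho> * C)" by (rule LIMSEQ_unique[OF LIMSEQ_Suc[OF L]])
  then have "(1 - \<rho>) * (L - C) = 0" by (simp add: algebra_simps)
  then show ?thesis using L assms(5) by simp
qed

text \<open>For \<open>m = 0\<close> the partial sums over at most \<open>N\<close> columns obey a recursion of which \<open>col_sum\<close> is
  the fixed point.\<close>

lemma cut_weight_has_sum_zero:
  assumes q: "0 < q" "q < 1" and u: "0 < u" "u * q < 1"
  shows "(cut_weight q u (\<lambda>_. 0) k has_sum col_sum q u (\<lambda>_. 0) k) partitions"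
proof -
  let ?z = "\<lambda>_. 0 :: nat"
  define F where "F N k = {c \<in> partitions. c 0 \<le> k \<and> plength c \<le> N}" for N k
  define G where "G N k = (\<Sum>c\<in>F N k. cut_weight q u ?z k c)" for N k
  let ?\<rho> = "\<lambda>r. u ^ r * q ^ r\<^sup>2"
  let ?B = "col_sum q u ?z"
  have pos: "qpoch q q i > 0" for i using qpoch_pos q by simp
  have rho: "?\<rho> r \<ge> 0" for r using u q by simp
  have nonneg: "cut_weight q u ?z k c \<ge> 0" for k c
    unfolding cut_weight_def using col_weight_nonneg[OF q u(1)] pos by (simp add: less_imp_le)
  have fin: "finite (F N k)" for N k
  proof (rule finite_subset)
    show "F N k \<subseteq> {f. \<forall>i. (i \<in> {..<N} \<longrightarrow> f i \<in> {..k}) \<and> (i \<notin> {..<N} \<longrightarrow> f i = 0)}"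
    proof
      fix c assume c: "c \<in> F N k"
      then have "c i \<le> k" for i using partition_le[of c 0 i] by (auto simp: F_def)
      moreover have "c i = 0" if "i \<ge> N" for i
        using c that partition_plength[of c i] by (auto simp: F_def)
      ultimately show "c \<in> {f. \<forall>i. (i \<in> {..<N} \<longrightarrow> f i \<in> {..k}) \<and> (i \<notin> {..<N} \<longrightarrow> f i = 0)}" by simp
    qed
    show "finite {f. \<forall>i. (i \<in> {..<N} \<longrightarrow> f i \<in> {..k}) \<and> (i \<notin> {..<N} \<longrightarrow> f i = (0::nat))}"
      by (rule finite_set_of_finite_funs) auto
  qed
  have G0: "G 0 k = 1 / qpoch q q k" for k
  proof -
    have "F 0 k = {?z}"
      unfolding F_def using partition_eq_zero by (auto simp: partition_zero plength_def)
    then show ?thesis by (simp add: G_def cut_weight_def col_weight_def plength_def)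
  qed
  have GSuc: "G (Suc N) k = (\<Sum>r\<le>k. ?\<rho> r / qpoch q q (k - r) * G N r)" for N k
  proof -
    have "(\<Sum>r\<le>k. ?\<rho> r / qpoch q q (k - r) * G N r)
      = (\<Sum>r\<le>k. \<Sum>c\<in>F N r. ?\<rho> r / qpoch q q (k - r) * cut_weight q u ?z r c)"
      by (simp add: G_def sum_distrib_left)
    also have "\<dots> = (\<Sum>(r, c)\<in>Sigma {..k} (F N). ?\<rho> r / qpoch q q (k - r) * cut_weight q u ?z r c)"
      using fin by (subst sum.Sigma) auto
    also have "\<dots> = G (Suc N) k"
      unfolding G_def
    proof (rule sum.reindex_bij_witness[of _ "\<lambda>c. (c 0, \<lambda>k. c (Suc k))" "\<lambda>(r, c). pcons r c"])
      fix p assume p: "p \<in> Sigma {..k} (F N)"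
      obtain r c where rc: "p = (r, c)" "r \<le> k" "c \<in> partitions" "c 0 \<le> r" "plength c \<le> N"
        using p by (auto simp: F_def)
      show "((case p of (r, c) \<Rightarrow> pcons r c) 0, \<lambda>k. (case p of (r, c) \<Rightarrow> pcons r c) (Suc k)) = p"
        using rc by simp
      have "c N = 0" using rc partition_plength[OF rc(3)] by simp
      then have "plength (pcons r c) \<le> Suc N"
        using partition_plength[OF pcons_in_partitions[OF rc(3,4)], of "Suc N"] by simp
      then show "(case p of (r, c) \<Rightarrow> pcons r c) \<in> F (Suc N) k"
        using rc pcons_in_partitions[OF rc(3,4)] by (simp add: F_def)
      show "cut_weight q u ?z k (case p of (r, c) \<Rightarrow> pcons r c)
        = (case p of (r, c) \<Rightarrow> ?\<rho> r / qpoch q q (k - r) * cut_weight q u ?z r c)"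
        using rc pos[of r] by (simp add: cut_weight_def col_weight_pcons col_factor_def)
    next
      fix c assume c: "c \<in> F (Suc N) k"
      then have "plength (\<lambda>k. c (Suc k)) \<le> N"
        using partition_plength[of c "Suc N"] partition_plength[OF partitions_tail, of c N] by (simp add: F_def)
      then show "(c 0, \<lambda>k. c (Suc k)) \<in> Sigma {..k} (F N)"
        using c partitions_tail partition_le[of c 0 1] by (simp add: F_def)
    qed (auto simp: pcons_tail)
    finally show ?thesis by simp
  qed
  have Beq: "?B k = (\<Sum>r\<le>k. ?\<rho> r / qpoch q q (k - r) * ?B r)" for k
    using sum_fibre_sum[OF q u partition_zero, of k]
    by (simp add: fibre_sum_def col_sum_def psize_def mult_ac)
  have incF: "incseq (\<lambda>N. F N k)" for k by (rule incseq_SucI) (auto simp: F_def)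
  have incG: "incseq (\<lambda>N. G N k)" for k
    unfolding G_def using fin nonneg incF[of k] by (intro incseq_SucI sum_mono2) (auto simp: incseq_Suc_iff)
  have GB: "G N k \<le> ?B k" for N k
  proof (induction N arbitrary: k)
    case 0
    have "qpoch (u * q) q k \<le> 1" unfolding qpoch_def
    proof (rule prod_le_1)
      fix i
      have "u * q * q ^ i \<le> 1 * 1" using u q by (intro mult_mono power_le_one) auto
      then show "0 \<le> 1 - u * q * q ^ i \<and> 1 - u * q * q ^ i \<le> 1" using u q by simp
    qed
    then have "1 / qpoch q q k \<le> 1 / (qpoch (u * q) q k * qpoch q q k)"
      using pos[of k] qpoch_pos[OF q u(2), of k] by (simp add: field_simps)
    then show ?case by (simp add: G0 col_sum_def psize_def)
  next
    case (Suc N)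
    show ?case unfolding GSuc Beq[of k]
      using Suc rho pos by (intro sum_mono mult_left_mono divide_nonneg_nonneg) (auto simp: less_imp_le)
  qed
  \<comment> \<open>The recursion for k involves k itself through r = k, which is handled by
    \<open>recursion_limit\<close>; the terms with r < k converge by the induction
    hypothesis.\<close>
  have lim: "(\<lambda>N. G N k) \<longlonglongrightarrow> ?B k" for k
  proof (induction k rule: less_induct)
    case (less k)
    have split: "(\<Sum>r\<le>k. f r) = f k + (\<Sum>r<k. f r)" for f :: "nat \<Rightarrow> real"
      by (simp add: lessThan_Suc_atMost[symmetric])
    show ?case
    \<comment> \<open>For k = 0 the factor \<open>?\<rho> 0\<close> is 1 and there is no
      contraction, but then all columns are empty and the sums are constant.\<close>
    proof (cases "k = 0")
      case True
      have "G N 0 = 1" for N by (induction N) (simp_all add: G0 GSuc)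
      then show ?thesis using True by (simp add: col_sum_def psize_def)
    next
      case False
      show ?thesis
      proof (rule recursion_limit[OF incG GB])
        show "G (Suc N) k = ?\<rho> k * G N k + (\<Sum>r<k. ?\<rho> r / qpoch q q (k - r) * G N r)" for N
          unfolding GSuc split by simp
        have "(\<lambda>N. \<Sum>r<k. ?\<rho> r / qpoch q q (k - r) * G N r) \<longlonglongrightarrow> (\<Sum>r<k. ?\<rho> r / qpoch q q (k - r) * ?B r)"
          by (intro tendsto_sum tendsto_mult_left less) auto
        also have "(\<Sum>r<k. ?\<rho> r / qpoch q q (k - r) * ?B r) = ?B k - ?\<rho> k * ?B k"
          using Beq[of k] unfolding split by simp
        finally show "(\<lambda>N. \<Sum>r<k. ?\<rho> r / qpoch q q (k - r) * G N r) \<longlonglongrightarrow> ?B k - ?\<rho> k * ?B k" .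
        \<comment> \<open>Since t may be negative, u may exceed 1; only u q < 1 is available, so one
          q has to be paired with each u.\<close>
        have "k * k = k + k * (k - 1)" using False by (cases k) auto
        then have "?\<rho> k = (u * q) ^ k * q ^ (k * (k - 1))"
          by (simp add: power2_eq_square power_mult_distrib power_add)
        also have "\<dots> \<le> (u * q) ^ k * 1" using u q by (intro mult_left_mono power_le_one) auto
        also have "\<dots> < 1" using u q False by (simp add: power_less_one_iff)
        finally show "?\<rho> k < 1" .
      qed
    qed
  qed
  have "(cut_weight q u ?z k has_sum ?B k) {c \<in> partitions. c 0 \<le> k}"
  proof (rule has_sum_nonneg_exhaustion[where F = "\<lambda>N. F N k"])
    show "(\<Union>N. F N k) = {c \<in> partitions. c 0 \<le> k}" by (auto simp: F_def)
    show "(\<lambda>N. sum (cut_weight q u ?z k) (F N k)) \<longlonglongrightarrow> ?B k" using lim[of k] by (simp add: G_def)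
  qed (use nonneg fin incF in auto)
  then show ?thesis
    by (subst has_sum_cong_neutral[where T = "{c \<in> partitions. c 0 \<le> k}" and g = "cut_weight q u ?z k"])
       (auto simp: cut_weight_def)
qed

text \<open>The columns of mu are peeled off one by one: each level turns the sums for the tail of m
  into fibre sums and these into sums for m, starting from
  \<open>cut_weight_has_sum_zero\<close>.\<close>

lemma col_weight_fibre_has_sum:
  assumes q: "0 < q" "q < 1" and u: "0 < u" "u * q < 1" and m: "m \<in> partitions"
  shows "(col_weight q u m has_sum fibre_sum q u m r) {c \<in> partitions. c 0 = r}"
proof -
  have "(cut_weight q u m k has_sum col_sum q u m k) partitions"
    if "m \<in> partitions" "plength m \<le> N" for N m k
    using that
  proof (induction N arbitrary: m k)
    case 0
    then have "m = (\<lambda>_. 0)" by (intro partition_eq_zero) auto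
    then show ?case using cut_weight_has_sum_zero[OF q u] by simp
  next
    case (Suc N)
    have "plength (\<lambda>k. m (Suc k)) \<le> N"
      using partition_plength[OF Suc.prems(1), of "Suc N"] Suc.prems
        partition_plength[OF partitions_tail[OF Suc.prems(1)], of N] by simp
    then show ?case
      by (intro cut_weight_has_sum[OF q u Suc.prems(1)] fibre_has_sum[OF q Suc.prems(1)] Suc.IH
          partitions_tail Suc.prems(1))
  qed
  from this[OF partitions_tail[OF m] order_refl] show ?thesis by (rule fibre_has_sum[OF q m])
qed

text \<open>Both measures deviate from the common column weight only by a function of the number of
  parts, that is, of the first column. A is that function, and the other columns have already been
  summed out.\<close>

lemma col_weight_has_sum:
  assumes q: "0 < q" "q < 1" and u: "0 < u" "u * q < 1" and m: "m \<in> partitions"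
    and A: "\<And>r. A r \<ge> 0" "((\<lambda>r. A r * fibre_sum q u m r) has_sum T) UNIV"
  shows "((\<lambda>c. A (c 0) * col_weight q u m c) has_sum T) partitions"
proof (rule has_sum_nonneg_fibres[where h = "\<lambda>c. c 0", OF _ _ A(2)])
  show "((\<lambda>c. A (c 0) * col_weight q u m c) has_sum A r * fibre_sum q u m r) {c \<in> partitions. c 0 = r}" for r
  proof -
    have "((\<lambda>c. A r * col_weight q u m c) has_sum A r * fibre_sum q u m r) {c \<in> partitions. c 0 = r}"
      by (intro has_sum_cmult_right col_weight_fibre_has_sum[OF q u m])
    also have "?this \<longleftrightarrow> ?thesis" by (intro has_sum_cong) auto
    finally show ?thesis .
  qed
qed (use A(1) col_weight_nonneg[OF q u(1)] in auto)

lemma col_weight_cnj: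
  assumes p: "p > 1" and q: "q = 1 / p" and la: "la \<in> partitions" and mu: "mu \<in> partitions"
  shows "u ^ psize la * q ^ (2 * pn la + psize la) / b_part q la * sur p la mu
    = col_weight q u (cnj mu) (cnj la)"
proof (cases "\<forall>k. cnj mu k \<le> cnj la k")
  case True
  let ?N = "la 0"
  have "psize la = (\<Sum>k<?N. cnj la k)"
    using psize_eq_sum[of ?N "cnj la"] cnj_eq_0[OF la] psize_cnj[OF la] by simp
  then have "u ^ psize la * q ^ (2 * pn la + psize la)
    = (\<Prod>k<?N. u ^ cnj la k) * (\<Prod>k<?N. q ^ (cnj la k)\<^sup>2)"
    unfolding pn_eq[OF la order_refl]
    by (simp add: square_eq_choose power_sum[symmetric] sum.distrib sum_distrib_left)
  then have "u ^ psize la * q ^ (2 * pn la + psize la) / b_part q la * sur p la mu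
    = (\<Prod>k<?N. col_factor q u (cnj mu k) (cnj mu (Suc k)) (cnj la k) (cnj la (Suc k)))"
    using True q unfolding sur_eq[OF p q la mu order_refl] b_part_eq[OF la order_refl] col_factor_def
    by (simp add: prod.distrib prod_dividef mult_ac)
  also have "\<dots> = col_weight q u (cnj mu) (cnj la)"
    using True plength_cnj[OF la] by (simp add: col_weight_def)
  finally show ?thesis .
next
  case False
  then have "col_weight q u (cnj mu) (cnj la) = 0" unfolding col_weight_def by (rule if_not_P)
  then show ?thesis unfolding sur_eq[OF p q la mu order_refl] if_not_P[OF False] by simp
qed

section \<open>Evaluation of the two moments\<close>

lemma qpoch_square: "qpoch (x\<^sup>2) (q\<^sup>2) n = qpoch x q n * qpoch (- x) q n"
  unfolding qpoch_def prod.distrib[symmetric]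
  by (intro prod.cong refl) (simp add: power2_eq_square power_mult_distrib algebra_simps)

text \<open>The denominator (q^(2t+2);q^2)_d factors as (uq;q)_d (-uq;q)_d, and its first factor
  cancels against \<open>P_d\<close>.\<close>

lemma P_d1_eq:
  assumes q: "0 < q" "q < 1" and t: "t > -1" and u: "u = q powr t"
  shows "P_d1 q d t la = u ^ psize la * q ^ (2 * pn la + psize la) / b_part q la
    * (qpoch q q (plength la) * qbinom q d (plength la) * qpoch (u * q) q (plength la)
        / (q ^ (plength la choose 2) * qpoch (- (u * q)) q d))"
proof -
  have uq: "q powr (t + 1) = u * q" using q u by (simp add: powr_add)
  have "u * q < 1" unfolding uq[symmetric] using q t by (simp add: powr01_less_one)
  then have "qpoch (u * q) q d > 0" using qpoch_pos q by simp
  moreover have "q powr (2 * t + 2) = (u * q)\<^sup>2"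
    unfolding uq[symmetric] using q by (simp add: powr_power)
  ultimately show ?thesis
    unfolding P_d1_def P_d_def using q
    by (simp add: uq qpoch_square powr_minus powr_realpow divide_inverse u[symmetric] mult_ac)
qed

text \<open>The factor (uq;q)_r of the measures cancels the same denominator of
  \<open>fibre_sum\<close>, and division by q^(r choose 2) lowers the quadratic exponent from s^2 to
  s choose 2, up to a linear term. This is why the first column calls for a q-binomial or Euler sum;
  B holds what the finite and the infinite case do not share.\<close>

lemma fibre_sum_shift:
  assumes q: "0 < q" "q < 1" and u: "0 < u" "u * q < 1" and m: "m \<in> partitions"
  shows "B * qpoch (u * q) q (m 0 + s) / q ^ (m 0 + s choose 2) * fibre_sum q u m (m 0 + s)
    = u ^ psize m / q ^ (m 0 choose 2) * (B * (q ^ (s choose 2) * (u * q) ^ s / qpoch q q s))"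
proof -
  let ?m = "m 0"
  have upos: "qpoch (u * q) q (?m + s) > 0" using qpoch_pos q u by simp
  have "(?m + s)\<^sup>2 + (m 0 choose 2) = (?m + s) * ?m + (?m + s choose 2) + (s choose 2) + s"
    unfolding choose_two_add using square_eq_choose[of s] by (simp add: power2_eq_square algebra_simps)
  then have "q ^ (?m + s)\<^sup>2 * q ^ (m 0 choose 2)
    = q ^ ((?m + s) * ?m) * q ^ (?m + s choose 2) * q ^ (s choose 2) * q ^ s"
    by (simp flip: power_add)
  then have "q ^ (?m + s)\<^sup>2 * (1 / q) ^ ((?m + s) * ?m) / q ^ (?m + s choose 2)
    = q ^ (s choose 2) * q ^ s / q ^ (m 0 choose 2)"
    using q by (simp add: power_one_over field_simps)
  then have main: "u ^ (psize m - ?m + (?m + s)) * (q ^ (?m + s)\<^sup>2 * (1 / q) ^ ((?m + s) * ?m) / q ^ (?m + s choose 2))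
    = u ^ psize m / q ^ (m 0 choose 2) * (q ^ (s choose 2) * (u * q) ^ s)"
    using psize_partition_tail[OF m] by (simp add: power_add power_mult_distrib mult_ac)
  have "B * qpoch (u * q) q (?m + s) / q ^ (?m + s choose 2) * fibre_sum q u m (?m + s)
    = B / qpoch q q s *
      (u ^ (psize m - ?m + (?m + s)) * (q ^ (?m + s)\<^sup>2 * (1 / q) ^ ((?m + s) * ?m) / q ^ (?m + s choose 2)))"
    unfolding fibre_sum_def using upos by simp
  then show ?thesis unfolding main by (simp add: mult_ac)
qed

theorem theorem1p12:
  fixes p q t :: real and d :: nat and mu :: "nat \<Rightarrow> nat"
  assumes "p > 1" and "q = 1 / p" and "t > -1" and "d \<ge> 1" and "mu \<in> partitions"
  shows "((\<lambda>la. P_d1 q d t la * sur p la mu) summable_on partitions \<and>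
          moment p mu (P_d1 q d t) =
            q powr (t * real (psize mu) - real (plength mu choose 2)) * qpoch q q (plength mu)
              / qpoch (- (q powr (real d + t + 1 - real (plength mu)))) q (plength mu)
              * qbinom q d (plength mu)) \<and>
         ((\<lambda>la. P_inf1 q t la * sur p la mu) summable_on partitions \<and>
          moment p mu (P_inf1 q t) = p powr (real (plength mu choose 2) - t * real (psize mu)))"
proof -
  note p = assms(1) and qp = assms(2) and t = assms(3) and mu = assms(5)
  have q: "0 < q" "q < 1" using p qp by auto
  define u where "u = q powr t"
  define m where "m = cnj mu"
  define l where "l = plength mu"
  have m: "m \<in> partitions" "m 0 = l" "psize m = psize mu"
    unfolding m_def l_def using mu by (auto simp: cnj_in_partitions cnj_0 psize_cnj)
  have uq: "q powr (t + 1) = u * q" using q by (simp add: u_def powr_add)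
  have u: "0 < u" "u * q < 1"
    unfolding uq[symmetric] using q t by (auto simp: powr01_less_one u_def)
  have pos: "qpoch q q i > 0" and upos: "qpoch (u * q) q i > 0" and npos: "qpoch (- (u * q)) q i > 0" for i
    using qpoch_pos q u by (auto intro!: qpoch_pos) (smt (verit) mult_pos_pos)
  have uq0: "u * q \<ge> 0" using u q by simp

  \<comment> \<open>Conjugation carries the sum over \<open>la\<close> to a sum over column
    sequences c, with \<open>plength la\<close> becoming c 0.\<close>
  have moment: "(\<lambda>la. nu la * sur p la mu) summable_on partitions \<and> moment p mu nu = T"
    if nu: "\<And>la. la \<in> partitions \<Longrightarrow> nu la = u ^ psize la * q ^ (2 * pn la + psize la) / b_part q la * A (plength la)"
      and A: "\<And>r. A r \<ge> 0" "((\<lambda>r. A r * fibre_sum q u m r) has_sum T) UNIV" for nu A T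
  proof -
    have "((\<lambda>c. A (c 0) * col_weight q u m c) has_sum T) partitions"
      by (rule col_weight_has_sum[OF q u m(1) A])
    then have "((\<lambda>la. A (cnj la 0) * col_weight q u m (cnj la)) has_sum T) partitions"
      using has_sum_reindex_bij_betw[OF bij_betw_cnj, of "\<lambda>c. A (c 0) * col_weight q u m c" T] by simp
    also have "?this \<longleftrightarrow> ((\<lambda>la. nu la * sur p la mu) has_sum T) partitions"
      by (intro has_sum_cong)
         (simp add: nu cnj_0 m_def col_weight_cnj[OF p qp _ mu, of _ u, symmetric])
    finally show ?thesis by (auto simp: moment_def summable_on_def infsumI)
  qed
  have fib_UNIV: "((\<lambda>r. A r * fibre_sum q u m r) has_sum T) UNIV"
    if "((\<lambda>s. A (l + s) * fibre_sum q u m (l + s)) has_sum T) UNIV" for A T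
  proof -
    have "((\<lambda>r. A r * fibre_sum q u m r) has_sum T) (range (\<lambda>s. l + s))"
      using that by (subst has_sum_reindex) (auto simp: comp_def)
    also have "?this \<longleftrightarrow> ?thesis"
    proof (rule has_sum_cong_neutral)
      fix r assume "r \<in> UNIV - range (\<lambda>s. l + s)"
      then have "r < l" by (metis Diff_iff le_Suc_ex not_le rangeI)
      then show "A r * fibre_sum q u m r = 0" by (simp add: fibre_sum_def m(2))
    qed auto
    finally show ?thesis .
  qed

  let ?A = "\<lambda>r. qpoch q q r * qbinom q d r * qpoch (u * q) q r / (q ^ (r choose 2) * qpoch (- (u * q)) q d)"
  let ?T = "q powr (t * real (psize mu) - real (l choose 2)) * qpoch q q l
      / qpoch (- (q powr (real d + t + 1 - real l))) q l * qbinom q d l"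
  have U: "q powr (t * real (psize mu) - real (l choose 2)) = u ^ psize mu / q ^ (l choose 2)"
    using q by (simp add: powr_diff u_def powr_realpow powr_power mult.commute)
  have fin: "((\<lambda>s. ?A (l + s) * fibre_sum q u m (l + s)) has_sum ?T) UNIV"
  proof (cases "l \<le> d")
    case False
    then show ?thesis by simp
  next
    case True
    \<comment> \<open>The q-binomial theorem will produce (-uq;q)_(d - l); splitting the denominator
      at d - l leaves the l factors that appear in the moment.\<close>
    have dl: "qpoch (- (u * q)) q d = qpoch (- (u * q)) q (d - l) * qpoch (- (q powr (real d + t + 1 - real l))) q l"
    proof -
      have "q powr (real d + t + 1 - real l) = u * q * q ^ (d - l)"
        using True q uq powr_realpow[of q "d - l"] powr_add[of q "t + 1" "real (d - l)"]
        by (simp add: of_nat_diff algebra_simps)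
      then show ?thesis using qpoch_add[of "- (u * q)" q "d - l" l] True by simp
    qed
    have val: "?A (l + s) * fibre_sum q u m (l + s)
      = u ^ psize mu / q ^ (l choose 2) * (qpoch q q d / qpoch q q (d - l) / qpoch (- (u * q)) q d)
        * (q ^ (s choose 2) * (u * q) ^ s * qbinom q (d - l) s)" for s
    proof (cases "l + s \<le> d")
      case le: True
      have "?A (l + s) = qpoch q q d / qpoch q q (d - (l + s)) / qpoch (- (u * q)) q d
          * qpoch (u * q) q (l + s) / q ^ (l + s choose 2)"
        using le pos[of "l + s"] by (simp add: qbinom_def)
      then have "?A (l + s) * fibre_sum q u m (l + s) = u ^ psize mu / q ^ (l choose 2) *
        (qpoch q q d / qpoch q q (d - (l + s)) / qpoch (- (u * q)) q d * (q ^ (s choose 2) * (u * q) ^ s / qpoch q q s))"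
        using fibre_sum_shift[OF q u m(1), of "qpoch q q d / qpoch q q (d - (l + s)) / qpoch (- (u * q)) q d" s,
            unfolded m(2,3)] by (simp only:)
      then show ?thesis using le pos[of "d - l"] by (simp add: qbinom_def)
    next
      case False
      then have "d < l + s" "d - l < s" using True by auto
      then show ?thesis by simp
    qed
    have "(\<Sum>s\<le>d - l. ?A (l + s) * fibre_sum q u m (l + s))
      = u ^ psize mu / q ^ (l choose 2) * (qpoch q q d / qpoch q q (d - l) / qpoch (- (u * q)) q d)
        * qpoch (- (u * q)) q (d - l)"
      unfolding val sum_distrib_left[symmetric] qpoch_eq_sum_qbinom[OF q, of "u * q" "d - l"] ..
    also have "\<dots> = ?T"
      unfolding U dl using True pos[of l] npos[of "d - l"] by (simp add: qbinom_def)
    finally have sum: "(\<Sum>s\<le>d - l. ?A (l + s) * fibre_sum q u m (l + s)) = ?T" .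
    show ?thesis unfolding sum[symmetric]
      by (rule has_sum_finite_neutralI[of "{..d - l}"]) (use True in auto)
  qed
  have A0: "?A r \<ge> 0" for r
    using pos[of r] upos[of r] npos[of d] qbinom_nonneg[OF q, of d r] q by (simp add: less_imp_le)
  have first: "(\<lambda>la. P_d1 q d t la * sur p la mu) summable_on partitions \<and> moment p mu (P_d1 q d t) = ?T"
    by (rule moment[OF _ A0 fib_UNIV[OF fin]]) (rule P_d1_eq[OF q t u_def])

  \<comment> \<open>E is (-uq;q)_infinity. It normalises the limiting measure and is also the sum of
    Euler's series, so it drops out of the moment.\<close>
  obtain E where E: "E > 0" "(\<lambda>n. qpoch (- (u * q)) q n) \<longlonglongrightarrow> E"
    "((\<lambda>s. q ^ (s choose 2) * (u * q) ^ s / qpoch q q s) has_sum E) UNIV"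
    using euler_expansion[OF q uq0] by blast
  let ?B = "\<lambda>r. 1 / E * qpoch (u * q) q r / q ^ (r choose 2)"
  have inf: "P_inf1 q t la = u ^ psize la * q ^ (2 * pn la + psize la) / b_part q la * ?B (plength la)" for la
  proof -
    let ?l = "plength la"
    have "(\<lambda>d. u ^ psize la * q ^ (2 * pn la + psize la) / b_part q la
      * (qpoch q q ?l * qbinom q d ?l * qpoch (u * q) q ?l / (q ^ (?l choose 2) * qpoch (- (u * q)) q d)))
      \<longlonglongrightarrow> u ^ psize la * q ^ (2 * pn la + psize la) / b_part q la
      * (qpoch q q ?l * (1 / qpoch q q ?l) * qpoch (u * q) q ?l / (q ^ (?l choose 2) * E))"
      using E q by (intro tendsto_intros qbinom_limit[OF q]) auto
    then show ?thesis
      unfolding P_inf1_def P_d1_eq[OF q t u_def] using pos[of ?l] by (intro limI) (simp add: mult_ac)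
  qed
  have "((\<lambda>s. u ^ psize mu / q ^ (l choose 2) * (1 / E * (q ^ (s choose 2) * (u * q) ^ s / qpoch q q s)))
    has_sum u ^ psize mu / q ^ (l choose 2) * (1 / E * E)) UNIV"
    by (intro has_sum_cmult_right E(3))
  also have "u ^ psize mu / q ^ (l choose 2) * (1 / E * E) = p powr (real (l choose 2) - t * real (psize mu))"
  proof -
    have "q powr y = p powr - y" for y using p qp by (simp add: powr_divide powr_minus_divide)
    then show ?thesis using U E(1) by simp
  qed
  finally have "((\<lambda>s. ?B (l + s) * fibre_sum q u m (l + s)) has_sum
      p powr (real (l choose 2) - t * real (psize mu))) UNIV"
    using fibre_sum_shift[OF q u m(1), of "1 / E"] m by simp
  moreover have "?B r \<ge> 0" for r using upos[of r] E q by (simp add: less_imp_le)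
  ultimately have second: "(\<lambda>la. P_inf1 q t la * sur p la mu) summable_on partitions
    \<and> moment p mu (P_inf1 q t) = p powr (real (l choose 2) - t * real (psize mu))"
    by (intro moment[where A = ?B] fib_UNIV inf)
  show ?thesis using first second unfolding l_def by blast
qed

end
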